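(* Let $\varphi=P(x)dx^{\otimes 3}$ be a polynomial cubic differential on $\mathbf{P}^1$, with $P$ a polynomial of degree $d$. Then $\varphi$ has at most $\frac{d(d-1)(d-2)}{6}$ (unoriented) critical tripods.
   Context: Away from the zeros of $P$ and $\infty$, branches of $\int^z\varphi^{1/3}$ give charts to $\mathbb{C}$ with transition maps $z\mapsto e^{2\pi i r/3}z+c$, hence a flat metric $|\varphi^{1/3}|$, and slopes of straight segments are defined modulo $2\pi/3$. A trajectory is an oriented arc that is locally a straight segment in these charts and contains no singularity (zero or pole of $\varphi$) except possibly at its endpoints. A tripod is a collection of three trajectories (of arbitrary, not necessarily real, slope), of the same slope modulo $2\pi/3$, intersecting at a point (so that they meet there with mutual angles $\frac{2\pi}{3}$). It is a critical tripod if each of the three trajectories starts at a zero of $\varphi$. *)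

theory Defs
  imports "HOL-Complex_Analysis.Complex_Analysis" "HOL-Computational_Algebra.Polynomial"
begin

text \<open>
  The cubic differential \<open>P(x) dx\<^sup>3\<close> is represented by the polynomial \<open>P\<close>. Its only pole is at
  infinity. All arcs below are arcs in the complex plane: the legs of a critical tripod run
  from a zero to a regular point and avoid singularities in between, so they never meet infinity.
\<close>

text \<open>A flat chart is an injective branch of the integral of \<open>P\<^bsup>1/3\<^esup>\<close>.\<close>

definition flat_chart :: "complex poly \<Rightarrow> complex set \<Rightarrow> (complex \<Rightarrow> complex) \<Rightarrow> bool" where
  "flat_chart P U w \<longleftrightarrow>
     open U \<and> connected U \<and> (\<forall>z\<in>U. poly P z \<noteq> 0) \<and>
     w holomorphic_on U \<and> inj_on w U \<and> (\<forall>z\<in>U. deriv w z ^ 3 = poly P z)"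

text \<open>
  Near the parameter \<open>t\<^sub>0\<close>, the chart \<open>w\<close> maps the oriented arc \<open>\<gamma>\<close> onto a straight segment
  traversed in the direction \<open>cis \<theta>\<close>. No particular parametrization is prescribed.
\<close>

definition straight_in_chart ::
  "complex set \<Rightarrow> (complex \<Rightarrow> complex) \<Rightarrow> (real \<Rightarrow> complex) \<Rightarrow> real \<Rightarrow> real \<Rightarrow> bool" where
  "straight_in_chart U w \<gamma> \<theta> t\<^sub>0 \<longleftrightarrow>
     (\<exists>\<epsilon>>0. \<gamma> ` (ball t\<^sub>0 \<epsilon> \<inter> {0..1}) \<subseteq> U \<and>
       (\<forall>s \<in> ball t\<^sub>0 \<epsilon> \<inter> {0..1}. \<forall>t \<in> ball t\<^sub>0 \<epsilon> \<inter> {0..1}.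
          s < t \<longrightarrow> (\<exists>r>0. w (\<gamma> t) - w (\<gamma> s) = complex_of_real r * cis \<theta>)))"

definition straight_at :: "complex poly \<Rightarrow> (real \<Rightarrow> complex) \<Rightarrow> real \<Rightarrow> real \<Rightarrow> bool" where
  "straight_at P \<gamma> \<theta> t\<^sub>0 \<longleftrightarrow> (\<exists>U w. flat_chart P U w \<and> straight_in_chart U w \<gamma> \<theta> t\<^sub>0)"

definition trajectory :: "complex poly \<Rightarrow> (real \<Rightarrow> complex) \<Rightarrow> bool" where
  "trajectory P \<gamma> \<longleftrightarrow>
     arc \<gamma> \<and> (\<forall>t\<in>{0<..<1}. poly P (\<gamma> t) \<noteq> 0) \<and>
     (\<forall>t\<in>{0..1}. poly P (\<gamma> t) \<noteq> 0 \<longrightarrow> (\<exists>\<theta>. straight_at P \<gamma> \<theta> t))"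

text \<open>
  Flat charts may be multiplied by cube roots of unity, so \<open>\<theta>\<close> matters only modulo
  \<open>2 * pi / 3\<close>: two trajectories have the same slope modulo \<open>2 * pi / 3\<close> iff they share a \<open>\<theta>\<close>.
\<close>

definition has_slope :: "complex poly \<Rightarrow> (real \<Rightarrow> complex) \<Rightarrow> real \<Rightarrow> bool" where
  "has_slope P \<gamma> \<theta> \<longleftrightarrow> (\<forall>t\<in>{0..1}. poly P (\<gamma> t) \<noteq> 0 \<longrightarrow> straight_at P \<gamma> \<theta> t)"

text \<open>
  The legs are \<open>\<gamma> 0, \<gamma> 1, \<gamma> 2\<close>, oriented towards the point \<open>p\<close> where they meet and listed
  counterclockwise around it. The point \<open>p\<close> is not a zero of \<open>P\<close>: there the total angle
  exceeds \<open>2 * pi\<close>, so three legs cannot have mutual angles \<open>2 * pi / 3\<close>.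
\<close>

definition tripod :: "complex poly \<Rightarrow> (nat \<Rightarrow> real \<Rightarrow> complex) \<Rightarrow> bool" where
  "tripod P \<gamma> \<longleftrightarrow>
     (\<forall>k<3. trajectory P (\<gamma> k)) \<and>
     (\<exists>\<theta>. (\<forall>k<3. has_slope P (\<gamma> k) \<theta>) \<and>
       (\<exists>p. (\<forall>k<3. pathfinish (\<gamma> k) = p) \<and> poly P p \<noteq> 0 \<and>
         (\<exists>U w. flat_chart P U w \<and> p \<in> U \<and>
           (\<forall>k<3. straight_in_chart U w (\<gamma> k) (\<theta> + 2 * pi * real k / 3) 1))))"

definition critical_tripod :: "complex poly \<Rightarrow> (nat \<Rightarrow> real \<Rightarrow> complex) \<Rightarrow> bool" where
  "critical_tripod P \<gamma> \<longleftrightarrow> tripod P \<gamma> \<and> (\<forall>k<3. poly P (pathstart (\<gamma> k)) = 0)"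

text \<open>
  Forgetting orientation, parametrization and numbering, a tripod becomes the set of the
  three point sets traced out by its legs.
\<close>

definition unoriented_critical_tripods :: "complex poly \<Rightarrow> complex set set set" where
  "unoriented_critical_tripods P =
     {(\<lambda>k. path_image (\<gamma> k)) ` {..<3} | \<gamma>. critical_tripod P \<gamma>}"

end

theory Submission
  imports Defs "HOL-Computational_Algebra.Fundamental_Theorem_Algebra"
begin

text \<open>
  The flat metric \<open>\<bar>P\<bar>\<^bsup>1/3\<^esup> \<bar>dz\<bar>\<close> extends to the zeros of \<open>P\<close>, where a zero of order \<open>m\<close> becomes a cone
  point of angle \<open>2 * pi * (1 + m / 3) > 2 * pi\<close>. So the plane is locally a \<open>CAT(0)\<close> space, and since it
  is simply connected, the distance between two local geodesics \<open>\<alpha>, \<beta>\<close> on \<open>[0, 1]\<close>, compared at equal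
  parameters, lies below the affine function with the same values at the ends.

  The legs of a tripod are local geodesics from the point \<open>p\<close> where they meet to their zeros, and
  their initial directions add up to zero. Given two tripods ending at the same three zeros, convexity
  along corresponding legs bounds the variation of the distances \<open>d (c k r) (c' k r)\<close>, while \<open>p\<close> and
  \<open>p'\<close> are barycentres of the nearby points of the legs, so that \<open>d p p'\<close> is at most the mean of these
  distances. This forces \<open>p = p'\<close>: in the case of equality all leg lengths differ by exactly \<open>d p p'\<close>,
  and a small change of speed of one tripod gives a strict inequality. Geodesics with common end points
  coincide, so a critical tripod is determined by its three zeros, which are distinct. There are
  at most \<open>d choose 3\<close> triples of zeros.
\<close>

section \<open>Pointwise Lipschitz constants\<close>

text \<open>The obstacle is the passage from local to global: triangle comparison holds only below
  some scale, while legs may be long. Geodesics between arbitrary points are never constructed. The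
  two given curves are sampled and joined by finitely many intermediate rows of points. Replacing
  points by midpoints of their neighbours fixes sampled local geodesics and pushes the distance of
  nearby rows below an affine function; the triangle inequality adds up these bounds. All rows must
  stay in one compact set, so that a single scale serves; this is why the chains joining the ends
  need a Euclidean length bound independent of their mesh.

  The distance is a supremum over functions whose gradient is bounded by the density. Upper bounds
  then come from integrating every such function along one explicit curve, lower bounds from one
  explicit function, and zeros of the density do no harm.

  The cone exponent \<open>\<kappa>\<close> is \<open>1 + m / 3\<close> at a zero of order
  \<open>m\<close>. As it is at least 1, unrolling the cone into a plane around a midpoint does not
  increase distances to the two ends, so that comparison reduces to Apollonius' formula.\<close>

definition ptwise_lipschitz :: "('a::metric_space \<Rightarrow> real) \<Rightarrow> 'a \<Rightarrow> real \<Rightarrow> bool" where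
  "ptwise_lipschitz f x c \<longleftrightarrow> (\<forall>e>0. \<forall>\<^sub>F y in nhds x. \<bar>f y - f x\<bar> \<le> (c + e) * dist y x)"

lemma ptwise_lipschitzI:
  assumes "\<And>e. e > 0 \<Longrightarrow> \<forall>\<^sub>F y in nhds x. \<bar>f y - f x\<bar> \<le> (c + e) * dist y x"
  shows "ptwise_lipschitz f x c"
  using assms by (auto simp: ptwise_lipschitz_def)

lemma ptwise_lipschitzD:
  assumes "ptwise_lipschitz f x c" "e > 0"
  shows "\<forall>\<^sub>F y in nhds x. \<bar>f y - f x\<bar> \<le> (c + e) * dist y x"
  using assms by (auto simp: ptwise_lipschitz_def)

lemma ptwise_lipschitz_of_bound:
  assumes "\<forall>\<^sub>F y in nhds x. \<bar>f y - f x\<bar> \<le> c * dist y x"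
  shows "ptwise_lipschitz f x c"
proof (rule ptwise_lipschitzI)
  fix e :: real assume "e > 0"
  show "\<forall>\<^sub>F y in nhds x. \<bar>f y - f x\<bar> \<le> (c + e) * dist y x"
    using assms
  proof eventually_elim
    case (elim y)
    have "c * dist y x \<le> (c + e) * dist y x"
      using \<open>e > 0\<close> by (intro mult_right_mono) auto
    then show ?case using elim by linarith
  qed
qed

lemma ptwise_lipschitz_mono:
  assumes "ptwise_lipschitz f x c" "c \<le> c'"
  shows "ptwise_lipschitz f x c'"
proof (rule ptwise_lipschitzI)
  fix e :: real assume "e > 0"
  show "\<forall>\<^sub>F y in nhds x. \<bar>f y - f x\<bar> \<le> (c' + e) * dist y x"
    using ptwise_lipschitzD[OF assms(1) \<open>e > 0\<close>]
  proof eventually_elim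
    case (elim y)
    have "(c + e) * dist y x \<le> (c' + e) * dist y x"
      using assms(2) by (intro mult_right_mono) auto
    then show ?case using elim by linarith
  qed
qed

lemma ptwise_lipschitz_dominated:
  assumes "ptwise_lipschitz g x c" "\<forall>\<^sub>F y in nhds x. \<bar>f y - f x\<bar> \<le> \<bar>g y - g x\<bar>"
  shows "ptwise_lipschitz f x c"
proof (rule ptwise_lipschitzI)
  fix e :: real assume "e > 0"
  show "\<forall>\<^sub>F y in nhds x. \<bar>f y - f x\<bar> \<le> (c + e) * dist y x"
    using ptwise_lipschitzD[OF assms(1) \<open>e > 0\<close>] assms(2)
    by eventually_elim linarith
qed

lemma ptwise_lipschitz_uminus:
  "ptwise_lipschitz f x c \<Longrightarrow> ptwise_lipschitz (\<lambda>y. - f y) x c"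
  by (erule ptwise_lipschitz_dominated) (auto intro!: always_eventually)

text \<open>Unlike differentiability, pointwise bounds survive maxima and minima; the truncated test
  functions that give lower bounds for distances rely on this.\<close>

lemma ptwise_lipschitz_max:
  assumes "ptwise_lipschitz f x c" "ptwise_lipschitz g x c"
  shows "ptwise_lipschitz (\<lambda>y. max (f y) (g y)) x c"
proof (rule ptwise_lipschitzI)
  fix e :: real assume "e > 0"
  show "\<forall>\<^sub>F y in nhds x. \<bar>max (f y) (g y) - max (f x) (g x)\<bar> \<le> (c + e) * dist y x"
    using ptwise_lipschitzD[OF assms(1) \<open>e > 0\<close>] ptwise_lipschitzD[OF assms(2) \<open>e > 0\<close>]
    by eventually_elim linarith
qed

lemma ptwise_lipschitz_min:
  assumes "ptwise_lipschitz f x c" "ptwise_lipschitz g x c"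
  shows "ptwise_lipschitz (\<lambda>y. min (f y) (g y)) x c"
proof (rule ptwise_lipschitzI)
  fix e :: real assume "e > 0"
  show "\<forall>\<^sub>F y in nhds x. \<bar>min (f y) (g y) - min (f x) (g x)\<bar> \<le> (c + e) * dist y x"
    using ptwise_lipschitzD[OF assms(1) \<open>e > 0\<close>] ptwise_lipschitzD[OF assms(2) \<open>e > 0\<close>]
    by eventually_elim linarith
qed

lemma ptwise_lipschitz_imp_isCont:
  assumes "ptwise_lipschitz f x c"
  shows "isCont f x"
proof -
  have ev: "\<forall>\<^sub>F y in nhds x. \<bar>f y - f x\<bar> \<le> (\<bar>c\<bar> + 1) * dist y x"
    using ptwise_lipschitzD[OF assms zero_less_one]
  proof eventually_elim
    case (elim y)
    have "(c + 1) * dist y x \<le> (\<bar>c\<bar> + 1) * dist y x" by (intro mult_right_mono) auto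
    then show ?case using elim by linarith
  qed
  have "((\<lambda>y. f y - f x) \<longlongrightarrow> 0) (at x)"
  proof (rule Lim_null_comparison)
    show "\<forall>\<^sub>F y in at x. norm (f y - f x) \<le> (\<bar>c\<bar> + 1) * dist y x"
      using ev unfolding eventually_at_filter by eventually_elim simp
    show "((\<lambda>y. (\<bar>c\<bar> + 1) * dist y x) \<longlongrightarrow> 0) (at x)"
      by (auto intro!: tendsto_eq_intros)
  qed
  then show ?thesis by (simp add: isCont_def LIM_zero_iff)
qed

lemma ptwise_lipschitz_compose:
  fixes g :: "'a::real_normed_vector \<Rightarrow> 'b::real_normed_vector"
  assumes f: "ptwise_lipschitz f (g t) c" and g: "(g has_derivative D) (at t)"
    and D: "\<And>h. norm (D h) \<le> k * norm h" and "c \<ge> 0" "k \<ge> 0"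
  shows "ptwise_lipschitz (\<lambda>s. f (g s)) t (c * k)"
proof (rule ptwise_lipschitzI)
  fix e :: real assume e: "e > 0"
  \<comment> \<open>One \<open>e1\<close> absorbs both approximation errors, since
    \<open>(c + x) * (k + x)\<close> tends to \<open>c * k\<close>.\<close>
  obtain e1 where e1: "e1 > 0" "(c + e1) * (k + e1) \<le> c * k + e"
  proof -
    have "((\<lambda>x. (c + x) * (k + x)) \<longlongrightarrow> (c + 0) * (k + 0)) (at_right 0)"
      by (intro tendsto_intros)
    then have "\<forall>\<^sub>F x in at_right 0. (c + x) * (k + x) < c * k + e"
      using e by (intro order_tendstoD) auto
    then have "\<forall>\<^sub>F x in at_right 0. (c + x) * (k + x) < c * k + e \<and> x > 0"
      using eventually_at_right_less[of "0::real"] by eventually_elim auto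
    then obtain x where "x > 0" "(c + x) * (k + x) < c * k + e"
      using eventually_happens[of _ "at_right (0::real)"] by (auto simp: trivial_limit_at_right_real)
    then show ?thesis using that[of x] by auto
  qed
  have cont: "isCont g t" using g has_derivative_continuous by blast
  have "\<forall>\<^sub>F s in nhds t. \<bar>f (g s) - f (g t)\<bar> \<le> (c + e1) * dist (g s) (g t)"
    using ptwise_lipschitzD[OF f e1(1)] cont
    by (auto simp: filterlim_iff[of g "nhds (g t)"] isCont_def tendsto_at_iff_tendsto_nhds)
  moreover have "\<forall>\<^sub>F s in nhds t. dist (g s) (g t) \<le> (k + e1) * dist s t"
  proof -
    obtain d where d: "d > 0" "\<And>y. norm (y - t) < d \<Longrightarrow> norm (g y - g t - D (y - t)) \<le> e1 * norm (y - t)"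
      using e1(1) g unfolding has_derivative_within_alt by auto
    show ?thesis unfolding eventually_nhds_metric
    proof (intro exI[of _ d] conjI allI impI d(1))
      fix s assume s: "dist s t < d"
      have "norm (g s - g t) \<le> norm (g s - g t - D (s - t)) + norm (D (s - t))"
        by (metis diff_add_cancel norm_triangle_ineq)
      also have "\<dots> \<le> e1 * norm (s - t) + k * norm (s - t)"
        using d(2)[of s] s D[of "s - t"] by (simp add: dist_norm)
      finally show "dist (g s) (g t) \<le> (k + e1) * dist s t"
        by (simp add: dist_norm algebra_simps)
    qed
  qed
  ultimately show "\<forall>\<^sub>F s in nhds t. \<bar>f (g s) - f (g t)\<bar> \<le> (c * k + e) * dist s t"
  proof eventually_elim
    case (elim s)
    have "(c + e1) * dist (g s) (g t) \<le> (c + e1) * ((k + e1) * dist s t)"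
      using elim(2) \<open>c \<ge> 0\<close> e1(1) by (intro mult_left_mono) auto
    also have "\<dots> = ((c + e1) * (k + e1)) * dist s t" by simp
    also have "\<dots> \<le> (c * k + e) * dist s t" using e1(2) by (intro mult_right_mono) auto
    finally show ?case using elim(1) by linarith
  qed
qed

lemma ptwise_lipschitz_compose_curve:
  fixes g :: "real \<Rightarrow> 'b::real_normed_vector"
  assumes "ptwise_lipschitz f (g t) c" "(g has_vector_derivative v) (at t)" "c \<ge> 0"
  shows "ptwise_lipschitz (\<lambda>s. f (g s)) t (c * norm v)"
  using assms by (intro ptwise_lipschitz_compose) (auto simp: has_vector_derivative_def mult.commute)

lemma ptwise_lipschitz_compose_field:
  fixes g :: "'b::real_normed_field \<Rightarrow> 'b"
  assumes "ptwise_lipschitz f (g t) c" "(g has_field_derivative v) (at t)" "c \<ge> 0"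
  shows "ptwise_lipschitz (\<lambda>s. f (g s)) t (c * norm v)"
  using assms by (intro ptwise_lipschitz_compose) (auto simp: has_field_derivative_def norm_mult)

text \<open>A mean value inequality without differentiability of \<open>F\<close>. The hypothesis
  compares values only with those at a centre, and bisection asks for exactly the intervals that
  straddle a centre: the two halves are added, and \<open>e1\<close> pays for the errors.\<close>

lemma ptwise_lipschitz_increment_open:
  fixes F G :: "real \<Rightarrow> real"
  assumes "a \<le> b"
    and F: "\<And>t. t \<in> {a..b} \<Longrightarrow> ptwise_lipschitz F t (G' t)"
    and G: "\<And>t. t \<in> {a..b} \<Longrightarrow> (G has_real_derivative G' t) (at t)"
  shows "\<bar>F b - F a\<bar> \<le> G b - G a"
proof (rule field_le_epsilon)
  fix e :: real assume "e > 0"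
  define e1 where "e1 = e / (b - a + 1)"
  have e1: "e1 > 0" using \<open>e > 0\<close> \<open>a \<le> b\<close> by (simp add: e1_def)
  let ?Q = "\<lambda>s t. \<bar>F t - F s\<bar> \<le> G t - G s + e1 * (t - s)"
  have "?Q a b"
  proof (rule Bolzano[OF \<open>a \<le> b\<close>, where P = ?Q], goal_cases)
    case (1 x y z)
    then show ?case by (simp add: algebra_simps)
  next
    case (2 x)
    then have x: "x \<in> {a..b}" by auto
    have "\<forall>\<^sub>F y in nhds x. \<bar>F y - F x\<bar> \<le> (G' x + e1/2) * dist y x"
      using F[OF x] e1 by (intro ptwise_lipschitzD) auto
    then obtain d1 where d1: "d1 > 0" "\<And>y. dist y x < d1 \<Longrightarrow> \<bar>F y - F x\<bar> \<le> (G' x + e1/2) * dist y x"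
      unfolding eventually_nhds_metric by auto
    have "(G has_derivative (\<lambda>h. G' x * h)) (at x within UNIV)"
      using G[OF x] by (simp add: has_field_derivative_def)
    then obtain d2 where d2: "d2 > 0" "\<And>y. norm (y - x) < d2 \<Longrightarrow> norm (G y - G x - G' x * (y - x)) \<le> (e1/2) * norm (y - x)"
      using half_gt_zero[OF e1] unfolding has_derivative_within_alt by (meson UNIV_I)
    show ?case
    proof (intro exI[of _ "min d1 d2"] conjI allI impI)
      show "min d1 d2 > 0" using d1 d2 by auto
      fix s t assume st: "s \<le> x \<and> x \<le> t \<and> t - s < min d1 d2"
      have "\<bar>F t - F x\<bar> \<le> (G' x + e1/2) * (t - x)" using d1(2)[of t] st by (simp add: dist_real_def)
      moreover have "\<bar>F s - F x\<bar> \<le> (G' x + e1/2) * (x - s)" using d1(2)[of s] st by (simp add: dist_real_def abs_of_nonpos[of "s - x"])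
      moreover have "\<bar>G t - G x - G' x * (t - x)\<bar> \<le> (e1/2) * (t - x)" using d2(2)[of t] st by simp
      moreover have "\<bar>G s - G x - G' x * (s - x)\<bar> \<le> (e1/2) * (x - s)" using d2(2)[of s] st by (simp add: abs_of_nonpos[of "s - x"])
      moreover have "G' x * (s - x) = - (G' x * (x - s))" by (simp add: algebra_simps)
      ultimately have 1: "\<bar>F t - F x\<bar> \<le> G' x * (t - x) + e1/2 * (t - x)"
        "\<bar>F s - F x\<bar> \<le> G' x * (x - s) + e1/2 * (x - s)"
        "G' x * (t - x) \<le> G t - G x + e1/2 * (t - x)"
        "G' x * (x - s) \<le> G x - G s + e1/2 * (x - s)"
        unfolding distrib_right by linarith+
      have "\<bar>F t - F x\<bar> + \<bar>F s - F x\<bar> \<le> (G t - G x) + (G x - G s) + (e1 * (t - x) + e1 * (x - s))"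
        using 1 by linarith
      also have "\<dots> = G t - G s + e1 * (t - s)" by (simp add: algebra_simps)
      finally show "?Q s t" by linarith
    qed
  qed
  moreover have "e1 * (b - a) \<le> e"
    using \<open>e > 0\<close> \<open>a \<le> b\<close> by (simp add: e1_def field_simps)
  ultimately show "\<bar>F b - F a\<bar> \<le> G b - G a + e" by linarith
qed

text \<open>Meant for paths that start at the apex of a cone, where only continuity is
  available.\<close>

lemma ptwise_lipschitz_increment:
  fixes F G :: "real \<Rightarrow> real"
  assumes "a < b"
    and cF: "continuous_on {a..b} F" and cG: "continuous_on {a..b} G"
    and F: "\<And>t. t \<in> {a<..<b} \<Longrightarrow> ptwise_lipschitz F t (G' t)"
    and G: "\<And>t. t \<in> {a<..<b} \<Longrightarrow> (G has_real_derivative G' t) (at t)"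
  shows "\<bar>F b - F a\<bar> \<le> G b - G a"
proof -
  define m where "m = (a + b) / 2"
  have m: "a < m" "m < b" using \<open>a < b\<close> by (auto simp: m_def)
  have inner: "\<bar>F t - F s\<bar> \<le> G t - G s" if "a < s" "s \<le> t" "t < b" for s t
    using that by (intro ptwise_lipschitz_increment_open[where G' = G'] F G) auto
  have tF: "(F \<longlongrightarrow> F b) (at_left b)" "(F \<longlongrightarrow> F a) (at_right a)"
    and tG: "(G \<longlongrightarrow> G b) (at_left b)" "(G \<longlongrightarrow> G a) (at_right a)"
    using cF cG \<open>a < b\<close> by (auto simp: continuous_on_Icc_at_leftD continuous_on_Icc_at_rightD)
  have "\<bar>F b - F m\<bar> \<le> G b - G m"
  proof (rule tendsto_le[OF trivial_limit_at_left_real])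
    show "((\<lambda>t. \<bar>F t - F m\<bar>) \<longlongrightarrow> \<bar>F b - F m\<bar>) (at_left b)"
      "((\<lambda>t. G t - G m) \<longlongrightarrow> G b - G m) (at_left b)"
      by (intro tendsto_intros tF tG)+
    show "\<forall>\<^sub>F t in at_left b. \<bar>F t - F m\<bar> \<le> G t - G m"
      using eventually_at_left_real[OF m(2)] by eventually_elim (use inner m in auto)
  qed
  moreover have "\<bar>F m - F a\<bar> \<le> G m - G a"
  proof (rule tendsto_le[OF trivial_limit_at_right_real])
    show "((\<lambda>t. \<bar>F m - F t\<bar>) \<longlongrightarrow> \<bar>F m - F a\<bar>) (at_right a)"
      "((\<lambda>t. G m - G t) \<longlongrightarrow> G m - G a) (at_right a)"
      by (intro tendsto_intros tF tG)+
    show "\<forall>\<^sub>F t in at_right a. \<bar>F m - F t\<bar> \<le> G m - G t"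
      using eventually_at_right_real[OF m(1)] by eventually_elim (use inner m in auto)
  qed
  ultimately show ?thesis by linarith
qed

section \<open>Length metrics of conformal densities\<close>

text \<open>
  Here \<open>l\<close> is the length of the chain in the metric \<open>d\<close> and \<open>C\<close> its Euclidean length. In \<open>chain_reach\<close>,
  \<open>C\<close> does not depend on \<open>h\<close>, so that arbitrarily fine chains stay in a common compact set.
\<close>

inductive fine_chain :: "(complex \<Rightarrow> complex \<Rightarrow> real) \<Rightarrow> real \<Rightarrow> complex \<Rightarrow> complex \<Rightarrow> real \<Rightarrow> real \<Rightarrow> bool"
  for d :: "complex \<Rightarrow> complex \<Rightarrow> real" and h :: real where
  fine_chain_refl: "fine_chain d h x x 0 0"
| fine_chain_step: "fine_chain d h x y l C \<Longrightarrow> dist y z < h \<Longrightarrow> fine_chain d h x z (l + d y z) (C + dist y z)"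

definition chain_reach :: "(complex \<Rightarrow> complex \<Rightarrow> real) \<Rightarrow> complex \<Rightarrow> complex \<Rightarrow> real \<Rightarrow> bool" where
  "chain_reach d x y l \<longleftrightarrow> (\<exists>C. \<forall>h>0. \<exists>l' C'. fine_chain d h x y l' C' \<and> l' \<le> l \<and> C' \<le> C)"

text \<open>The density may vanish, as the cubic one does at zeros. At this level \<open>d\<close>
  is therefore only a pseudometric; points are separated later, with the help of charts.\<close>

locale conformal_density =
  fixes \<rho> :: "complex \<Rightarrow> real"
  assumes \<rho>_cont: "continuous_on UNIV \<rho>" and \<rho>_nonneg: "\<rho> z \<ge> 0"
begin

definition admissible :: "(complex \<Rightarrow> real) \<Rightarrow> bool" where
  "admissible f \<longleftrightarrow> (\<forall>z. ptwise_lipschitz f z (\<rho> z))"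

text \<open>The distance of the length metric \<open>\<rho> \<bar>dz\<bar>\<close>, defined by duality instead of lengths of curves.\<close>

definition d :: "complex \<Rightarrow> complex \<Rightarrow> real" where
  "d x y = (SUP f\<in>Collect admissible. f y - f x)"

lemma admissible_const: "admissible (\<lambda>_. c)"
  unfolding admissible_def by (auto intro!: ptwise_lipschitz_of_bound always_eventually mult_nonneg_nonneg \<rho>_nonneg)

lemma admissible_uminus: "admissible f \<Longrightarrow> admissible (\<lambda>z. - f z)"
  by (auto simp: admissible_def ptwise_lipschitz_uminus)

lemma \<rho>_bounded_on_compact:
  assumes "compact K"
  obtains M where "M > 0" "\<And>z. z \<in> K \<Longrightarrow> \<rho> z \<le> M"
proof -
  have "bounded (\<rho> ` K)"
    using assms \<rho>_cont by (intro compact_imp_bounded compact_continuous_image continuous_on_subset[OF \<rho>_cont]) auto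
  then obtain M where "M > 0" "\<forall>z\<in>K. norm (\<rho> z) \<le> M" by (auto simp: bounded_pos)
  then show ?thesis by (intro that[of M]) auto
qed

lemma admissible_segment_bound:
  assumes "admissible f" "\<And>z. z \<in> closed_segment x y \<Longrightarrow> \<rho> z \<le> M"
  shows "\<bar>f y - f x\<bar> \<le> M * dist x y"
proof -
  have "\<bar>f (linepath x y 1) - f (linepath x y 0)\<bar> \<le> M * dist x y * 1 - M * dist x y * 0"
  proof (rule ptwise_lipschitz_increment_open[where G' = "\<lambda>_. M * dist x y"])
    fix t :: real assume t: "t \<in> {0..1}"
    have der: "(linepath x y has_vector_derivative (y - x)) (at t)"
      unfolding linepath_def by (auto intro!: derivative_eq_intros simp: algebra_simps)
    have "linepath x y t \<in> closed_segment x y" using t linepath_in_path by blast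
    then have "ptwise_lipschitz f (linepath x y t) M"
      using assms by (auto simp: admissible_def intro: ptwise_lipschitz_mono)
    moreover have "0 \<le> M" using assms(2)[of x] \<rho>_nonneg[of x] by auto
    ultimately show "ptwise_lipschitz (\<lambda>t. f (linepath x y t)) t (M * dist x y)"
      using ptwise_lipschitz_compose_curve[OF _ der, of f M] by (simp add: dist_norm norm_minus_commute)
  qed (auto intro!: derivative_eq_intros)
  then show ?thesis by (simp add: linepath_def)
qed

lemma bdd_above_admissible: "bdd_above ((\<lambda>f. f y - f x) ` Collect admissible)"
proof -
  obtain M where M: "\<And>z. z \<in> closed_segment x y \<Longrightarrow> \<rho> z \<le> M"
    using \<rho>_bounded_on_compact[OF compact_segment] by metis
  show ?thesis
    using admissible_segment_bound[OF _ M] by (intro bdd_aboveI2[where M = "M * dist x y"]) (auto simp: abs_le_iff)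
qed

lemma admissible_le_d: "admissible f \<Longrightarrow> f y - f x \<le> d x y"
  unfolding d_def by (rule cSUP_upper[OF _ bdd_above_admissible]) auto

lemma abs_admissible_le_d: "admissible f \<Longrightarrow> \<bar>f y - f x\<bar> \<le> d x y"
  using admissible_le_d[of f y x] admissible_le_d[OF admissible_uminus, of f y x] by (auto simp: abs_le_iff)

lemma d_leI: "(\<And>f. admissible f \<Longrightarrow> f y - f x \<le> c) \<Longrightarrow> d x y \<le> c"
  unfolding d_def by (rule cSUP_least) (use admissible_const in auto)

lemma d_nonneg: "0 \<le> d x y"
  using admissible_le_d[OF admissible_const[of 0], of x y] by simp

lemma d_self: "d x x = 0"
  using d_leI[of x x 0] d_nonneg[of x x] by auto

lemma d_sym: "d x y = d y x"
proof -
  have "d x y \<le> d y x" for x y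
  proof (rule d_leI)
    fix f assume "admissible f"
    then show "f y - f x \<le> d y x" using admissible_le_d[OF admissible_uminus, of f x y] by auto
  qed
  then show ?thesis by (metis antisym)
qed

lemma d_triangle: "d x z \<le> d x y + d y z"
proof (rule d_leI)
  fix f assume f: "admissible f"
  show "f z - f x \<le> d x y + d y z"
    using admissible_le_d[OF f, of y x] admissible_le_d[OF f, of z y] by linarith
qed

lemma d_le_segment:
  assumes "\<And>z. z \<in> closed_segment x y \<Longrightarrow> \<rho> z \<le> M"
  shows "d x y \<le> M * dist x y"
  by (rule d_leI) (use admissible_segment_bound[OF _ assms] in \<open>auto simp: abs_le_iff\<close>)

lemma d_Lipschitz_on_cball: "\<exists>M>0. \<forall>x\<in>cball 0 R. \<forall>y\<in>cball 0 R. d x y \<le> M * dist x y"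
proof -
  obtain M where M: "M > 0" "\<And>z. z \<in> cball 0 R \<Longrightarrow> \<rho> z \<le> M" using \<rho>_bounded_on_compact[OF compact_cball] by metis
  have "d x y \<le> M * dist x y" if "x \<in> cball 0 R" "y \<in> cball 0 R" for x y
  proof (rule d_le_segment)
    fix z assume "z \<in> closed_segment x y"
    then have "z \<in> cball 0 R" using that closed_segment_subset[OF that convex_cball] by auto
    then show "\<rho> z \<le> M" by (rule M)
  qed
  then show ?thesis using M(1) by blast
qed

lemma \<rho>_near: "e > 0 \<Longrightarrow> \<exists>h>0. \<forall>z\<in>ball z0 h. \<rho> z \<le> \<rho> z0 + e"
proof -
  assume "e > 0"
  have "isCont \<rho> z0" using \<rho>_cont by (simp add: continuous_on_eq_continuous_at)
  then obtain h where "h > 0" "\<forall>z. dist z z0 < h \<longrightarrow> dist (\<rho> z) (\<rho> z0) < e"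
    using \<open>e > 0\<close> unfolding continuous_at_eps_delta by blast
  then show ?thesis by (intro exI[of _ h]) (force simp: dist_real_def dist_commute)
qed

text \<open>Continuity of \<open>\<rho>\<close> turns bounds along segments into infinitesimal ones,
  with \<open>M = \<rho> z0 + e\<close> near \<open>z0\<close>. This converse of
  \<open>admissible_segment_bound\<close> serves functions such as distances and infimal chain
  lengths, which come with a triangle inequality but no derivative.\<close>

lemma admissibleI_segment:
  assumes "\<And>x y M. (\<And>z. z \<in> closed_segment x y \<Longrightarrow> \<rho> z \<le> M) \<Longrightarrow> f y - f x \<le> M * dist x y"
  shows "admissible f"
  unfolding admissible_def
proof (intro allI ptwise_lipschitzI)
  fix z0 and e :: real assume "e > 0"
  then obtain h where h: "h > 0" "\<And>z. z \<in> ball z0 h \<Longrightarrow> \<rho> z \<le> \<rho> z0 + e" using \<rho>_near by blast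
  show "\<forall>\<^sub>F y in nhds z0. \<bar>f y - f z0\<bar> \<le> (\<rho> z0 + e) * dist y z0"
    unfolding eventually_nhds_metric
  proof (intro exI[of _ h] conjI allI impI h(1))
    fix y assume y: "dist y z0 < h"
    have sub: "closed_segment z0 y \<subseteq> ball z0 h"
      using y h(1) by (intro closed_segment_subset) (auto simp: dist_commute)
    have "f y - f z0 \<le> (\<rho> z0 + e) * dist z0 y" using sub h(2) by (intro assms) auto
    moreover have "f z0 - f y \<le> (\<rho> z0 + e) * dist y z0"
      using sub h(2) by (intro assms) (auto simp: closed_segment_commute)
    ultimately show "\<bar>f y - f z0\<bar> \<le> (\<rho> z0 + e) * dist y z0" by (auto simp: dist_commute abs_le_iff)
  qed
qed

lemma admissible_d: "admissible (d x)"
proof (rule admissibleI_segment)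
  fix y z M assume "\<And>w. w \<in> closed_segment y z \<Longrightarrow> \<rho> w \<le> M"
  then have "d y z \<le> M * dist y z" by (rule d_le_segment)
  then show "d x z - d x y \<le> M * dist y z" using d_triangle[of x z y] by linarith
qed

lemma continuous_on_d: "continuous_on A (d x)"
  using admissible_d by (auto simp: admissible_def intro!: continuous_at_imp_continuous_on ptwise_lipschitz_imp_isCont)

lemma open_d_ball: "open {y. d x y < r}"
  using continuous_on_d[of UNIV x] by (intro open_Collect_less) auto

lemma fine_chain_nonneg: "fine_chain d h x y l C \<Longrightarrow> 0 \<le> l \<and> 0 \<le> C"
  by (induction rule: fine_chain.induct) (auto simp: d_nonneg)

lemma fine_chain_segment:
  assumes "fine_chain d h x y l C" "h > 0" and M: "\<And>w. w \<in> closed_segment y z \<Longrightarrow> \<rho> w \<le> M"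
  shows "\<exists>l'\<le>l + M * dist y z. fine_chain d h x z l' (C + dist y z)"
proof -
  obtain n :: nat where n: "n > 0" "dist y z / real n < h"
  proof -
    obtain n :: nat where n: "dist y z / h < real n" using reals_Archimedean2 by blast
    moreover have "0 \<le> dist y z / h" using \<open>h > 0\<close> by simp
    ultimately have "n > 0" by (metis less_le_trans not_gr_zero not_less of_nat_0)
    then show ?thesis using n \<open>h > 0\<close> by (intro that[of n]) (auto simp: field_simps)
  qed
  define p where "p k = linepath y z (real k / real n)" for k :: nat
  have seg: "p k \<in> closed_segment y z" if "k \<le> n" for k
    unfolding p_def using that n by (intro linepath_in_path) (auto simp: divide_simps)
  have step: "dist (p k) (p (Suc k)) = dist y z / real n" for k
  proof -
    have "p (Suc k) - p k = (real (Suc k) / real n - real k / real n) *\<^sub>R (z - y)"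
      by (simp only: p_def linepath_def) (simp add: algebra_simps)
    also have "real (Suc k) / real n - real k / real n = 1 / real n"
      by (simp add: diff_divide_distrib[symmetric])
    finally have "dist (p (Suc k)) (p k) = dist z y / real n" by (simp add: dist_norm)
    then show ?thesis by (simp only: dist_commute)
  qed
  have "k \<le> n \<Longrightarrow> \<exists>l'\<le>l + M * (real k / real n * dist y z). fine_chain d h x (p k) l' (C + real k / real n * dist y z)" for k
  proof (induction k)
    case 0
    then show ?case using assms(1) by (auto simp: p_def linepath_def)
  next
    case (Suc k)
    then obtain l' where l': "l' \<le> l + M * (real k / real n * dist y z)"
      "fine_chain d h x (p k) l' (C + real k / real n * dist y z)" by auto
    have "d (p k) (p (Suc k)) \<le> M * dist (p k) (p (Suc k))"
      using subset_closed_segment[of "p k" "p (Suc k)" y z] seg[of k] seg[of "Suc k"] Suc.prems M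
      by (intro d_le_segment) auto
    moreover have "fine_chain d h x (p (Suc k)) (l' + d (p k) (p (Suc k)))
        (C + real k / real n * dist y z + dist (p k) (p (Suc k)))"
      by (rule fine_chain_step[OF l'(2)]) (use step n in auto)
    moreover have "C + real k / real n * dist y z + dist (p k) (p (Suc k)) = C + real (Suc k) / real n * dist y z"
      unfolding step by (simp add: add_divide_distrib algebra_simps)
    ultimately show ?case
      using l'(1) by (intro exI[of _ "l' + d (p k) (p (Suc k))"]) (auto simp: step algebra_simps add_divide_distrib)
  qed
  from this[of n] show ?thesis using n by (simp add: p_def linepath_def)
qed

lemma chain_reach_segment:
  assumes "chain_reach d x y l" and M: "\<And>w. w \<in> closed_segment y z \<Longrightarrow> \<rho> w \<le> M"
  shows "chain_reach d x z (l + M * dist y z)"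
proof -
  obtain C where C: "\<And>h. h > 0 \<Longrightarrow> \<exists>l' C'. fine_chain d h x y l' C' \<and> l' \<le> l \<and> C' \<le> C"
    using assms(1) unfolding chain_reach_def by auto
  show ?thesis unfolding chain_reach_def
  proof (rule exI[of _ "C + dist y z"], intro allI impI)
    fix h :: real assume h: "h > 0"
    then obtain l' C' where l': "fine_chain d h x y l' C'" "l' \<le> l" "C' \<le> C" using C by blast
    from fine_chain_segment[OF l'(1) h M] obtain l''
      where l'': "l'' \<le> l' + M * dist y z" "fine_chain d h x z l'' (C' + dist y z)" by blast
    show "\<exists>l' C'. fine_chain d h x z l' C' \<and> l' \<le> l + M * dist y z \<and> C' \<le> C + dist y z"
      by (rule exI[of _ l''], rule exI[of _ "C' + dist y z"]) (use l' l'' in auto)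
  qed
qed

lemma chain_reach_refl: "chain_reach d x x 0"
  unfolding chain_reach_def using fine_chain_refl by (intro exI[of _ 0]) blast

lemma chain_reach_nonneg: "chain_reach d x y l \<Longrightarrow> 0 \<le> l"
  unfolding chain_reach_def using fine_chain_nonneg by (meson order.trans zero_less_one)

text \<open>The infimal chain length from a fixed point is itself admissible.\<close>

lemma length_space:
  assumes "e > 0"
  shows "chain_reach d x y (d x y + e)"
proof -
  define f where "f z = Inf {l. chain_reach d x z l}" for z
  have bdd: "bdd_below {l. chain_reach d x z l}" for z
    by (rule bdd_belowI[of _ 0]) (use chain_reach_nonneg in auto)
  have ne: "{l. chain_reach d x z l} \<noteq> {}" for z
  proof -
    obtain M where "\<And>w. w \<in> closed_segment x z \<Longrightarrow> \<rho> w \<le> M"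
      using \<rho>_bounded_on_compact[OF compact_segment] by metis
    from chain_reach_segment[OF chain_reach_refl this] show ?thesis by blast
  qed
  have "admissible f"
  proof (rule admissibleI_segment)
    fix y z M assume M: "\<And>w. w \<in> closed_segment y z \<Longrightarrow> \<rho> w \<le> M"
    have "f z - M * dist y z \<le> f y" unfolding f_def[of y]
    proof (rule cInf_greatest[OF ne])
      fix l assume "l \<in> {l. chain_reach d x y l}"
      then have "chain_reach d x z (l + M * dist y z)" using chain_reach_segment M by blast
      then have "f z \<le> l + M * dist y z" unfolding f_def by (intro cInf_lower bdd) auto
      then show "f z - M * dist y z \<le> l" by linarith
    qed
    then show "f z - f y \<le> M * dist y z" by linarith
  qed
  \<comment> \<open>The infimal chain length is now one of the competitors in the supremum that
    defines \<open>d x y\<close>.\<close>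
  then have "f y - f x \<le> d x y" by (rule admissible_le_d)
  moreover have "f x \<le> 0" unfolding f_def by (intro cInf_lower bdd) (auto intro: chain_reach_refl)
  ultimately have "f y < d x y + e" using assms by linarith
  then obtain l where "chain_reach d x y l" "l < d x y + e"
    unfolding f_def using cInf_lessD[OF ne] by blast
  then show ?thesis unfolding chain_reach_def by (meson order.trans less_imp_le)
qed

text \<open>Truncating against the distance extends a locally defined test function to an admissible one.\<close>

lemma abs_diff_le_d_local:
  assumes F: "\<And>y. d z0 y < 4 * e \<Longrightarrow> ptwise_lipschitz F y (\<rho> y)"
    and x: "d z0 x < e / 2" and y: "d z0 y < e / 2"
  shows "\<bar>F y - F x\<bar> \<le> d x y"
proof -
  have e: "e > 0" using x d_nonneg[of z0 x] by linarith
  \<comment> \<open>The clamp \<open>h\<close> vanishes from distance \<open>3 * e\<close> of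
    \<open>x\<close> on, before control of \<open>F\<close> is lost at distance \<open>4 * e\<close>
    from \<open>z0\<close>. At \<open>y\<close> it exceeds \<open>2 * e\<close>, hence
    \<open>d x y\<close>; since \<open>G\<close> changes by at most \<open>d x y\<close>, the clamp
    is inactive there and \<open>G y = F y - F x\<close>.\<close>
  define h where "h z = max 0 (3 * e - d x z)" for z
  define G where "G z = max (- h z) (min (h z) (F z - F x))" for z
  have lip_d: "ptwise_lipschitz (d x) z (\<rho> z)" for z using admissible_d by (auto simp: admissible_def)
  have lip_h: "ptwise_lipschitz h z (\<rho> z)" for z
    unfolding h_def by (rule ptwise_lipschitz_dominated[OF lip_d]) (auto intro!: always_eventually)
  have "admissible G" unfolding admissible_def
  proof
    fix z
    show "ptwise_lipschitz G z (\<rho> z)"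
    proof (cases "d x z < 3 * e")
      case True
      have "d z0 z \<le> d z0 x + d x z" by (rule d_triangle)
      then have "ptwise_lipschitz F z (\<rho> z)" using True x e by (intro F) linarith
      then have "ptwise_lipschitz (\<lambda>z. F z - F x) z (\<rho> z)"
        by (rule ptwise_lipschitz_dominated) (auto intro!: always_eventually)
      then show ?thesis unfolding G_def
        by (intro ptwise_lipschitz_max ptwise_lipschitz_min ptwise_lipschitz_uminus lip_h)
    next
      case False
      then have "h z = 0" by (auto simp: h_def)
      then show ?thesis
        by (intro ptwise_lipschitz_dominated[OF lip_h]) (auto intro!: always_eventually simp: G_def h_def)
    qed
  qed
  then have le: "\<bar>G y - G x\<bar> \<le> d x y" by (rule abs_admissible_le_d)
  have "d x y < e" using d_triangle[of x y z0] x y by (simp add: d_sym[of x z0])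
  have "G x = 0" using e by (simp add: G_def h_def d_self)
  have "h y > d x y" using \<open>d x y < e\<close> by (simp add: h_def)
  then show ?thesis using le \<open>G x = 0\<close> by (auto simp: G_def max_def min_def split: if_splits)
qed

end

section \<open>Flat cones\<close>

text \<open>Within one full turn to either side, the angular distance is either the angle or its
  complement to \<open>2 * pi\<close>. Sums of two principal arguments lie in this range.\<close>

lemma abs_Arg_rcis:
  assumes "s > 0" "\<bar>\<phi>\<bar> \<le> 2 * pi"
  shows "\<bar>Arg (rcis s \<phi>)\<bar> = min \<bar>\<phi>\<bar> (2 * pi - \<bar>\<phi>\<bar>)"
proof -
  have shift: "rcis s (\<phi> - 2 * pi) = rcis s \<phi>" "rcis s (\<phi> + 2 * pi) = rcis s \<phi>"
    by (simp_all add: rcis_def cis.code cos_diff sin_diff)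
  consider "\<phi> \<in> {-pi<..pi}" | "\<phi> > pi" | "\<phi> \<le> - pi" by force
  then show ?thesis
  proof cases
    case 1
    then show ?thesis using assms by (subst Arg_rcis) auto
  next
    case 2
    then have "Arg (rcis s \<phi>) = \<phi> - 2 * pi" using assms
      by (subst shift(1)[symmetric], subst Arg_rcis) auto
    then show ?thesis using 2 assms pi_gt_zero by (auto simp: min_def)
  next
    case 3
    then have "\<phi> + 2 * pi \<in> {-pi<..pi}"
      using assms(2) pi_gt_zero unfolding greaterThanAtMost_iff by linarith
    then have "Arg (rcis s (\<phi> + 2 * pi)) = \<phi> + 2 * pi" using assms(1) by (rule Arg_rcis)
    then have "Arg (rcis s \<phi>) = \<phi> + 2 * pi" by (simp only: shift)
    then show ?thesis using 3 assms pi_gt_zero by (auto simp: min_def)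
  qed
qed

lemma abs_Arg_mult_le: "\<bar>Arg (u * v)\<bar> \<le> \<bar>Arg u\<bar> + \<bar>Arg v\<bar>"
proof (cases "u = 0 \<or> v = 0")
  case False
  have "u * v = rcis (cmod u * cmod v) (Arg u + Arg v)"
    by (metis rcis_cmod_Arg rcis_mult)
  moreover have "\<bar>Arg u + Arg v\<bar> \<le> 2 * pi"
    using mpi_less_Arg[of u] mpi_less_Arg[of v] Arg_le_pi[of u] Arg_le_pi[of v] by linarith
  ultimately have "\<bar>Arg (u * v)\<bar> = min \<bar>Arg u + Arg v\<bar> (2 * pi - \<bar>Arg u + Arg v\<bar>)"
    using False by (simp add: abs_Arg_rcis)
  then show ?thesis by linarith
qed (auto simp: Arg_zero)

lemma abs_Arg_inverse: "\<bar>Arg (inverse u)\<bar> = \<bar>Arg u\<bar>"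
  by (simp add: Arg_inverse)

text \<open>The third side of a Euclidean triangle with sides \<open>r\<close>, \<open>s\<close> enclosing the angle \<open>A\<close>.\<close>

definition chord :: "real \<Rightarrow> real \<Rightarrow> real \<Rightarrow> real" where
  "chord r s A = sqrt (r\<^sup>2 + s\<^sup>2 - 2 * r * s * cos A)"

text \<open>The law of cosines; the free base angle \<open>B\<close> allows chords to be laid end to
  end.\<close>

lemma chord_eq_cmod: "chord r s A = cmod (rcis r B - rcis s (B + A))"
proof -
  have "(cmod (rcis r B - rcis s (B + A)))\<^sup>2 =
      (r * cos B - s * cos (B + A))\<^sup>2 + (r * sin B - s * sin (B + A))\<^sup>2"
    by (simp add: cmod_power2)
  also have "\<dots> = r\<^sup>2 * ((cos B)\<^sup>2 + (sin B)\<^sup>2) + s\<^sup>2 * ((cos (B + A))\<^sup>2 + (sin (B + A))\<^sup>2)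
      - 2 * r * s * (cos (B + A) * cos B + sin (B + A) * sin B)"
    by algebra
  also have "\<dots> = r\<^sup>2 + s\<^sup>2 - 2 * r * s * cos A"
    using cos_diff[of "B + A" B] by (simp add: sin_cos_squared_add2)
  finally show ?thesis unfolding chord_def by (metis norm_ge_zero real_sqrt_unique)
qed

lemma chord_radicand_nonneg:
  fixes r s A :: real
  shows "0 \<le> r\<^sup>2 + s\<^sup>2 - 2 * r * s * cos A"
  using chord_eq_cmod[of r s A 0] norm_ge_zero[of "rcis r 0 - rcis s (0 + A)"]
  unfolding chord_def by (metis real_sqrt_ge_0_iff)

lemma chord_sq: "(chord r s A)\<^sup>2 = r\<^sup>2 + s\<^sup>2 - 2 * r * s * cos A"
  unfolding chord_def using chord_radicand_nonneg by simp

lemma chord_nonneg: "0 \<le> chord r s A"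
  unfolding chord_def using chord_radicand_nonneg by simp

lemma chord_commute: "chord r s A = chord s r A"
  by (simp add: chord_def add.commute mult.commute mult.left_commute)

lemma chord_mono_cos:
  assumes "cos B \<le> cos A" "r \<ge> 0" "s \<ge> 0"
  shows "chord r s A \<le> chord r s B"
proof -
  have "r * s * cos B \<le> r * s * cos A" using assms by (intro mult_left_mono) auto
  then show ?thesis unfolding chord_def by (intro real_sqrt_le_mono) auto
qed

lemma chord_mono:
  "0 \<le> A \<Longrightarrow> A \<le> B \<Longrightarrow> B \<le> pi \<Longrightarrow> r \<ge> 0 \<Longrightarrow> s \<ge> 0 \<Longrightarrow> chord r s A \<le> chord r s B"
  by (intro chord_mono_cos cos_monotone_0_pi_le) auto

lemma chord_pi: "r \<ge> 0 \<Longrightarrow> s \<ge> 0 \<Longrightarrow> chord r s pi = r + s"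
  unfolding chord_def by (intro real_sqrt_unique) (auto simp: power2_eq_square algebra_simps)

lemma chord_0_left: "s \<ge> 0 \<Longrightarrow> chord 0 s A = s"
  by (simp add: chord_def)

lemma chord_0_right: "r \<ge> 0 \<Longrightarrow> chord r 0 A = r"
  by (simp add: chord_def)

lemma chord_triangle: "chord r t (A + B) \<le> chord r s A + chord s t B"
proof -
  have "cmod (rcis r 0 - rcis t (0 + (A + B)))
      \<le> cmod (rcis r 0 - rcis s (0 + A)) + cmod (rcis s (0 + A) - rcis t ((0 + A) + B))"
    using norm_triangle_ineq[of "rcis r 0 - rcis s (0 + A)" "rcis s (0 + A) - rcis t ((0 + A) + B)"]
    by (simp add: add.assoc)
  then show ?thesis by (simp only: chord_eq_cmod[symmetric])
qed

text \<open>
  The metric of the Euclidean cone of total angle \<open>2 * pi * \<kappa>\<close>; the point of the cone at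
  distance \<open>r\<close> from the apex in direction \<open>\<kappa> * \<phi>\<close> is represented by \<open>r powr (1 / \<kappa>) * cis \<phi>\<close>.
\<close>

definition cone_dist :: "real \<Rightarrow> complex \<Rightarrow> complex \<Rightarrow> real" where
  "cone_dist \<kappa> u v = chord (cmod u powr \<kappa>) (cmod v powr \<kappa>) (min pi (\<kappa> * \<bar>Arg (u / v)\<bar>))"

lemma cone_dist_commute: "cone_dist \<kappa> u v = cone_dist \<kappa> v u"
proof -
  have "\<bar>Arg (u / v)\<bar> = \<bar>Arg (v / u)\<bar>"
    using abs_Arg_inverse[of "u / v"] by (simp add: inverse_eq_divide)
  then show ?thesis unfolding cone_dist_def by (simp add: chord_commute)
qed

text \<open>The apex has no direction, but the angle that division by zero and
  \<open>Arg 0 = 0\<close> supply does not matter once a radius is zero.\<close>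

lemma cone_dist_0: "\<kappa> > 0 \<Longrightarrow> cone_dist \<kappa> 0 v = cmod v powr \<kappa>"
  by (simp add: cone_dist_def chord_0_left)

lemma cone_dist_0_right: "\<kappa> > 0 \<Longrightarrow> cone_dist \<kappa> u 0 = cmod u powr \<kappa>"
  using cone_dist_0 cone_dist_commute by metis

lemma cone_dist_le_add: "\<kappa> > 0 \<Longrightarrow> cone_dist \<kappa> u v \<le> cmod u powr \<kappa> + cmod v powr \<kappa>"
  unfolding cone_dist_def
  by (subst chord_pi[symmetric]) (auto intro!: chord_mono simp: min_def pi_ge_zero)

text \<open>Truncated angles are subadditive. If \<open>A + B\<close> exceeds \<open>pi\<close>,
  then \<open>B\<close> is lowered to \<open>pi - A\<close>, which only shortens its chord, and the
  planar triangle inequality applies to a total angle of exactly \<open>pi\<close>.\<close>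

lemma cone_dist_triangle:
  assumes "\<kappa> > 0"
  shows "cone_dist \<kappa> u w \<le> cone_dist \<kappa> u v + cone_dist \<kappa> v w"
proof (cases "v = 0")
  case True
  then show ?thesis using cone_dist_le_add[OF assms, of u w] assms by (simp add: cone_dist_0 cone_dist_0_right)
next
  case False
  let ?r = "cmod u powr \<kappa>" and ?s = "cmod v powr \<kappa>" and ?t = "cmod w powr \<kappa>"
  define A B C where "A = min pi (\<kappa> * \<bar>Arg (u / v)\<bar>)" "B = min pi (\<kappa> * \<bar>Arg (v / w)\<bar>)"
    "C = min pi (\<kappa> * \<bar>Arg (u / w)\<bar>)"
  have AB: "0 \<le> A" "A \<le> pi" "0 \<le> B" "B \<le> pi" "0 \<le> C" "C \<le> pi"
    using assms by (auto simp: A_B_C_def)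
  have "\<bar>Arg (u / w)\<bar> \<le> \<bar>Arg (u / v)\<bar> + \<bar>Arg (v / w)\<bar>"
    using abs_Arg_mult_le[of "u / v" "v / w"] False by simp
  then have "\<kappa> * \<bar>Arg (u / w)\<bar> \<le> \<kappa> * \<bar>Arg (u / v)\<bar> + \<kappa> * \<bar>Arg (v / w)\<bar>"
    using assms by (metis distrib_left mult_left_mono less_imp_le)
  then have C: "C \<le> A + B" using AB unfolding A_B_C_def by (auto simp: min_def)
  have "chord ?r ?t C \<le> chord ?r ?s A + chord ?s ?t B"
  proof (cases "A + B \<le> pi")
    case True
    have "chord ?r ?t C \<le> chord ?r ?t (A + B)" using AB C True by (intro chord_mono) auto
    then show ?thesis using chord_triangle[of ?r ?t A B ?s] by linarith
  next
    case False
    have "chord ?r ?t C \<le> chord ?r ?t (A + (pi - A))" using AB by (intro chord_mono) auto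
    also have "\<dots> \<le> chord ?r ?s A + chord ?s ?t (pi - A)" by (rule chord_triangle)
    also have "chord ?s ?t (pi - A) \<le> chord ?s ?t B" using AB False by (intro chord_mono) auto
    finally show ?thesis by linarith
  qed
  then show ?thesis by (simp add: cone_dist_def A_B_C_def)
qed

text \<open>
  With \<open>m\<close> as origin of the angles, the point \<open>q\<close> is moved to the direction \<open>\<delta>'\<close> of a
  plane. This preserves its distance from \<open>m\<close> and does not increase its distance from \<open>x\<close>.
\<close>

lemma cone_comparison:
  assumes "\<kappa> \<ge> 1" and x: "x = m * rcis s (\<xi> / \<kappa>)" "s > 0" "\<bar>\<xi>\<bar> \<le> pi" and "m \<noteq> 0" "q \<noteq> 0"
    and \<delta>': "\<delta>' = max (- pi) (min pi (\<kappa> * Arg (q / m)))"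
  shows "chord (cmod q powr \<kappa>) (cmod x powr \<kappa>) (\<delta>' - \<xi>) \<le> cone_dist \<kappa> q x"
proof -
  define \<delta> where "\<delta> = \<kappa> * Arg (q / m)"
  have "q / m = rcis (cmod (q / m)) (\<delta> / \<kappa>)"
    using assms(1) rcis_cmod_Arg[of "q / m"] by (simp add: \<delta>_def)
  then have "q / x = rcis (cmod (q / m)) (\<delta> / \<kappa>) / rcis s (\<xi> / \<kappa>)"
    using x \<open>m \<noteq> 0\<close> by (simp add: divide_simps)
  also have "\<dots> = rcis (cmod (q / m) / s) ((\<delta> - \<xi>) / \<kappa>)" by (simp add: rcis_divide diff_divide_distrib)
  finally have qx: "q / x = rcis (cmod (q / m) / s) ((\<delta> - \<xi>) / \<kappa>)" .
  define K where "K = \<kappa> * pi"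
  have \<delta>: "\<bar>\<delta>\<bar> \<le> K"
    using mpi_less_Arg[of "q / m"] Arg_le_pi[of "q / m"] assms(1) unfolding \<delta>_def K_def
    by (auto simp: abs_mult intro!: mult_left_mono)
  have pik: "pi \<le> K" using assms(1) by (simp add: K_def)
  have 2: "\<bar>\<delta> - \<xi>\<bar> \<le> 2 * K" using \<delta> x(3) pik by linarith
  then have "\<bar>(\<delta> - \<xi>) / \<kappa>\<bar> \<le> 2 * pi" using assms(1) by (simp add: K_def abs_divide divide_simps mult.commute mult.left_commute)
  then have "\<bar>Arg (q / x)\<bar> = min \<bar>(\<delta> - \<xi>) / \<kappa>\<bar> (2 * pi - \<bar>(\<delta> - \<xi>) / \<kappa>\<bar>)"
    unfolding qx using assms by (intro abs_Arg_rcis) auto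
  then have A: "\<kappa> * \<bar>Arg (q / x)\<bar> = min \<bar>\<delta> - \<xi>\<bar> (2 * K - \<bar>\<delta> - \<xi>\<bar>)"
    using assms(1) by (auto simp: K_def min_def abs_divide field_simps)
  define A where "A = min pi (min \<bar>\<delta> - \<xi>\<bar> (2 * K - \<bar>\<delta> - \<xi>\<bar>))"
  have A0: "0 \<le> A" "A \<le> pi" using 2 by (auto simp: A_def)
  have \<delta>'2: "\<delta>' = max (- pi) (min pi \<delta>)" by (simp add: \<delta>' \<delta>_def)
  have "cos A \<le> cos (\<delta>' - \<xi>)"
  proof -
    define D where "D = \<bar>\<delta>' - \<xi>\<bar>"
    define D' where "D' = min D (2 * pi - D)"
    have "D \<le> 2 * pi" using x(3) \<delta>'2 pi_gt_zero unfolding D_def by linarith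
    then have D': "0 \<le> D'" "D' \<le> pi" by (auto simp: D'_def D_def)
    \<comment> \<open>Here the cone angle \<open>2 * K \<ge> 2 * pi\<close> enters. Clamping
      \<open>\<delta>\<close> to an interval containing \<open>\<xi>\<close> brings the two angles
      closer, and the way around the apex shrinks too: clamping removes at most
      \<open>K - pi\<close> from the difference, whereas the full turn drops by
      \<open>2 * K - 2 * pi\<close>.\<close>
    have "D' \<le> A"
      using \<delta> x(3) pik pi_gt_zero unfolding \<delta>'2 D'_def D_def A_def by linarith
    then have "cos A \<le> cos D'" using D' A0 by (intro cos_monotone_0_pi_le) auto
    also have "cos D' = cos D" by (auto simp: D'_def min_def cos_diff)
    also have "cos D = cos (\<delta>' - \<xi>)" by (simp add: D_def)
    finally show ?thesis .
  qed
  then show ?thesis unfolding cone_dist_def A A_def[symmetric] by (intro chord_mono_cos) auto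
qed

section \<open>Midpoints in a cone\<close>

lemma cos_clamp: "cos (max (- pi) (min pi \<delta>)) = cos (min pi \<bar>\<delta>\<bar>)"
proof -
  have "max (- pi) (min pi \<delta>) = min pi \<bar>\<delta>\<bar> \<or> max (- pi) (min pi \<delta>) = - min pi \<bar>\<delta>\<bar>"
    using pi_gt_zero by linarith
  then show ?thesis by auto
qed

text \<open>Apollonius' formula for the median from \<open>(q, \<delta>)\<close>, in polar
  coordinates whose zero direction points at the midpoint: the two hypotheses say that
  \<open>(m, 0)\<close> is the midpoint of \<open>(u, \<xi>)\<close> and
  \<open>(v, \<eta>)\<close>.\<close>

lemma planar_midpoint_identity:
  fixes q u v m \<delta> \<xi> \<eta> :: real
  assumes "2 * m = u * cos \<xi> + v * cos \<eta>" "u * sin \<xi> + v * sin \<eta> = 0"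
  shows "(chord q m \<delta>)\<^sup>2 = (chord q u (\<delta> - \<xi>))\<^sup>2 / 2 + (chord q v (\<delta> - \<eta>))\<^sup>2 / 2 - (chord u v (\<eta> - \<xi>))\<^sup>2 / 4"
proof -
  have linear: "a + b = 2 * c \<Longrightarrow> 4 * M = U + V + e \<Longrightarrow>
      Q + M - c = (Q + U - a) / 2 + (Q + V - b) / 2 - (U + V - e) / 4" for a b c M U V e Q :: real
    by (simp add: field_simps)
  have "4 * m\<^sup>2 = (u * cos \<xi> + v * cos \<eta>)\<^sup>2 + (u * sin \<xi> + v * sin \<eta>)\<^sup>2"
    unfolding assms(2) by (simp add: assms(1)[symmetric] power2_eq_square)
  also have "\<dots> = u\<^sup>2 * ((cos \<xi>)\<^sup>2 + (sin \<xi>)\<^sup>2) + v\<^sup>2 * ((cos \<eta>)\<^sup>2 + (sin \<eta>)\<^sup>2) + 2 * u * v * (cos \<eta> * cos \<xi> + sin \<eta> * sin \<xi>)"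
    by algebra
  also have "\<dots> = u\<^sup>2 + v\<^sup>2 + 2 * u * v * cos (\<eta> - \<xi>)" by (simp add: cos_diff)
  finally have m: "4 * m\<^sup>2 = u\<^sup>2 + v\<^sup>2 + 2 * u * v * cos (\<eta> - \<xi>)" .
  have "u * cos (\<delta> - \<xi>) + v * cos (\<delta> - \<eta>) = cos \<delta> * (u * cos \<xi> + v * cos \<eta>) + sin \<delta> * (u * sin \<xi> + v * sin \<eta>)"
    by (simp add: cos_diff algebra_simps)
  then have "u * cos (\<delta> - \<xi>) + v * cos (\<delta> - \<eta>) = 2 * m * cos \<delta>"
    unfolding assms(2) by (simp add: assms(1)[symmetric])
  then have "2 * q * (u * cos (\<delta> - \<xi>) + v * cos (\<delta> - \<eta>)) = 2 * q * (2 * m * cos \<delta>)" by simp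
  then have "2 * q * u * cos (\<delta> - \<xi>) + 2 * q * v * cos (\<delta> - \<eta>) = 2 * (2 * q * m * cos \<delta>)"
    by (simp add: algebra_simps)
  then show ?thesis unfolding chord_sq by (rule linear[OF _ m])
qed

text \<open>The inequality of Bruhat and Tits, with one \<open>m\<close> for all \<open>q\<close>.
  The bound on \<open>cmod m\<close> keeps the midpoint inside the image of a chart.\<close>

definition cone_midpoint_ineq :: "real \<Rightarrow> complex \<Rightarrow> complex \<Rightarrow> complex \<Rightarrow> bool" where
  "cone_midpoint_ineq \<kappa> u v m \<longleftrightarrow> cmod m \<le> max (cmod u) (cmod v) \<and>
    (\<forall>q. (cone_dist \<kappa> q m)\<^sup>2 \<le> (cone_dist \<kappa> q u)\<^sup>2 / 2 + (cone_dist \<kappa> q v)\<^sup>2 / 2 - (cone_dist \<kappa> u v)\<^sup>2 / 4)"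

lemma powr_powr_inverse: "\<kappa> > 0 \<Longrightarrow> a \<ge> 0 \<Longrightarrow> (a powr (1 / \<kappa>)) powr \<kappa> = (a::real)"
  by (simp add: powr_powr)

text \<open>The geodesic passes through the apex.\<close>

lemma cone_midpoint_shadow:
  assumes "\<kappa> \<ge> 1" "u \<noteq> 0" "cmod v \<le> cmod u" and vis: "v = 0 \<or> pi \<le> \<kappa> * \<bar>Arg (u / v)\<bar>"
  shows "\<exists>m. cone_midpoint_ineq \<kappa> u v m"
proof -
  have \<kappa>: "\<kappa> > 0" using assms by simp
  define r s where "r = cmod u powr \<kappa>" "s = cmod v powr \<kappa>"
  have rs: "0 \<le> s" "s \<le> r" "0 < r" using assms by (auto simp: r_s_def intro!: powr_mono2)
  \<comment> \<open>The path through the apex has length \<open>r + s\<close>; half of it, measured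
    from the farther point \<open>u\<close>, ends on the ray of \<open>u\<close> at radius
    \<open>r - (r + s) / 2\<close>.\<close>
  define \<mu> where "\<mu> = (r - s) / 2"
  define t where "t = (\<mu> / r) powr (1 / \<kappa>)"
  define m where "m = of_real t * u"
  have t: "0 \<le> t" "t powr \<kappa> = \<mu> / r"
    using rs \<kappa> by (auto simp: t_def \<mu>_def powr_powr_inverse)
  have "t \<le> 1"
    using rs \<kappa> powr_mono2[of "1 / \<kappa>" "\<mu> / r" 1] by (simp add: t_def \<mu>_def)
  have cm: "cmod m = t * cmod u" using t by (simp add: m_def norm_mult)
  have cmp: "cmod m powr \<kappa> = \<mu>" using t rs by (simp add: cm powr_mult r_s_def(1)[symmetric])
  have dist_uv: "cone_dist \<kappa> u v = chord r s pi"
    using vis rs by (auto simp: cone_dist_def r_s_def chord_def)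
  show ?thesis
  proof (rule exI[of _ m], unfold cone_midpoint_ineq_def, intro conjI allI)
    show "cmod m \<le> max (cmod u) (cmod v)"
      using \<open>t \<le> 1\<close> t by (simp add: cm mult_left_le_one_le le_max_iff_disj)
    fix q
    define R where "R = cmod q powr \<kappa>"
    define \<delta> where "\<delta> = min pi (\<kappa> * \<bar>Arg (q / u)\<bar>)"
    have \<delta>: "0 \<le> \<delta>" "\<delta> \<le> pi" using \<kappa> by (auto simp: \<delta>_def)
    have qu: "cone_dist \<kappa> q u = chord R r (\<delta> - 0)" by (simp add: cone_dist_def R_def r_s_def \<delta>_def)
    have qm: "cone_dist \<kappa> q m = chord R \<mu> \<delta>"
    proof (cases "t = 0")
      case True
      then have "\<mu> = 0" using t rs by auto
      then show ?thesis using True by (simp add: m_def cone_dist_0_right[OF \<kappa>] R_def chord_0_right)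
    next
      case False
      then have "Arg (q / m) = Arg (q / u)"
        using t Arg_divide_of_real[of t "q / u"] by (simp add: m_def mult.commute)
      then show ?thesis by (simp add: cone_dist_def cmp \<delta>_def R_def)
    qed
    \<comment> \<open>In the comparison plane \<open>u\<close> lies in direction 0 and
      \<open>v\<close> in direction \<open>pi\<close>. Since \<open>u\<close> and \<open>v\<close>
      are at least \<open>pi\<close> apart in the cone, \<open>q\<close> sees \<open>v\<close> under
      an angle of at least \<open>pi - \<delta>\<close>.\<close>
    have "chord R s (\<delta> - pi) \<le> cone_dist \<kappa> q v"
    proof (cases "v = 0")
      case True
      then show ?thesis using \<kappa> by (simp add: r_s_def chord_0_right R_def cone_dist_0_right)
    next
      case False
      have "\<bar>Arg (u / v)\<bar> \<le> \<bar>Arg (q / u)\<bar> + \<bar>Arg (q / v)\<bar>" if "q \<noteq> 0"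
        using abs_Arg_mult_le[of "inverse (q / u)" "q / v"] abs_Arg_inverse[of "q / u"] that by simp
      then have "pi \<le> \<kappa> * \<bar>Arg (q / u)\<bar> + \<kappa> * \<bar>Arg (q / v)\<bar>" if "q \<noteq> 0"
        using vis False that \<kappa> by (smt (verit) distrib_left mult_left_mono)
      then have "pi - \<delta> \<le> min pi (\<kappa> * \<bar>Arg (q / v)\<bar>)" if "q \<noteq> 0"
        using that \<kappa> by (auto simp: \<delta>_def min_def)
      then have "chord R s (pi - \<delta>) \<le> cone_dist \<kappa> q v" if "q \<noteq> 0"
        using that \<delta> rs unfolding cone_dist_def R_def[symmetric] r_s_def(2)[symmetric]
        by (intro chord_mono) (auto simp: R_def)
      moreover have "chord R s (pi - \<delta>) = chord R s (\<delta> - pi)"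
        by (simp add: chord_def cos_diff)
      ultimately show ?thesis using cone_dist_0[OF \<kappa>] rs
        by (cases "q = 0") (auto simp: R_def chord_0_left r_s_def(2)[symmetric])
    qed
    then have "(chord R s (\<delta> - pi))\<^sup>2 \<le> (cone_dist \<kappa> q v)\<^sup>2"
      by (intro power_mono chord_nonneg)
    moreover have "(chord R \<mu> \<delta>)\<^sup>2 = (chord R r (\<delta> - 0))\<^sup>2 / 2 + (chord R s (\<delta> - pi))\<^sup>2 / 2 - (chord r s (pi - 0))\<^sup>2 / 4"
      by (rule planar_midpoint_identity) (auto simp: \<mu>_def)
    ultimately show "(cone_dist \<kappa> q m)\<^sup>2 \<le> (cone_dist \<kappa> q u)\<^sup>2 / 2 + (cone_dist \<kappa> q v)\<^sup>2 / 2 - (cone_dist \<kappa> u v)\<^sup>2 / 4"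
      unfolding qm qu dist_uv by simp
  qed
qed

text \<open>The coordinate \<open>(v / u)\<^bsup>\<kappa>\<^esup>\<close> develops the sector between \<open>u\<close> and \<open>v\<close> into the plane.\<close>

lemma cone_midpoint_visible:
  assumes "\<kappa> \<ge> 1" "u \<noteq> 0" "v \<noteq> 0" and vis: "\<kappa> * \<bar>Arg (v / u)\<bar> < pi"
  shows "\<exists>m. cone_midpoint_ineq \<kappa> u v m"
proof -
  have \<kappa>: "\<kappa> > 0" using assms by simp
  define \<Psi> where "\<Psi> = \<kappa> * Arg (v / u)"
  have \<Psi>: "\<bar>\<Psi>\<bar> < pi" using vis \<kappa> by (simp add: \<Psi>_def abs_mult)
  define r s where "r = cmod u powr \<kappa>" "s = cmod v powr \<kappa>"
  have rs: "0 < s" "0 < r" using assms by (auto simp: r_s_def)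
  \<comment> \<open>In the developed sector \<open>u\<close> becomes 1 and \<open>v\<close> becomes
    \<open>W\<close>; \<open>M\<close> is their planar midpoint, and \<open>m\<close> is its image
    back in the cone.\<close>
  define W where "W = rcis (s / r) \<Psi>"
  define M where "M = (1 + W) / 2"
  have ArgW: "Arg W = \<Psi>" using \<Psi> rs unfolding W_def by (intro Arg_rcis) auto
  have W: "W \<notin> \<real>\<^sub>\<le>\<^sub>0"
  proof
    assume "W \<in> \<real>\<^sub>\<le>\<^sub>0"
    moreover have "W \<noteq> 0" using rs by (simp add: W_def)
    ultimately have "Arg W = pi"
      by (auto simp: complex_nonpos_Reals_iff Arg_eq_pi complex_eq_iff less_le)
    then show False using ArgW \<Psi> by simp
  qed
  have ImM: "Im M = Im W / 2" "Re M = (1 + Re W) / 2" by (simp_all add: M_def)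
  have M: "M \<notin> \<real>\<^sub>\<le>\<^sub>0" using W by (auto simp: complex_nonpos_Reals_iff ImM)
  then have "M \<noteq> 0" by auto
  define \<mu> where "\<mu> = Arg M"
  have W0: "W \<noteq> 0" using W by auto
  have \<mu>: "\<bar>\<mu>\<bar> < pi"
    using M Arg_eq_pi[of M] mpi_less_Arg[of M] Arg_le_pi[of M]
    by (auto simp: \<mu>_def complex_nonpos_Reals_iff less_le)
  \<comment> \<open>\<open>M\<close> and \<open>W\<close> lie on the same side of the real axis, so
    their arguments have the same sign and cannot differ by \<open>pi\<close>.\<close>
  have sign: "\<bar>\<Psi> - \<mu>\<bar> < pi"
  proof (cases "Im W \<ge> 0")
    case True
    then have "0 \<le> \<mu>" "0 \<le> \<Psi>" using Arg_less_0[of M] Arg_less_0[of W] ArgW by (auto simp: ImM \<mu>_def)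
    then show ?thesis using \<mu> \<Psi> by linarith
  next
    case False
    then have "\<mu> < 0" "\<Psi> < 0" using Arg_less_0[of M] Arg_less_0[of W] ArgW by (auto simp: ImM \<mu>_def)
    then show ?thesis using \<mu> \<Psi> by linarith
  qed
  define \<tau> where "\<tau> = cmod M powr (1 / \<kappa>)"
  have \<tau>: "\<tau> > 0" "\<tau> powr \<kappa> = cmod M" using \<open>M \<noteq> 0\<close> \<kappa> by (auto simp: \<tau>_def powr_powr_inverse)
  define m where "m = u * rcis \<tau> (\<mu> / \<kappa>)"
  have "m \<noteq> 0" using assms \<tau> by (simp add: m_def)
  have cm: "cmod m = cmod u * \<tau>" using \<tau> by (simp add: m_def norm_mult)
  have cmp: "cmod m powr \<kappa> = r * cmod M" using \<tau> by (simp add: cm powr_mult r_s_def)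
  have um: "u = m * rcis (1 / \<tau>) ((- \<mu>) / \<kappa>)"
    using \<tau> by (simp add: m_def mult.assoc rcis_mult)
  have "v = u * rcis (cmod (v / u)) (\<Psi> / \<kappa>)"
    using \<kappa> assms rcis_cmod_Arg[of "v / u"] by (simp add: \<Psi>_def)
  then have *: "v = (m * rcis (1 / \<tau>) ((- \<mu>) / \<kappa>)) * rcis (cmod (v / u)) (\<Psi> / \<kappa>)"
    by (simp only: um[symmetric])
  have vm: "v = m * rcis (cmod (v / u) / \<tau>) ((\<Psi> - \<mu>) / \<kappa>)"
    by (rule trans[OF *]) (simp add: mult.assoc rcis_mult diff_divide_distrib)
  have polarM: "M = rcis (cmod M) \<mu>" by (simp add: \<mu>_def rcis_cmod_Arg)
  have planar: "2 * (r * cmod M) = r * cos (- \<mu>) + s * cos (\<Psi> - \<mu>)" "r * sin (- \<mu>) + s * sin (\<Psi> - \<mu>) = 0"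
  proof -
    have "of_real (2 * (r * cmod M)) = of_real (2 * r) * M * cis (- \<mu>)"
      by (subst polarM) (simp add: rcis_def cis_mult mult.assoc)
    also have "\<dots> = of_real r * cis (- \<mu>) + of_real r * W * cis (- \<mu>)"
      by (simp add: M_def field_simps)
    also have "of_real r * W * cis (- \<mu>) = of_real s * cis (\<Psi> - \<mu>)"
      using rs by (simp add: W_def rcis_def cis_mult mult.assoc)
    finally have eq: "of_real (2 * (r * cmod M)) = of_real r * cis (- \<mu>) + of_real s * cis (\<Psi> - \<mu>)" .
    show "2 * (r * cmod M) = r * cos (- \<mu>) + s * cos (\<Psi> - \<mu>)" using arg_cong[OF eq, of Re] by simp
    show "r * sin (- \<mu>) + s * sin (\<Psi> - \<mu>) = 0" using arg_cong[OF eq, of Im] by simp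
  qed
  have dist_uv: "cone_dist \<kappa> u v = chord r s ((\<Psi> - \<mu>) - (- \<mu>))"
  proof -
    have "min pi (\<kappa> * \<bar>Arg (u / v)\<bar>) = \<bar>\<Psi>\<bar>"
      using abs_Arg_inverse[of "v / u"] \<Psi> \<kappa> by (simp add: \<Psi>_def abs_mult inverse_eq_divide)
    then show ?thesis by (simp add: cone_dist_def r_s_def chord_def)
  qed
  show ?thesis
  proof (rule exI[of _ m], unfold cone_midpoint_ineq_def, intro conjI allI)
    show "cmod m \<le> max (cmod u) (cmod v)"
    proof -
      have "r * cmod M \<le> (r + s) / 2"
        using norm_triangle_ineq[of 1 W] rs by (simp add: M_def norm_divide W_def field_simps)
      then have "cmod m powr \<kappa> \<le> max r s" by (simp add: cmp max_def)
      also have "\<dots> = max (cmod u) (cmod v) powr \<kappa>"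
        using \<kappa> by (auto simp: r_s_def max_def powr_mono2 powr_less_mono2 intro: antisym)
      finally show ?thesis using powr_less_mono2[OF \<kappa>, of "max (cmod u) (cmod v)" "cmod m"]
        by (auto simp: not_less[symmetric] le_max_iff_disj)
    qed
    fix q
    define R where "R = cmod q powr \<kappa>"
    define \<delta>' where "\<delta>' = max (- pi) (min pi (\<kappa> * Arg (q / m)))"
    have qm: "cone_dist \<kappa> q m = chord R (r * cmod M) \<delta>'"
      using \<kappa> by (simp add: cone_dist_def R_def cmp chord_def \<delta>'_def cos_clamp abs_mult)
    have qu: "chord R r (\<delta>' - (- \<mu>)) \<le> cone_dist \<kappa> q u" if "q \<noteq> 0"
      unfolding R_def r_s_def
      by (rule cone_comparison[OF assms(1) um]) (use \<tau> \<mu> \<open>m \<noteq> 0\<close> that \<delta>'_def in auto)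
    have qv: "chord R s (\<delta>' - (\<Psi> - \<mu>)) \<le> cone_dist \<kappa> q v" if "q \<noteq> 0"
      unfolding R_def r_s_def
      by (rule cone_comparison[OF assms(1) vm]) (use \<tau> sign assms \<open>m \<noteq> 0\<close> that \<delta>'_def in auto)
    have "(chord R r (\<delta>' - (- \<mu>)))\<^sup>2 \<le> (cone_dist \<kappa> q u)\<^sup>2" "(chord R s (\<delta>' - (\<Psi> - \<mu>)))\<^sup>2 \<le> (cone_dist \<kappa> q v)\<^sup>2"
    proof -
      have "R = 0" if "q = 0" using that by (simp add: R_def)
      then have "chord R r (\<delta>' - (- \<mu>)) \<le> cone_dist \<kappa> q u" "chord R s (\<delta>' - (\<Psi> - \<mu>)) \<le> cone_dist \<kappa> q v"
        using qu qv rs cone_dist_0[OF \<kappa>, of u] cone_dist_0[OF \<kappa>, of v]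
        by (cases "q = 0"; simp add: chord_0_left r_s_def[symmetric])+
      then show "(chord R r (\<delta>' - (- \<mu>)))\<^sup>2 \<le> (cone_dist \<kappa> q u)\<^sup>2"
        "(chord R s (\<delta>' - (\<Psi> - \<mu>)))\<^sup>2 \<le> (cone_dist \<kappa> q v)\<^sup>2"
        by (auto intro!: power_mono chord_nonneg)
    qed
    moreover have "(chord R (r * cmod M) \<delta>')\<^sup>2 = (chord R r (\<delta>' - (- \<mu>)))\<^sup>2 / 2 + (chord R s (\<delta>' - (\<Psi> - \<mu>)))\<^sup>2 / 2
        - (chord r s ((\<Psi> - \<mu>) - (- \<mu>)))\<^sup>2 / 4"
      by (rule planar_midpoint_identity[OF planar])
    ultimately show "(cone_dist \<kappa> q m)\<^sup>2 \<le> (cone_dist \<kappa> q u)\<^sup>2 / 2 + (cone_dist \<kappa> q v)\<^sup>2 / 2 - (cone_dist \<kappa> u v)\<^sup>2 / 4"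
      unfolding qm dist_uv by linarith
  qed
qed

lemma cone_midpoint_ineq_commute: "cone_midpoint_ineq \<kappa> u v m \<longleftrightarrow> cone_midpoint_ineq \<kappa> v u m"
  unfolding cone_midpoint_ineq_def by (simp add: cone_dist_commute[of \<kappa> u v] max.commute add.commute)

lemma cone_midpoint_exists:
  assumes "\<kappa> \<ge> 1"
  shows "\<exists>m. cone_midpoint_ineq \<kappa> u v m"
proof -
  have \<kappa>: "\<kappa> > 0" using assms by simp
  have ordered: "\<exists>m. cone_midpoint_ineq \<kappa> u v m" if "cmod v \<le> cmod u" for u v
  proof (cases "u = 0")
    case True
    then have "v = 0" using that by simp
    then have "cone_midpoint_ineq \<kappa> u v 0" using True \<kappa> by (simp add: cone_midpoint_ineq_def cone_dist_0)
    then show ?thesis ..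
  next
    case False
    have "\<bar>Arg (u / v)\<bar> = \<bar>Arg (v / u)\<bar>" using abs_Arg_inverse[of "v / u"] by (simp add: inverse_eq_divide)
    then show ?thesis
      using cone_midpoint_shadow[OF assms False that] cone_midpoint_visible[OF assms False, of v]
      by (metis not_less)
  qed
  show ?thesis
    using ordered[of v u] ordered[of u v] cone_midpoint_ineq_commute by (metis linear)
qed

section \<open>The cone distance as the dual distance of its density\<close>

lemma cone_dist_infinitesimal:
  assumes "\<kappa> > 0" "u \<noteq> 0"
  shows "ptwise_lipschitz (cone_dist \<kappa> u) u (\<kappa> * cmod u powr (\<kappa> - 1))"
proof -
  \<comment> \<open>Near \<open>u\<close>, the principal branch of the power \<open>\<kappa>\<close>
    of \<open>v / u\<close> develops the cone into the plane, up to the scale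
    \<open>cmod u powr \<kappa>\<close>. The constant is this scale times the modulus of the
    derivative \<open>\<kappa> / u\<close>.\<close>
  define w where "w v = exp (of_real \<kappa> * Ln (v / u))" for v
  have w_u: "w u = 1" using assms by (simp add: w_def)
  have der: "(w has_field_derivative of_real \<kappa> / u) (at u)"
    unfolding w_def using assms by (auto intro!: derivative_eq_intros simp: divide_simps)
  have eq: "cone_dist \<kappa> u v = cmod u powr \<kappa> * cmod (w v - 1)" if v: "v \<noteq> 0" "\<kappa> * \<bar>Arg (v / u)\<bar> < pi" for v
  proof -
    define \<Psi> where "\<Psi> = \<kappa> * Arg (v / u)"
    have "w v = rcis (cmod (v / u) powr \<kappa>) \<Psi>"
      using v assms
      by (simp add: w_def exp_eq_polar Arg_eq_Im_Ln rcis_def powr_def Re_Ln \<Psi>_def mult.commute)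
    then have "cmod (w v - 1) = cmod (rcis 1 0 - rcis (cmod (v / u) powr \<kappa>) (0 + \<Psi>))"
      by (simp add: norm_minus_commute)
    then have 1: "cmod (w v - 1) = chord 1 (cmod (v / u) powr \<kappa>) \<Psi>" by (simp only: chord_eq_cmod[where B = 0])
    have 2: "min pi (\<kappa> * \<bar>Arg (u / v)\<bar>) = \<bar>\<Psi>\<bar>"
      using abs_Arg_inverse[of "v / u"] v assms by (simp add: \<Psi>_def abs_mult inverse_eq_divide)
    define r where "r = cmod u powr \<kappa>"
    have r: "r > 0" using assms by (simp add: r_def)
    have "cmod v powr \<kappa> = r * cmod (v / u) powr \<kappa>"
      using assms by (simp add: r_def powr_mult[symmetric] norm_divide)
    then have "cone_dist \<kappa> u v = chord r (r * cmod (v / u) powr \<kappa>) \<Psi>"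
      unfolding cone_dist_def 2 by (simp add: r_def chord_def)
    also have "\<dots> = sqrt (r\<^sup>2 * (1 + (cmod (v / u) powr \<kappa>)\<^sup>2 - 2 * (cmod (v / u) powr \<kappa>) * cos \<Psi>))"
      unfolding chord_def by (simp add: power2_eq_square algebra_simps)
    also have "\<dots> = r * chord 1 (cmod (v / u) powr \<kappa>) \<Psi>"
      using r by (simp add: real_sqrt_mult chord_def)
    finally show ?thesis using 1 by (simp add: r_def)
  qed
  have "isCont (\<lambda>v. Arg (v / u)) u"
  proof (rule isCont_o2[where g = Arg])
    show "isCont (\<lambda>v. v / u) u" using assms by (intro continuous_intros)
    show "isCont Arg (u / u)" using assms by (intro continuous_at_Arg) auto
  qed
  then have "isCont (\<lambda>v. \<kappa> * \<bar>Arg (v / u)\<bar>) u" by (intro continuous_intros)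
  then have "((\<lambda>v. \<kappa> * \<bar>Arg (v / u)\<bar>) \<longlongrightarrow> \<kappa> * \<bar>Arg (u / u)\<bar>) (nhds u)"
    using tendsto_at_iff_tendsto_nhds[of "\<lambda>v. \<kappa> * \<bar>Arg (v / u)\<bar>" u] by (simp only: isCont_def)
  then have "\<forall>\<^sub>F v in nhds u. \<kappa> * \<bar>Arg (v / u)\<bar> < pi"
    using assms by (intro order_tendstoD) auto
  moreover have "\<forall>\<^sub>F v in nhds u. v \<noteq> 0"
    using assms(2) by (rule t1_space_nhds)
  ultimately have ev: "\<forall>\<^sub>F v in nhds u. cone_dist \<kappa> u v = cmod u powr \<kappa> * cmod (w v - 1)"
    by eventually_elim (rule eq)
  have lip: "ptwise_lipschitz (\<lambda>v. cmod u powr \<kappa> * cmod (v - 1)) (w u) (cmod u powr \<kappa>)"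
  proof (rule ptwise_lipschitz_of_bound, intro always_eventually allI)
    fix y
    show "\<bar>cmod u powr \<kappa> * cmod (y - 1) - cmod u powr \<kappa> * cmod (w u - 1)\<bar> \<le> cmod u powr \<kappa> * dist y (w u)"
      by (simp add: w_u dist_norm abs_mult)
  qed
  have "ptwise_lipschitz (\<lambda>v. cmod u powr \<kappa> * cmod (w v - 1)) u (cmod u powr \<kappa> * cmod (of_real \<kappa> / u))"
    using ptwise_lipschitz_compose_field[OF lip der] by simp
  also have "cmod u powr \<kappa> * cmod (of_real \<kappa> / u) = \<kappa> * cmod u powr (\<kappa> - 1)"
    using assms by (simp add: norm_divide powr_diff)
  finally show ?thesis
  proof (rule ptwise_lipschitz_dominated)
    have eq_u: "cone_dist \<kappa> u u = cmod u powr \<kappa> * cmod (w u - 1)"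
      by (rule eventually_nhds_x_imp_x[OF ev])
    from ev show "\<forall>\<^sub>F v in nhds u. \<bar>cone_dist \<kappa> u v - cone_dist \<kappa> u u\<bar>
        \<le> \<bar>cmod u powr \<kappa> * cmod (w v - 1) - cmod u powr \<kappa> * cmod (w u - 1)\<bar>"
      by eventually_elim (simp add: eq_u)
  qed
qed

text \<open>The density is integrated along the radius, where it is the derivative of
  \<open>cmod u powr \<kappa> * t powr \<kappa>\<close>; at the apex only continuity is
  used.\<close>

lemma radial_bound:
  fixes f :: "complex \<Rightarrow> real"
  assumes "\<kappa> \<ge> 1" and cont: "continuous_on (ball 0 R) f"
    and lip: "\<And>u. u \<in> ball 0 R \<Longrightarrow> u \<noteq> 0 \<Longrightarrow> ptwise_lipschitz f u (\<kappa> * cmod u powr (\<kappa> - 1))"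
    and u: "u \<in> ball 0 R"
  shows "\<bar>f u - f 0\<bar> \<le> cmod u powr \<kappa>"
proof (cases "u = 0")
  case False
  have in_ball: "of_real t * u \<in> ball 0 R" if "0 \<le> t" "t \<le> 1" for t
    using that u mult_left_le_one_le[of "cmod u" t] by (auto simp: norm_mult)
  have "\<bar>f (of_real 1 * u) - f (of_real 0 * u)\<bar> \<le> cmod u powr \<kappa> * 1 powr \<kappa> - cmod u powr \<kappa> * 0 powr \<kappa>"
  proof (rule ptwise_lipschitz_increment[OF zero_less_one, where G' = "\<lambda>t. cmod u powr \<kappa> * (\<kappa> * t powr (\<kappa> - 1))"])
    show "continuous_on {0..1} (\<lambda>t. f (of_real t * u))"
      by (rule continuous_on_compose2[OF cont]) (use in_ball in \<open>auto intro!: continuous_intros\<close>)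
    show "continuous_on {0..1} (\<lambda>t. cmod u powr \<kappa> * t powr \<kappa>)"
      using assms(1) by (intro continuous_intros continuous_on_powr') auto
    fix t :: real assume t: "t \<in> {0<..<1}"
    show "((\<lambda>t. cmod u powr \<kappa> * t powr \<kappa>) has_real_derivative cmod u powr \<kappa> * (\<kappa> * t powr (\<kappa> - 1))) (at t)"
      using t by (auto intro!: derivative_eq_intros)
    have der: "((\<lambda>t. of_real t * u) has_vector_derivative u) (at t)"
      by (auto intro!: derivative_eq_intros simp: has_vector_derivative_def scaleR_conv_of_real)
    have "ptwise_lipschitz f (of_real t * u) (\<kappa> * cmod (of_real t * u) powr (\<kappa> - 1))"
      using in_ball[of t] t False by (intro lip) auto
    from ptwise_lipschitz_compose_curve[OF this der]
    have "ptwise_lipschitz (\<lambda>s. f (of_real s * u)) t (\<kappa> * cmod (of_real t * u) powr (\<kappa> - 1) * cmod u)"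
      using assms(1) by simp
    also have "\<kappa> * cmod (of_real t * u) powr (\<kappa> - 1) * cmod u = cmod u powr \<kappa> * (\<kappa> * t powr (\<kappa> - 1))"
      using t False by (simp add: norm_mult powr_mult powr_diff)
    finally show "ptwise_lipschitz (\<lambda>s. f (of_real s * u)) t (cmod u powr \<kappa> * (\<kappa> * t powr (\<kappa> - 1)))" .
  qed
  then show ?thesis by simp
qed auto

text \<open>The straight segment from 1 to \<open>W\<close>, the developed image of
  \<open>v\<close>, is pulled back by the root of order \<open>\<kappa>\<close>. Along the resulting
  path \<open>g\<close> the factor \<open>cmod (L t)\<close> cancels, so that the speed is
  constant.\<close>

lemma visible_bound:
  fixes f :: "complex \<Rightarrow> real"
  assumes "\<kappa> \<ge> 1" and cont: "continuous_on (ball 0 R) f"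
    and lip: "\<And>u. u \<in> ball 0 R \<Longrightarrow> u \<noteq> 0 \<Longrightarrow> ptwise_lipschitz f u (\<kappa> * cmod u powr (\<kappa> - 1))"
    and u: "u \<in> ball 0 R" "u \<noteq> 0" and v: "v \<in> ball 0 R" "v \<noteq> 0"
    and vis: "\<kappa> * \<bar>Arg (v / u)\<bar> < pi"
  shows "\<bar>f v - f u\<bar> \<le> cone_dist \<kappa> u v"
proof -
  have \<kappa>: "\<kappa> > 0" using assms by simp
  define \<Psi> where "\<Psi> = \<kappa> * Arg (v / u)"
  have \<Psi>: "\<bar>\<Psi>\<bar> < pi" using vis \<kappa> by (simp add: \<Psi>_def abs_mult)
  define W where "W = exp (of_real \<kappa> * Ln (v / u))"
  have ImL: "Im (of_real \<kappa> * Ln (v / u)) = \<Psi>" using u v by (simp add: \<Psi>_def Arg_eq_Im_Ln)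
  have LnW: "Ln W = of_real \<kappa> * Ln (v / u)" unfolding W_def using \<Psi> ImL by (intro Ln_exp) auto
  have cW: "cmod W = cmod (v / u) powr \<kappa>"
    using u v \<kappa> by (simp add: W_def powr_def Re_Ln mult.commute)
  have ArgW: "Arg W = \<Psi>" using Arg_eq_Im_Ln[of W] LnW ImL by (simp add: W_def)
  have W: "W \<notin> \<real>\<^sub>\<le>\<^sub>0"
  proof
    assume "W \<in> \<real>\<^sub>\<le>\<^sub>0"
    moreover have "W \<noteq> 0" by (simp add: W_def)
    ultimately have "Arg W = pi" by (auto simp: complex_nonpos_Reals_iff Arg_eq_pi complex_eq_iff less_le)
    then show False using ArgW \<Psi> by simp
  qed
  define L where "L t = 1 + of_real t * (W - 1)" for t :: real
  \<comment> \<open>A segment from 1 can meet the closed negative axis only if \<open>W\<close> lies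
    on it; so the root is holomorphic along the whole path.\<close>
  have L: "L t \<notin> \<real>\<^sub>\<le>\<^sub>0" if "0 \<le> t" "t \<le> 1" for t
  proof
    assume "L t \<in> \<real>\<^sub>\<le>\<^sub>0"
    then have *: "Re (L t) \<le> 0" "Im (L t) = 0" by (auto simp: complex_nonpos_Reals_iff)
    show False
    proof (cases "t = 0")
      case False
      then have "Im W = 0" using * by (simp add: L_def)
      then have "Re W > 0" using W by (auto simp: complex_nonpos_Reals_iff)
      then have "(1 - t) + t * Re W > 0" using that False by (intro add_nonneg_pos mult_pos_pos) auto
      then show False using * by (simp add: L_def algebra_simps)
    qed (use * in \<open>simp add: L_def\<close>)
  qed
  define g where "g t = u * exp (Ln (L t) / of_real \<kappa>)" for t
  have g01: "g 0 = u" "g 1 = v"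
    using u v \<kappa> by (simp_all add: g_def L_def LnW)
  have cg: "cmod (g t) = cmod u * cmod (L t) powr (1 / \<kappa>)" if "0 \<le> t" "t \<le> 1" for t
  proof -
    have "L t \<noteq> 0" using L[OF that] by auto
    then show ?thesis by (simp add: g_def norm_mult powr_def Re_Ln)
  qed
  \<comment> \<open>Norms along the segment are at most the larger of those at its ends, so the
    pulled back path does not leave the ball.\<close>
  have g_ball: "g t \<in> ball 0 R" if "0 \<le> t" "t \<le> 1" for t
  proof -
    have "L t = of_real (1 - t) + of_real t * W" by (simp add: L_def algebra_simps)
    then have "cmod (L t) \<le> (1 - t) + t * cmod W"
      using that norm_triangle_ineq[of "of_real (1 - t)" "of_real t * W"] by (simp add: norm_mult del: of_real_diff)
    also have "\<dots> \<le> (1 - t) * max 1 (cmod W) + t * max 1 (cmod W)"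
      using that mult_left_mono[of 1 "max 1 (cmod W)" "1 - t"] mult_left_mono[of "cmod W" "max 1 (cmod W)" t] by simp
    also have "\<dots> = max 1 (cmod W)" by (simp add: algebra_simps)
    finally have "cmod (L t) powr (1 / \<kappa>) \<le> max 1 (cmod W) powr (1 / \<kappa>)"
      using \<kappa> by (intro powr_mono2) auto
    also have "\<dots> = max 1 (cmod (v / u))"
      using \<kappa> powr_mono2[of "1 / \<kappa>" 1 "cmod W"] powr_mono2[of "1 / \<kappa>" "cmod W" 1]
      by (auto simp: max_def cW powr_powr)
    finally have "cmod (g t) \<le> cmod u * max 1 (cmod (v / u))" by (simp add: cg[OF that] mult_left_mono)
    also have "\<dots> = max (cmod u) (cmod v)" using u by (simp add: max_mult_distrib_left norm_divide)
    finally show ?thesis using u v by auto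
  qed
  have g0: "g t \<noteq> 0" for t using u by (simp add: g_def)
  have der: "(g has_vector_derivative g t * (W - 1) / (of_real \<kappa> * L t)) (at t)" if "0 \<le> t" "t \<le> 1" for t
  proof -
    have 1: "((\<lambda>z. u * exp (Ln (1 + z * (W - 1)) / of_real \<kappa>)) has_field_derivative
        g t * (W - 1) / (of_real \<kappa> * L t)) (at (of_real t))"
      using L[OF that] \<kappa> unfolding g_def L_def
      by (auto intro!: derivative_eq_intros simp: divide_simps)
    show ?thesis using has_vector_derivative_real_field[OF 1] by (simp add: g_def[abs_def] L_def[abs_def])
  qed
  have "\<bar>f (g 1) - f (g 0)\<bar> \<le> cmod u powr \<kappa> * cmod (W - 1) * 1 - cmod u powr \<kappa> * cmod (W - 1) * 0"
  proof (rule ptwise_lipschitz_increment_open[where G' = "\<lambda>_. cmod u powr \<kappa> * cmod (W - 1)"])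
    fix t :: real assume "t \<in> {0..1}"
    then have t: "0 \<le> t" "t \<le> 1" by auto
    have L0: "L t \<noteq> 0" using L[OF t] by auto
    have "ptwise_lipschitz f (g t) (\<kappa> * cmod (g t) powr (\<kappa> - 1))" using g_ball[OF t] g0 by (intro lip)
    from ptwise_lipschitz_compose_curve[OF this der[OF t]]
    have "ptwise_lipschitz (\<lambda>t. f (g t)) t
        (\<kappa> * cmod (g t) powr (\<kappa> - 1) * cmod (g t * (W - 1) / (of_real \<kappa> * L t)))"
      using \<kappa> by simp
    also have "\<kappa> * cmod (g t) powr (\<kappa> - 1) * cmod (g t * (W - 1) / (of_real \<kappa> * L t)) =
        cmod (g t) powr \<kappa> / cmod (L t) * cmod (W - 1)"
      using \<kappa> g0[of t] by (simp add: norm_mult norm_divide powr_diff)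
    also have "cmod (g t) powr \<kappa> / cmod (L t) = cmod u powr \<kappa>"
      using \<kappa> L0 by (simp add: cg[OF t] powr_mult powr_powr)
    finally show "ptwise_lipschitz (\<lambda>t. f (g t)) t (cmod u powr \<kappa> * cmod (W - 1))" .
  qed (auto intro!: derivative_eq_intros)
  moreover have "cmod u powr \<kappa> * cmod (W - 1) = cone_dist \<kappa> u v"
  proof -
    have "W = rcis (cmod W) (0 + \<Psi>)" using rcis_cmod_Arg[of W] ArgW by simp
    then have 1: "cmod (W - 1) = chord 1 (cmod W) \<Psi>"
      unfolding chord_eq_cmod[where B = 0] by (metis norm_minus_commute rcis_zero_arg of_real_1)
    have 2: "min pi (\<kappa> * \<bar>Arg (u / v)\<bar>) = \<bar>\<Psi>\<bar>"
      using abs_Arg_inverse[of "v / u"] \<Psi> \<kappa> by (simp add: \<Psi>_def abs_mult inverse_eq_divide)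
    define r where "r = cmod u powr \<kappa>"
    have r: "r > 0" using u by (simp add: r_def)
    have "cmod v powr \<kappa> = r * cmod W"
      using u by (simp add: r_def cW powr_mult[symmetric] norm_divide)
    then have "cone_dist \<kappa> u v = chord r (r * cmod W) \<Psi>"
      unfolding cone_dist_def 2 by (simp add: r_def chord_def)
    also have "\<dots> = sqrt (r\<^sup>2 * (1 + (cmod W)\<^sup>2 - 2 * cmod W * cos \<Psi>))"
      unfolding chord_def by (simp add: power2_eq_square algebra_simps)
    also have "\<dots> = r * chord 1 (cmod W) \<Psi>"
      using r by (simp add: real_sqrt_mult chord_def)
    finally show ?thesis using 1 by (simp add: r_def)
  qed
  ultimately show ?thesis by (simp add: g01)
qed

text \<open>The two cases follow the shape of the shortest path: two radii through the apex, or a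
  segment of the developed sector.\<close>

lemma cone_dist_bound:
  fixes f :: "complex \<Rightarrow> real"
  assumes "\<kappa> \<ge> 1" and cont: "continuous_on (ball 0 R) f"
    and lip: "\<And>u. u \<in> ball 0 R \<Longrightarrow> u \<noteq> 0 \<Longrightarrow> ptwise_lipschitz f u (\<kappa> * cmod u powr (\<kappa> - 1))"
    and u: "u \<in> ball 0 R" and v: "v \<in> ball 0 R"
  shows "\<bar>f v - f u\<bar> \<le> cone_dist \<kappa> u v"
proof (cases "u = 0 \<or> v = 0 \<or> pi \<le> \<kappa> * \<bar>Arg (u / v)\<bar>")
  case True
  then have "cone_dist \<kappa> u v = cmod u powr \<kappa> + cmod v powr \<kappa>"
    using assms(1) by (auto simp: cone_dist_0 cone_dist_0_right)
      (auto simp: cone_dist_def chord_pi)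
  then show ?thesis
    using radial_bound[OF assms(1) cont lip u] radial_bound[OF assms(1) cont lip v] by linarith
next
  case False
  then have "\<kappa> * \<bar>Arg (v / u)\<bar> < pi"
    using abs_Arg_inverse[of "v / u"] by (simp add: inverse_eq_divide)
  then show ?thesis using visible_bound[OF assms(1) cont lip u _ v] False by auto
qed

lemma cone_dist_self: "cone_dist \<kappa> u u = 0"
  by (cases "u = 0") (auto simp: cone_dist_def chord_def power2_eq_square)

section \<open>Cone charts as local isometries\<close>

context conformal_density
begin

text \<open>The density of the cone of angle \<open>2 * pi * \<kappa>\<close> in the coordinate \<open>u\<close> is \<open>\<kappa> * \<bar>u\<bar> powr (\<kappa> - 1)\<close>.\<close>

definition cone_chart :: "complex \<Rightarrow> real \<Rightarrow> real \<Rightarrow> (complex \<Rightarrow> complex) \<Rightarrow> bool" where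
  "cone_chart z0 e \<kappa> \<zeta> \<longleftrightarrow> e > 0 \<and> \<kappa> \<ge> 1 \<and> \<zeta> holomorphic_on ball z0 e \<and> inj_on \<zeta> (ball z0 e) \<and> \<zeta> z0 = 0 \<and>
    (\<forall>z\<in>ball z0 e. deriv \<zeta> z \<noteq> 0) \<and>
    (\<forall>z\<in>ball z0 e - {z0}. \<rho> z = \<kappa> * cmod (\<zeta> z) powr (\<kappa> - 1) * cmod (deriv \<zeta> z))"

text \<open>Leaving a small disc means crossing an annulus, where the density has a positive minimum
  even if it vanishes at \<open>z0\<close>. Dually, the test function \<open>f\<close> grows only on
  the annulus.\<close>

lemma small_d_ball:
  assumes pos: "\<And>z. z \<in> ball z0 e - {z0} \<Longrightarrow> \<rho> z > 0" and "e > 0"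
  shows "\<exists>h>0. \<forall>y. d z0 y < h \<longrightarrow> dist z0 y < e"
proof -
  define e1 where "e1 = e / 3"
  have e1: "e1 > 0" "2 * e1 < e" using \<open>e > 0\<close> by (auto simp: e1_def)
  define A where "A = cball z0 (2 * e1) - ball z0 e1"
  have "compact A" unfolding A_def by (intro compact_diff) auto
  moreover have "A \<noteq> {}"
    using e1 by (intro ex_in_conv[THEN iffD1] exI[of _ "z0 + of_real e1"]) (auto simp: A_def dist_norm)
  moreover have "continuous_on A \<rho>" using \<rho>_cont continuous_on_subset by blast
  ultimately obtain p where p: "p \<in> A" "\<And>z. z \<in> A \<Longrightarrow> \<rho> p \<le> \<rho> z"
    using continuous_attains_inf by metis
  have c: "\<rho> p > 0" using p(1) e1 by (intro pos) (auto simp: A_def)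
  define f where "f y = \<rho> p * min (max (dist z0 y - e1) 0) e1" for y
  have "admissible f" unfolding admissible_def
  proof
    fix y
    consider "dist z0 y < e1" | "y \<in> A" | "dist z0 y > 2 * e1" by (force simp: A_def)
    then show "ptwise_lipschitz f y (\<rho> y)"
    proof cases
      case 1
      then have "\<forall>\<^sub>F y' in nhds y. y' \<in> ball z0 e1" by (intro eventually_nhds_in_open) auto
      then have "\<forall>\<^sub>F y' in nhds y. \<bar>f y' - f y\<bar> \<le> 0 * dist y' y"
        by eventually_elim (use 1 e1 in \<open>auto simp: f_def\<close>)
      then show ?thesis by (rule ptwise_lipschitz_mono[OF ptwise_lipschitz_of_bound \<rho>_nonneg])
    next
      case 2
      have "\<bar>f y' - f y\<bar> \<le> \<rho> p * dist y' y" for y'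
      proof -
        have "\<bar>min (max (dist z0 y' - e1) 0) e1 - min (max (dist z0 y - e1) 0) e1\<bar> \<le> dist y' y"
          using dist_triangle[of z0 y y'] dist_triangle[of z0 y' y] by (simp add: dist_commute)
        then show ?thesis using c by (simp add: f_def right_diff_distrib[symmetric] abs_mult)
      qed
      then show ?thesis
        by (intro ptwise_lipschitz_mono[OF ptwise_lipschitz_of_bound p(2)[OF 2]] always_eventually allI)
    next
      case 3
      then have "\<forall>\<^sub>F y' in nhds y. y' \<in> - cball z0 (2 * e1)" by (intro eventually_nhds_in_open) auto
      then have "\<forall>\<^sub>F y' in nhds y. \<bar>f y' - f y\<bar> \<le> 0 * dist y' y"
        by eventually_elim (use 3 e1 in \<open>auto simp: f_def\<close>)
      then show ?thesis by (rule ptwise_lipschitz_mono[OF ptwise_lipschitz_of_bound \<rho>_nonneg])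
    qed
  qed
  then have le: "f y - f z0 \<le> d z0 y" for y by (rule admissible_le_d)
  show ?thesis
  proof (intro exI[of _ "\<rho> p * e1"] conjI allI impI)
    show "\<rho> p * e1 > 0" using c e1 by simp
    fix y assume y: "d z0 y < \<rho> p * e1"
    have "f z0 = 0" using e1 by (simp add: f_def)
    then have "f y < \<rho> p * e1" using le[of y] y by linarith
    then have "\<rho> p * min (max (dist z0 y - e1) 0) e1 < \<rho> p * e1" by (simp add: f_def)
    then have "min (max (dist z0 y - e1) 0) e1 < e1" using c by simp
    then show "dist z0 y < e" using e1 by linarith
  qed
qed

lemma cone_chart_pos:
  assumes "cone_chart z0 e \<kappa> \<zeta>" "z \<in> ball z0 e - {z0}"
  shows "\<zeta> z \<noteq> 0" "\<rho> z > 0"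
proof -
  have "z0 \<in> ball z0 e" using assms(1) by (auto simp: cone_chart_def)
  then show "\<zeta> z \<noteq> 0" using assms unfolding cone_chart_def inj_on_def by (metis DiffD1 DiffD2 singletonI)
  then show "\<rho> z > 0" using assms by (simp add: cone_chart_def)
qed

lemma cone_chart_small_d_ball:
  assumes "cone_chart z0 e \<kappa> \<zeta>" "e' > 0"
  shows "\<exists>h>0. \<forall>y. d z0 y < h \<longrightarrow> dist z0 y < e'"
proof -
  have "e > 0" using assms(1) by (simp add: cone_chart_def)
  then have "\<exists>h>0. \<forall>y. d z0 y < h \<longrightarrow> dist z0 y < min e e'"
    using assms by (intro small_d_ball cone_chart_pos[OF assms(1)]) auto
  then show ?thesis by auto
qed

text \<open>By the triangle inequality, the constant at \<open>y\<close> is bounded by that of the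
  distance from \<open>\<zeta> y\<close> itself, which is known away from the apex. At
  \<open>z0\<close> the estimate is integrated along segments from \<open>z0\<close> and extended by
  continuity of \<open>\<rho>\<close>.\<close>

lemma cone_chart_lipschitz:
  assumes ch: "cone_chart z0 e \<kappa> \<zeta>" and y: "y \<in> ball z0 e"
  shows "ptwise_lipschitz (\<lambda>y. cone_dist \<kappa> u (\<zeta> y)) y (\<rho> y)"
proof -
  have \<kappa>: "\<kappa> > 0" "\<kappa> \<ge> 1" and hol: "\<zeta> holomorphic_on ball z0 e" and e: "e > 0" and z0: "\<zeta> z0 = 0"
    using ch by (auto simp: cone_chart_def)
  have cd: "\<bar>cone_dist \<kappa> w (\<zeta> y') - cone_dist \<kappa> w (\<zeta> y)\<bar> \<le> \<bar>cone_dist \<kappa> (\<zeta> y) (\<zeta> y') - cone_dist \<kappa> (\<zeta> y) (\<zeta> y)\<bar>" for w y y'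
    using cone_dist_triangle[OF \<kappa>(1), of w "\<zeta> y'" "\<zeta> y"] cone_dist_triangle[OF \<kappa>(1), of w "\<zeta> y" "\<zeta> y'"]
      cone_dist_commute[of \<kappa> "\<zeta> y" "\<zeta> y'"] by (simp add: cone_dist_self)
  have regular: "ptwise_lipschitz (\<lambda>y. cone_dist \<kappa> w (\<zeta> y)) y (\<rho> y)" if y: "y \<in> ball z0 e - {z0}" for w y
  proof -
    have "(\<zeta> has_field_derivative deriv \<zeta> y) (at y)"
      using hol y holomorphic_derivI by (metis DiffD1 open_ball)
    from ptwise_lipschitz_compose_field[OF cone_dist_infinitesimal[OF \<kappa>(1) cone_chart_pos(1)[OF ch y]] this]
    have "ptwise_lipschitz (\<lambda>y'. cone_dist \<kappa> (\<zeta> y) (\<zeta> y')) y (\<rho> y)"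
      using \<kappa> ch y by (simp add: cone_chart_def)
    then show ?thesis by (rule ptwise_lipschitz_dominated) (intro always_eventually allI cd)
  qed
  show ?thesis
  proof (cases "y = z0")
    case True
    have "ptwise_lipschitz (\<lambda>y. cone_dist \<kappa> 0 (\<zeta> y)) z0 (\<rho> z0)"
    proof (rule ptwise_lipschitzI)
      fix e' :: real assume "e' > 0"
      then obtain h where h: "h > 0" "\<And>z. z \<in> ball z0 h \<Longrightarrow> \<rho> z \<le> \<rho> z0 + e'" using \<rho>_near by blast
      show "\<forall>\<^sub>F y in nhds z0. \<bar>cone_dist \<kappa> 0 (\<zeta> y) - cone_dist \<kappa> 0 (\<zeta> z0)\<bar> \<le> (\<rho> z0 + e') * dist y z0"
        unfolding eventually_nhds_metric
      proof (intro exI[of _ "min h e"] conjI allI impI)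
        show "min h e > 0" using h e by simp
        fix y assume y: "dist y z0 < min h e"
        show "\<bar>cone_dist \<kappa> 0 (\<zeta> y) - cone_dist \<kappa> 0 (\<zeta> z0)\<bar> \<le> (\<rho> z0 + e') * dist y z0"
        proof (cases "y = z0")
          case False
          let ?M = "(\<rho> z0 + e') * dist y z0"
          have seg: "linepath z0 y t \<in> ball z0 (min h e)" if "0 \<le> t" "t \<le> 1" for t
          proof -
            have "linepath z0 y t \<in> closed_segment z0 y" using that by (intro linepath_in_path) auto
            then show ?thesis using closed_segment_subset[of z0 "ball z0 (min h e)" y] y h e
              by (auto simp: dist_commute)
          qed
          have "\<bar>cone_dist \<kappa> 0 (\<zeta> (linepath z0 y 1)) - cone_dist \<kappa> 0 (\<zeta> (linepath z0 y 0))\<bar> \<le> ?M * 1 - ?M * 0"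
          proof (rule ptwise_lipschitz_increment[OF zero_less_one, where G' = "\<lambda>_. ?M"])
            have "continuous_on {0..1} (\<lambda>t. \<zeta> (linepath z0 y t))"
              by (rule continuous_on_compose2[OF holomorphic_on_imp_continuous_on[OF hol]])
                (use seg in \<open>auto intro!: continuous_intros\<close>)
            then show "continuous_on {0..1} (\<lambda>t. cone_dist \<kappa> 0 (\<zeta> (linepath z0 y t)))"
              unfolding cone_dist_0[OF \<kappa>(1)] using \<kappa> by (intro continuous_on_powr' continuous_intros) auto
            fix t :: real assume t: "t \<in> {0<..<1}"
            have "linepath z0 y t - z0 = of_real t * (y - z0)" by (simp add: linepath_def algebra_simps scaleR_conv_of_real)
            then have ne: "linepath z0 y t \<noteq> z0" using t False by auto
            have der: "(linepath z0 y has_vector_derivative (y - z0)) (at t)"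
              unfolding linepath_def by (auto intro!: derivative_eq_intros simp: algebra_simps)
            have "ptwise_lipschitz (\<lambda>y. cone_dist \<kappa> 0 (\<zeta> y)) (linepath z0 y t) (\<rho> z0 + e')"
              by (rule ptwise_lipschitz_mono[OF regular h(2)]) (use seg[of t] t ne in auto)
            from ptwise_lipschitz_compose_curve[OF this der]
            show "ptwise_lipschitz (\<lambda>t. cone_dist \<kappa> 0 (\<zeta> (linepath z0 y t))) t ?M"
              using \<rho>_nonneg[of z0] \<open>e' > 0\<close> by (simp add: dist_norm)
          qed (auto intro!: derivative_eq_intros continuous_intros)
          then show ?thesis by (simp add: linepath_def)
        qed simp
      qed
    qed
    then have "ptwise_lipschitz (\<lambda>y. cone_dist \<kappa> u (\<zeta> y)) z0 (\<rho> z0)"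
      by (rule ptwise_lipschitz_dominated) (use cd[of u _ z0] z0 in \<open>auto intro!: always_eventually\<close>)
    then show ?thesis using True by simp
  qed (use regular y in auto)
qed

text \<open>Every test function is transported to the cone by the inverse chart. The comparison
  paths in the cone stay in a ball around the apex, so it is enough that the chart covers
  \<open>ball 0 R\<close>.\<close>

lemma cone_chart_upper:
  assumes ch: "cone_chart z0 e \<kappa> \<zeta>" and R: "ball 0 R \<subseteq> \<zeta> ` ball z0 e"
    and x: "x \<in> ball z0 e" "\<zeta> x \<in> ball 0 R" and y: "y \<in> ball z0 e" "\<zeta> y \<in> ball 0 R"
  shows "d x y \<le> cone_dist \<kappa> (\<zeta> x) (\<zeta> y)"
proof (rule d_leI)
  fix f assume f: "admissible f"
  have \<kappa>: "\<kappa> \<ge> 1" and hol: "\<zeta> holomorphic_on ball z0 e" and inj: "inj_on \<zeta> (ball z0 e)"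
    using ch by (auto simp: cone_chart_def)
  obtain Z where Z: "Z holomorphic_on (\<zeta> ` ball z0 e)"
    "\<And>z. z \<in> ball z0 e \<Longrightarrow> deriv \<zeta> z * deriv Z (\<zeta> z) = 1" "\<And>z. z \<in> ball z0 e \<Longrightarrow> Z (\<zeta> z) = z"
    using holomorphic_has_inverse[OF hol open_ball inj] by metis
  have f_cont: "continuous_on UNIV f"
    using f by (auto simp: admissible_def intro!: continuous_at_imp_continuous_on ptwise_lipschitz_imp_isCont)
  have "\<bar>f (Z (\<zeta> y)) - f (Z (\<zeta> x))\<bar> \<le> cone_dist \<kappa> (\<zeta> x) (\<zeta> y)"
  proof (rule cone_dist_bound[OF \<kappa> _ _ x(2) y(2)])
    have "continuous_on (ball 0 R) Z"
      using Z(1) R by (meson continuous_on_subset holomorphic_on_imp_continuous_on)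
    then show "continuous_on (ball 0 R) (\<lambda>u. f (Z u))"
      by (rule continuous_on_compose2[OF f_cont]) auto
    fix u assume u: "u \<in> ball 0 R" "u \<noteq> (0::complex)"
    then obtain z where z: "z \<in> ball z0 e" "u = \<zeta> z" using R by auto
    have "z \<noteq> z0" using z u ch by (auto simp: cone_chart_def)
    have "(Z has_field_derivative deriv Z u) (at u)"
      using holomorphic_derivI[OF holomorphic_on_subset[OF Z(1) R] open_ball u(1)] .
    from ptwise_lipschitz_compose_field[OF _ this, of f "\<rho> (Z u)"]
    have "ptwise_lipschitz (\<lambda>u. f (Z u)) u (\<rho> (Z u) * cmod (deriv Z u))"
      using f \<rho>_nonneg by (auto simp: admissible_def)
    moreover have "cmod (deriv \<zeta> z) * cmod (deriv Z u) = 1"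
      using Z(2)[OF z(1)] z(2) by (metis norm_mult norm_one)
    then have "\<rho> (Z u) * cmod (deriv Z u) = \<kappa> * cmod u powr (\<kappa> - 1)"
      using z \<open>z \<noteq> z0\<close> ch Z(3)[OF z(1)] by (simp add: cone_chart_def mult.assoc)
    ultimately show "ptwise_lipschitz (\<lambda>u. f (Z u)) u (\<kappa> * cmod u powr (\<kappa> - 1))" by simp
  qed
  then show "f y - f x \<le> cone_dist \<kappa> (\<zeta> x) (\<zeta> y)" using Z(3) x y by simp
qed

text \<open>The cone distance in the chart is itself a local test function, which gives the lower
  bound; \<open>cone_chart_upper\<close> gives the other. The midpoint is no farther from the apex
  than the farther of its two ends, hence remains in the isometric ball.\<close>

lemma cone_chart_isometry:
  assumes ch: "cone_chart z0 e \<kappa> \<zeta>"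
  shows "\<exists>r>0. (\<forall>x. d z0 x < r \<longrightarrow> x \<in> ball z0 e) \<and>
    (\<forall>x y. d z0 x < r \<longrightarrow> d z0 y < r \<longrightarrow> d x y = cone_dist \<kappa> (\<zeta> x) (\<zeta> y) \<and>
      (\<exists>m. \<forall>q. d z0 q < r \<longrightarrow> (d q m)\<^sup>2 \<le> (d q x)\<^sup>2 / 2 + (d q y)\<^sup>2 / 2 - (d x y)\<^sup>2 / 4))"
proof -
  have \<kappa>: "\<kappa> > 0" "\<kappa> \<ge> 1" and hol: "\<zeta> holomorphic_on ball z0 e" and e: "e > 0" and z0: "\<zeta> z0 = 0"
    and inj: "inj_on \<zeta> (ball z0 e)"
    using ch by (auto simp: cone_chart_def)
  have "open (\<zeta> ` ball z0 e)" using hol inj by (intro open_mapping_thm3) auto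
  moreover have "0 \<in> \<zeta> ` ball z0 e" using z0 e by (metis centre_in_ball image_eqI)
  ultimately obtain R where R: "R > 0" "ball 0 R \<subseteq> \<zeta> ` ball z0 e" by (meson open_contains_ball)
  have "isCont \<zeta> z0"
    using holomorphic_on_imp_continuous_on[OF hol] e by (simp add: continuous_on_eq_continuous_at)
  then obtain e1 where e1: "e1 > 0" "\<And>z. dist z z0 < e1 \<Longrightarrow> dist (\<zeta> z) (\<zeta> z0) < R"
    using R(1) unfolding continuous_at_eps_delta by blast
  obtain h where h: "h > 0" "\<And>y. d z0 y < h \<Longrightarrow> dist z0 y < min e e1"
    using cone_chart_small_d_ball[OF ch, of "min e e1"] e e1 by auto
  \<comment> \<open>\<open>abs_diff_le_d_local\<close> will be used with \<open>e = 2 * r\<close>: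
    points within \<open>e / 2 = r\<close>, a test function controlled within
    \<open>4 * e = h\<close>.\<close>
  define r where "r = h / 8"
  have r: "r > 0" using h by (simp add: r_def)
  have in_ball: "x \<in> ball z0 e" "\<zeta> x \<in> ball 0 R" if "d z0 x < h" for x
    using h(2)[OF that] e1(2)[of x] z0 by (auto simp: dist_commute)
  have iso: "d x y = cone_dist \<kappa> (\<zeta> x) (\<zeta> y)" if "d z0 x < r" "d z0 y < r" for x y
  proof (rule antisym)
    show "d x y \<le> cone_dist \<kappa> (\<zeta> x) (\<zeta> y)"
      by (rule cone_chart_upper[OF ch R(2)]) (use in_ball that r h in \<open>auto simp: r_def\<close>)
    have "\<bar>cone_dist \<kappa> (\<zeta> x) (\<zeta> y) - cone_dist \<kappa> (\<zeta> x) (\<zeta> x)\<bar> \<le> d x y"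
      by (rule abs_diff_le_d_local[of z0 "2 * r"])
        (use in_ball that in \<open>auto simp: r_def intro!: cone_chart_lipschitz[OF ch]\<close>)
    then show "cone_dist \<kappa> (\<zeta> x) (\<zeta> y) \<le> d x y" by (simp add: cone_dist_self)
  qed
  have "\<exists>m. \<forall>q. d z0 q < r \<longrightarrow> (d q m)\<^sup>2 \<le> (d q x)\<^sup>2 / 2 + (d q y)\<^sup>2 / 2 - (d x y)\<^sup>2 / 4"
    if xy: "d z0 x < r" "d z0 y < r" for x y
  proof -
    obtain m' where m': "cone_midpoint_ineq \<kappa> (\<zeta> x) (\<zeta> y) m'" using cone_midpoint_exists[OF \<kappa>(2)] by blast
    have le: "cmod m' \<le> max (cmod (\<zeta> x)) (cmod (\<zeta> y))" using m' by (simp add: cone_midpoint_ineq_def)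
    have "d z0 x < h" "d z0 y < h" using xy r by (auto simp: r_def)
    then have "m' \<in> ball 0 R" using le in_ball(2)[of x] in_ball(2)[of y] by auto
    then obtain m where m: "m \<in> ball z0 e" "\<zeta> m = m'" using R(2) by auto
    have rad: "d z0 x = cmod (\<zeta> x) powr \<kappa>" if "d z0 x < r" for x
      using iso[OF _ that, of z0] r by (simp add: d_self z0 cone_dist_0[OF \<kappa>(1)])
    have "d z0 m \<le> cmod m' powr \<kappa>"
      using cone_chart_upper[OF ch R(2), of z0 m] e m \<open>m' \<in> ball 0 R\<close> R(1) by (simp add: z0 cone_dist_0[OF \<kappa>(1)])
    also have "\<dots> \<le> max (cmod (\<zeta> x)) (cmod (\<zeta> y)) powr \<kappa>" using le \<kappa> by (intro powr_mono2) auto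
    also have "\<dots> < r" using rad[OF xy(1)] rad[OF xy(2)] xy by (auto simp: max_def)
    finally have m_r: "d z0 m < r" .
    show ?thesis
    proof (intro exI[of _ m] allI impI)
      fix q assume "d z0 q < r"
      then show "(d q m)\<^sup>2 \<le> (d q x)\<^sup>2 / 2 + (d q y)\<^sup>2 / 2 - (d x y)\<^sup>2 / 4"
        using m' by (simp add: iso xy m_r m(2) cone_midpoint_ineq_def)
    qed
  qed
  then show ?thesis using r iso in_ball(1) by (intro exI[of _ r]) (auto simp: r_def)
qed

end

section \<open>Holomorphic normal form of a cubic differential at a point\<close>

text \<open>Solves \<open>((z - z0)\<^bsup>\<kappa>\<^esup> h)' = (z - z0)\<^bsup>\<kappa> - 1\<^esup> g\<close> without a branch of the power.\<close>

lemma holomorphic_radial_ode: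
  fixes g :: "complex \<Rightarrow> complex" and \<kappa> :: real
  assumes g: "g analytic_on {z0}" and "\<kappa> > 0"
  obtains e h where "e > 0" "h holomorphic_on ball z0 e"
    "\<And>z. z \<in> ball z0 e \<Longrightarrow> of_real \<kappa> * h z + (z - z0) * deriv h z = g z"
proof -
  define F where "F = fps_expansion g z0"
  have F: "(\<lambda>x. g (z0 + x)) has_fps_expansion F"
    unfolding F_def by (rule analytic_at_imp_has_fps_expansion[OF g])
  \<comment> \<open>Comparison of coefficients. Positivity of \<open>\<kappa>\<close> excludes
    resonance, and denominators of modulus at least \<open>\<kappa>\<close> do not reduce the radius
    of convergence.\<close>
  define H where "H = Abs_fps (\<lambda>n. fps_nth F n / (of_real \<kappa> + of_nat n))"
  have "fps_conv_radius F \<le> fps_conv_radius H"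
    unfolding fps_conv_radius_def
  proof (rule conv_radius_geI_ex')
    fix r :: real assume r: "0 < r" "ereal r < conv_radius (fps_nth F)"
    have "summable (\<lambda>n. norm (fps_nth F n * of_real r ^ n))"
      using r by (intro abs_summable_in_conv_radius) auto
    then have "summable (\<lambda>n. norm (fps_nth F n * of_real r ^ n) * (1 / \<kappa>))" by (rule summable_mult2)
    then show "summable (\<lambda>n. fps_nth H n * of_real r ^ n)"
    proof (rule summable_comparison_test'[where N = 0])
      fix n :: nat
      have "norm (of_real \<kappa> + of_nat n :: complex) = \<kappa> + real n"
        using \<open>\<kappa> > 0\<close> by (metis (no_types) abs_of_nonneg add_nonneg_nonneg less_imp_le norm_of_real of_nat_0_le_iff of_real_add of_real_of_nat_eq)
      then have "norm (fps_nth H n * of_real r ^ n) = norm (fps_nth F n * of_real r ^ n) * (1 / (\<kappa> + real n))"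
        by (simp add: H_def norm_mult norm_divide)
      also have "\<dots> \<le> norm (fps_nth F n * of_real r ^ n) * (1 / \<kappa>)"
        using \<open>\<kappa> > 0\<close> by (intro mult_left_mono) (auto simp: field_simps)
      finally show "norm (fps_nth H n * of_real r ^ n) \<le> norm (fps_nth F n * of_real r ^ n) * (1 / \<kappa>)" .
    qed
  qed
  moreover have "fps_conv_radius F > 0" using F by (simp add: has_fps_expansion_def)
  ultimately have radH: "fps_conv_radius H > 0" by simp
  obtain r where r: "r > 0" "ereal r < fps_conv_radius H"
    using radH by (metis ereal_dense2 ereal_less(2) less_ereal.simps(1) zero_ereal_def)
  have "\<forall>\<^sub>F x in nhds 0. eval_fps F x = g (z0 + x)" using F by (simp add: has_fps_expansion_def)
  then obtain r' where r': "r' > 0" "\<And>x. dist x 0 < r' \<Longrightarrow> eval_fps F x = g (z0 + x)"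
    unfolding eventually_nhds_metric by auto
  define e where "e = min r r'"
  define h where "h z = eval_fps H (z - z0)" for z
  have conv: "ereal (norm x) < fps_conv_radius H" if "norm x < r" for x
    using that r(2) by (meson ereal_less_eq(3) less_imp_le order_le_less_trans)
  have der: "(h has_field_derivative eval_fps (fps_deriv H) (z - z0)) (at z)" if "z \<in> ball z0 e" for z
  proof -
    have "(eval_fps H has_field_derivative eval_fps (fps_deriv H) (z - z0)) (at (z - z0))"
      using that by (intro has_field_derivative_eval_fps conv) (auto simp: e_def dist_norm norm_minus_commute)
    from DERIV_shift[THEN iffD1, of "eval_fps H" _ z "- z0"] this
    show ?thesis by (simp add: h_def[abs_def])
  qed
  have id: "fps_const (of_real \<kappa>) * H + fps_X * fps_deriv H = F"
  proof (rule fps_ext)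
    fix n
    have "of_real \<kappa> + of_nat n \<noteq> (0 :: complex)"
      using \<open>\<kappa> > 0\<close> by (metis add_nonneg_eq_0_iff less_imp_le less_irrefl of_nat_0_le_iff of_real_add of_real_eq_0_iff of_real_of_nat_eq)
    then have eq: "(of_real \<kappa> + of_nat n) * fps_nth H n = fps_nth F n" by (simp add: H_def)
    have "fps_nth (fps_X * fps_deriv H) n = of_nat n * fps_nth H n"
      by (cases n) auto
    then show "fps_nth (fps_const (of_real \<kappa>) * H + fps_X * fps_deriv H) n = fps_nth F n"
      using eq by (simp add: distrib_right)
  qed
  show ?thesis
  proof (rule that[of e h])
    show "e > 0" using r r' by (simp add: e_def)
    show "h holomorphic_on ball z0 e"
      unfolding holomorphic_on_open[OF open_ball] using der by blast
    fix z assume z: "z \<in> ball z0 e"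
    have n: "norm (z - z0) < r" "norm (z - z0) < r'" using z by (auto simp: e_def dist_norm norm_minus_commute)
    have rd: "ereal (norm (z - z0)) < fps_conv_radius (fps_deriv H)"
      using conv[OF n(1)] fps_conv_radius_deriv[of H] by simp
    have r1: "ereal (norm (z - z0)) < fps_conv_radius (fps_X * fps_deriv H)"
      using rd fps_conv_radius_mult[of "fps_X" "fps_deriv H"] by (auto simp: min_def split: if_splits)
    have r2: "ereal (norm (z - z0)) < fps_conv_radius (fps_const (of_real \<kappa>) * H)"
      using conv[OF n(1)] fps_conv_radius_mult[of "fps_const (of_real \<kappa>)" H] by (auto simp: min_def split: if_splits)
    have "eval_fps F (z - z0) = of_real \<kappa> * eval_fps H (z - z0) + (z - z0) * eval_fps (fps_deriv H) (z - z0)"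
      unfolding id[symmetric] using r1 r2 rd conv[OF n(1)] by (simp add: eval_fps_add eval_fps_mult)
    moreover have "eval_fps F (z - z0) = g z" using r'(2)[of "z - z0"] n by (simp add: dist_norm)
    moreover have "deriv h z = eval_fps (fps_deriv H) (z - z0)" using der[OF z] by (rule DERIV_imp_deriv)
    ultimately show "of_real \<kappa> * h z + (z - z0) * deriv h z = g z" by (simp add: h_def)
  qed
qed

text \<open>Provides a disc on which \<open>Ln (f z / f z0)\<close> is holomorphic, even when
  \<open>f z0\<close> lies on the branch cut of \<open>Ln\<close>.\<close>

lemma ball_Re_ratio_pos:
  fixes f :: "complex \<Rightarrow> complex"
  assumes "isCont f z0" "f z0 \<noteq> 0"
  obtains e where "e > 0" "\<And>z. z \<in> ball z0 e \<Longrightarrow> Re (f z / f z0) > 0"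
proof -
  have "isCont (\<lambda>z. f z / f z0) z0" using assms by simp
  then have "isCont (\<lambda>z. Re (f z / f z0)) z0" by (rule continuous_Re)
  then have "\<forall>\<^sub>F z in at z0. Re (f z / f z0) > 0"
    using assms(2) unfolding isCont_def by (intro order_tendstoD) auto
  then obtain e where "e > 0" "\<And>z. z \<noteq> z0 \<Longrightarrow> dist z z0 < e \<Longrightarrow> Re (f z / f z0) > 0"
    unfolding eventually_at by auto
  moreover have "Re (f z0 / f z0) > 0" using assms(2) by simp
  ultimately show ?thesis by (intro that[of e]) (metis dist_commute mem_ball)+
qed

text \<open>
  If \<open>P\<close> vanishes to order \<open>m\<close> at \<open>z0\<close>, then \<open>P dz\<^sup>3\<close> is the cube of the differential of \<open>\<zeta>\<^bsup>\<kappa>\<^esup>\<close>,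
  where \<open>\<kappa> = (m + 3) / 3\<close>.
\<close>

lemma cubic_normal_form:
  fixes P :: "complex poly"
  assumes "P \<noteq> 0"
  obtains e \<zeta> m where "e > 0" "\<zeta> holomorphic_on ball z0 e" "inj_on \<zeta> (ball z0 e)" "\<zeta> z0 = 0"
    "\<And>z. z \<in> ball z0 e \<Longrightarrow> deriv \<zeta> z \<noteq> 0"
    "\<And>z. z \<in> ball z0 e \<Longrightarrow> of_real ((real m + 3) / 3) ^ 3 * deriv \<zeta> z ^ 3 * \<zeta> z ^ m = poly P z"
proof -
  define m where "m = order z0 P"
  define \<kappa> where "\<kappa> = (real m + 3) / 3"
  have \<kappa>: "\<kappa> > 0" by (simp add: \<kappa>_def)
  obtain q where q: "P = [:- z0, 1:] ^ m * q" "\<not> [:- z0, 1:] dvd q"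
    unfolding m_def using order_decomp[OF assms] by metis
  have q0: "poly q z0 \<noteq> 0" using q(2) by (simp add: poly_eq_0_iff_dvd)
  obtain e0 where e0: "e0 > 0" "\<And>z. z \<in> ball z0 e0 \<Longrightarrow> Re (poly q z / poly q z0) > 0"
    using ball_Re_ratio_pos[where f = "poly q"] q0 by auto
  \<comment> \<open>A local cube root of \<open>q\<close>: the value at the centre is split off, and
    the principal branch is applied to the ratio.\<close>
  define g where "g z = exp (Ln (poly q z0) / 3) * exp (Ln (poly q z / poly q z0) / 3)" for z
  have g3: "g z ^ 3 = poly q z" if "z \<in> ball z0 e0" for z
  proof -
    have "poly q z \<noteq> 0" using e0(2)[OF that] by auto
    moreover have "exp (Ln a / 3) ^ 3 = a" if "a \<noteq> 0" for a
      using that by (simp add: exp_of_nat_mult[symmetric])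
    ultimately show ?thesis using q0 by (simp add: g_def power_mult_distrib)
  qed
  have hol_g: "g holomorphic_on ball z0 e0"
    unfolding g_def using e0(2) by (intro holomorphic_intros) (force simp: complex_nonpos_Reals_iff q0)+
  have "g analytic_on {z0}"
    using hol_g e0(1) analytic_on_open analytic_on_subset by (metis centre_in_ball empty_subsetI insert_subset open_ball)
  then obtain e1 h where e1: "e1 > 0" "h holomorphic_on ball z0 e1"
    "\<And>z. z \<in> ball z0 e1 \<Longrightarrow> of_real \<kappa> * h z + (z - z0) * deriv h z = g z"
    using holomorphic_radial_ode[OF _ \<kappa>] by metis
  have "g z0 \<noteq> 0" by (simp add: g_def)
  then have h0: "h z0 \<noteq> 0" using e1(3)[of z0] e1(1) by auto
  have "isCont h z0"
    using holomorphic_on_imp_continuous_on[OF e1(2)] e1(1) by (simp add: continuous_on_eq_continuous_at)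
  then obtain e2 where e2: "e2 > 0" "\<And>z. z \<in> ball z0 e2 \<Longrightarrow> Re (h z / h z0) > 0"
    using ball_Re_ratio_pos h0 by metis
  define e3 where "e3 = min e0 (min e1 e2)"
  have e3: "e3 > 0" using e0 e1 e2 by (simp add: e3_def)
  define l where "l z = Ln (h z0) + Ln (h z / h z0)" for z
  have hz: "h z \<noteq> 0" if "z \<in> ball z0 e3" for z using e2(2)[of z] that by (auto simp: e3_def)
  have exp_l: "exp (l z) = h z" if "z \<in> ball z0 e3" for z
    using hz[OF that] h0 by (simp add: l_def exp_add)
  \<comment> \<open>Formally the power \<open>\<kappa>\<close> of \<open>\<zeta>\<close> is that of
    \<open>z - z0\<close>, times \<open>h\<close>. The equation for \<open>h\<close> makes its
    derivative \<open>(z - z0)^(\<kappa> - 1) * g\<close>, whose cube is \<open>P\<close> because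
    \<open>3 * (\<kappa> - 1) = m\<close>.\<close>
  define \<zeta> where "\<zeta> z = (z - z0) * exp (l z / of_real \<kappa>)" for z
  have der_l: "(l has_field_derivative deriv h z / h z) (at z)" if "z \<in> ball z0 e3" for z
  proof -
    have "(h has_field_derivative deriv h z) (at z)"
      using that by (intro holomorphic_derivI[OF e1(2)]) (auto simp: e3_def)
    moreover have "h z / h z0 \<notin> \<real>\<^sub>\<le>\<^sub>0"
      using e2(2)[of z] that by (force simp: e3_def complex_nonpos_Reals_iff)
    ultimately show ?thesis
      unfolding l_def using hz[OF that] h0 by (auto intro!: derivative_eq_intros)
  qed
  have der: "(\<zeta> has_field_derivative exp (l z / of_real \<kappa>) * g z / (of_real \<kappa> * h z)) (at z)" if "z \<in> ball z0 e3" for z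
  proof -
    have "(\<zeta> has_field_derivative exp (l z / of_real \<kappa>) + (z - z0) * (exp (l z / of_real \<kappa>) * (deriv h z / h z / of_real \<kappa>))) (at z)"
      unfolding \<zeta>_def using der_l[OF that] \<kappa> by (auto intro!: derivative_eq_intros)
    moreover have gz: "g z = of_real \<kappa> * h z + (z - z0) * deriv h z" using e1(3)[of z] that by (auto simp: e3_def)
    have "exp (l z / of_real \<kappa>) + (z - z0) * (exp (l z / of_real \<kappa>) * (deriv h z / h z / of_real \<kappa>)) =
        exp (l z / of_real \<kappa>) * g z / (of_real \<kappa> * h z)"
      unfolding gz using hz[OF that] \<kappa> by (simp add: field_simps)
    ultimately show ?thesis by simp
  qed
  have hol: "\<zeta> holomorphic_on ball z0 e3"
    unfolding holomorphic_on_open[OF open_ball] using der by blast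
  have "deriv \<zeta> z0 \<noteq> 0"
    using DERIV_imp_deriv[OF der[of z0]] e3 \<kappa> hz[of z0] by (simp add: g_def)
  then obtain e where e: "e > 0" "ball z0 e \<subseteq> ball z0 e3" "inj_on \<zeta> (ball z0 e)"
    using has_complex_derivative_locally_injective[OF hol _ open_ball] e3 by (metis centre_in_ball)
  show ?thesis
  proof (rule that[of e \<zeta> m])
    show hol': "\<zeta> holomorphic_on ball z0 e" using hol e(2) by (rule holomorphic_on_subset)
    show "\<zeta> z0 = 0" by (simp add: \<zeta>_def)
    fix z assume z: "z \<in> ball z0 e"
    show "deriv \<zeta> z \<noteq> 0" by (rule holomorphic_injective_imp_regular[OF hol' open_ball e(3) z])
    have z3: "z \<in> ball z0 e3" using z e(2) by auto
    have d1: "of_real \<kappa> * deriv \<zeta> z * h z = exp (l z / of_real \<kappa>) * g z"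
      using DERIV_imp_deriv[OF der[OF z3]] hz[OF z3] \<kappa> by simp
    \<comment> \<open>Since \<open>3 + m = 3 * \<kappa>\<close>, this integral power removes the
      fractional exponent; multiplying the claim by \<open>h z ^ 3\<close> then leaves integral
      powers only.\<close>
    have "exp (l z / of_real \<kappa>) ^ (3 + m) = exp (of_nat (3 + m) * (l z / of_real \<kappa>))"
      by (simp only: exp_of_nat_mult)
    also have "of_nat (3 + m) * (l z / of_real \<kappa>) = of_nat 3 * l z"
    proof -
      have "of_nat (3 + m) = of_real \<kappa> * (of_nat 3 :: complex)" by (simp add: \<kappa>_def)
      then show ?thesis using \<kappa> by simp
    qed
    also have "exp (of_nat 3 * l z) = h z ^ 3" by (simp only: exp_of_nat_mult exp_l[OF z3])
    finally have d2: "exp (l z / of_real \<kappa>) ^ (3 + m) = h z ^ 3" .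
    have "(of_real \<kappa> ^ 3 * deriv \<zeta> z ^ 3 * \<zeta> z ^ m) * h z ^ 3 = (of_real \<kappa> * deriv \<zeta> z * h z) ^ 3 * \<zeta> z ^ m"
      by (simp add: power_mult_distrib)
    also have "\<dots> = exp (l z / of_real \<kappa>) ^ (3 + m) * (z - z0) ^ m * g z ^ 3"
      unfolding d1 \<zeta>_def by (simp add: power_mult_distrib power_add)
    also have "\<dots> = poly P z * h z ^ 3"
      using g3[of z] z3 unfolding d2 by (simp add: q(1) e3_def poly_power algebra_simps)
    finally show "of_real ((real m + 3) / 3) ^ 3 * deriv \<zeta> z ^ 3 * \<zeta> z ^ m = poly P z"
      using hz[OF z3] by (simp add: \<kappa>_def)
  qed (use e in auto)
qed

definition cubic_density :: "complex poly \<Rightarrow> complex \<Rightarrow> real" where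
  "cubic_density P z = root 3 (cmod (poly P z))"

lemma conformal_density_cubic: "conformal_density (cubic_density P)"
  by unfold_locales (auto simp: cubic_density_def intro!: continuous_intros)

lemma cubic_density_eqI:
  assumes "poly P z = w ^ 3"
  shows "cubic_density P z = cmod w"
  using assms by (simp add: cubic_density_def norm_power real_root_power_cancel)

text \<open>The relation to \<open>P\<close> itself is kept besides the density, because a modulus
  would not suffice to identify branches of the chart with flat charts along a trajectory.\<close>

lemma cone_chart_exists:
  assumes "P \<noteq> 0"
  obtains e \<kappa> \<zeta> where "conformal_density.cone_chart (cubic_density P) z0 e \<kappa> \<zeta>"
    "\<exists>m. \<kappa> = (real m + 3) / 3 \<and> (\<forall>z\<in>ball z0 e. of_real \<kappa> ^ 3 * deriv \<zeta> z ^ 3 * \<zeta> z ^ m = poly P z)"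
proof -
  obtain e \<zeta> m where e: "e > 0" "\<zeta> holomorphic_on ball z0 e" "inj_on \<zeta> (ball z0 e)" "\<zeta> z0 = 0"
    "\<And>z. z \<in> ball z0 e \<Longrightarrow> deriv \<zeta> z \<noteq> 0"
    "\<And>z. z \<in> ball z0 e \<Longrightarrow> of_real ((real m + 3) / 3) ^ 3 * deriv \<zeta> z ^ 3 * \<zeta> z ^ m = poly P z"
    using cubic_normal_form[OF assms, of z0] by metis
  define \<kappa> where "\<kappa> = (real m + 3) / 3"
  have \<kappa>: "\<kappa> > 0" by (simp add: \<kappa>_def)
  have "conformal_density.cone_chart (cubic_density P) z0 e \<kappa> \<zeta>"
    unfolding conformal_density.cone_chart_def[OF conformal_density_cubic]
  proof (intro conjI ballI)
    \<comment> \<open>The centre is left out because \<open>0 powr 0 = 0\<close>: at a regular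
      centre, where \<open>\<kappa> = 1\<close>, the formula would give density 0.\<close>
    fix z assume z: "z \<in> ball z0 e - {z0}"
    then have "\<zeta> z \<noteq> 0" using e(1,3,4) unfolding inj_on_def by (metis DiffD1 DiffD2 centre_in_ball singletonI)
    then have "(cmod (\<zeta> z) powr (\<kappa> - 1)) ^ 3 = cmod (\<zeta> z) powr real m"
      by (simp add: powr_power \<kappa>_def add_divide_distrib)
    also have "\<dots> = cmod (\<zeta> z) ^ m" using \<open>\<zeta> z \<noteq> 0\<close> by (simp add: powr_realpow)
    finally have "(cmod (\<zeta> z) powr (\<kappa> - 1)) ^ 3 = cmod (\<zeta> z) ^ m" .
    moreover have "cmod (poly P z) = \<kappa> ^ 3 * cmod (deriv \<zeta> z) ^ 3 * cmod (\<zeta> z) ^ m"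
    proof -
      have "poly P z = of_real \<kappa> ^ 3 * deriv \<zeta> z ^ 3 * \<zeta> z ^ m" using e(6)[of z] z by (simp only: \<kappa>_def DiffD1)
      then show ?thesis using \<kappa> by (simp add: norm_mult norm_power)
    qed
    ultimately have "cmod (poly P z) = (\<kappa> * cmod (\<zeta> z) powr (\<kappa> - 1) * cmod (deriv \<zeta> z)) ^ 3"
      by (simp add: power_mult_distrib)
    then show "cubic_density P z = \<kappa> * cmod (\<zeta> z) powr (\<kappa> - 1) * cmod (deriv \<zeta> z)"
      unfolding cubic_density_def by (simp add: real_root_power_cancel \<kappa>_def)
  qed (use e in \<open>auto simp: \<kappa>_def\<close>)
  then show ?thesis using that e(6) by (metis \<kappa>_def)
qed

lemma fine_chain_dist_le: "fine_chain d h x y l C \<Longrightarrow> dist x y \<le> C"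
proof (induction rule: fine_chain.induct)
  case (fine_chain_step x y l C z)
  then show ?case using dist_triangle[of x z y] by linarith
qed auto

section \<open>Convexity of the distance between local geodesics\<close>

text \<open>All that the convexity argument knows of the metric. Almost shortest chains replace
  geodesics, properness keeps smoothed rows in a ball of radius \<open>R\<close>, and comparison is
  local with a scale \<open>r\<close> that depends on \<open>R\<close> only.\<close>

locale npc_metric =
  fixes d :: "complex \<Rightarrow> complex \<Rightarrow> real"
  assumes d_nonneg: "0 \<le> d x y" and d_self: "d x x = 0" and d_sym: "d x y = d y x"
    and d_triangle: "d x z \<le> d x y + d y z"
    and d_lipschitz: "\<exists>M>0. \<forall>x\<in>cball 0 R. \<forall>y\<in>cball 0 R. d x y \<le> M * dist x y"
    and d_proper: "\<exists>R. \<forall>y. d x y \<le> C \<longrightarrow> cmod y \<le> R"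
    and d_separates: "e > 0 \<Longrightarrow> \<exists>h>0. \<forall>y. d x y < h \<longrightarrow> dist x y < e"
    and d_length: "e > 0 \<Longrightarrow> chain_reach d x y (d x y + e)"
    and local_midpoints: "\<exists>r>0. \<forall>x y. x \<in> cball 0 R \<longrightarrow> d x y < r \<longrightarrow>
      (\<exists>m. \<forall>q. d q x < r \<longrightarrow> (d q m)\<^sup>2 \<le> (d q x)\<^sup>2 / 2 + (d q y)\<^sup>2 / 2 - (d x y)\<^sup>2 / 4)"
begin

lemma d_eq_0D: "d x y = 0 \<Longrightarrow> x = y"
  using d_separates[of "dist x y" x] by (metis less_irrefl zero_less_dist_iff)

text \<open>Specified by the two half distances instead of the comparison inequality, so that it is
  symmetric and independent of \<open>R\<close> and \<open>r\<close>.\<close>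

definition mid :: "complex \<Rightarrow> complex \<Rightarrow> complex" where
  "mid x y = (SOME m. d x m \<le> d x y / 2 \<and> d y m \<le> d x y / 2)"

lemma mid_commute: "mid x y = mid y x"
  unfolding mid_def d_sym[of x y] by (rule arg_cong[where f = Eps]) auto

definition midpoint_radius :: "real \<Rightarrow> real \<Rightarrow> bool" where
  "midpoint_radius R r \<longleftrightarrow> (\<forall>x y. x \<in> cball 0 R \<longrightarrow> d x y < r \<longrightarrow>
      (\<exists>m. \<forall>q. d q x < r \<longrightarrow> (d q m)\<^sup>2 \<le> (d q x)\<^sup>2 / 2 + (d q y)\<^sup>2 / 2 - (d x y)\<^sup>2 / 4))"

text \<open>For \<open>q = x\<close> and \<open>q = y\<close> the inequality puts \<open>m\<close>
  at half the distance. For \<open>q\<close> another midpoint its right side is at most 0, so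
  midpoints are unique and \<open>SOME\<close> can only choose \<open>m\<close>.\<close>

lemma mid_ineq:
  assumes "midpoint_radius R r" "x \<in> cball 0 R" "d x y < r"
  shows "d q x < r \<Longrightarrow> (d q (mid x y))\<^sup>2 \<le> (d q x)\<^sup>2 / 2 + (d q y)\<^sup>2 / 2 - (d x y)\<^sup>2 / 4"
    and "d x (mid x y) \<le> d x y / 2" "d y (mid x y) \<le> d x y / 2"
    and "d x m' \<le> d x y / 2 \<Longrightarrow> d y m' \<le> d x y / 2 \<Longrightarrow> m' = mid x y"
proof -
  obtain m where m: "\<And>q. d q x < r \<Longrightarrow> (d q m)\<^sup>2 \<le> (d q x)\<^sup>2 / 2 + (d q y)\<^sup>2 / 2 - (d x y)\<^sup>2 / 4"
    using assms unfolding midpoint_radius_def by blast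
  have r: "r > 0" using assms(3) d_nonneg[of x y] by linarith
  have half: "a \<le> d x y / 2" if "a\<^sup>2 \<le> (d x y)\<^sup>2 / 4" for a
    by (rule power2_le_imp_le) (use that d_nonneg[of x y] in \<open>auto simp: power_divide\<close>)
  have m1: "d x m \<le> d x y / 2" by (rule half) (use m[of x] r in \<open>simp add: d_self\<close>)
  have m2: "d y m \<le> d x y / 2"
    by (rule half) (use m[of y] assms(3) in \<open>simp add: d_self d_sym[of y x]\<close>)
  have uniq: "m' = m" if "d x m' \<le> d x y / 2" "d y m' \<le> d x y / 2" for m'
  proof -
    have "d m' x < r" using that(1) assms(3) d_nonneg[of x y] d_sym[of m' x] by linarith
    from m[OF this] have "(d m' m)\<^sup>2 \<le> (d x m')\<^sup>2 / 2 + (d y m')\<^sup>2 / 2 - (d x y)\<^sup>2 / 4"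
      by (simp add: d_sym[of m' x] d_sym[of m' y])
    moreover have "(d x m')\<^sup>2 \<le> (d x y)\<^sup>2 / 4" "(d y m')\<^sup>2 \<le> (d x y)\<^sup>2 / 4"
      using power_mono[OF that(1) d_nonneg, of 2] power_mono[OF that(2) d_nonneg, of 2] by (auto simp: power_divide)
    ultimately have "(d m' m)\<^sup>2 \<le> 0" by linarith
    then show ?thesis using d_eq_0D by simp
  qed
  have "d x (mid x y) \<le> d x y / 2 \<and> d y (mid x y) \<le> d x y / 2"
    unfolding mid_def by (rule someI[of _ m]) (use m1 m2 in auto)
  then have "mid x y = m" using uniq by blast
  note [simp] = this
  show "d q x < r \<Longrightarrow> (d q (mid x y))\<^sup>2 \<le> (d q x)\<^sup>2 / 2 + (d q y)\<^sup>2 / 2 - (d x y)\<^sup>2 / 4"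
    using m by simp
  show "d x (mid x y) \<le> d x y / 2" "d y (mid x y) \<le> d x y / 2"
    using m1 m2 by simp_all
  show "d x m' \<le> d x y / 2 \<Longrightarrow> d y m' \<le> d x y / 2 \<Longrightarrow> m' = mid x y"
    using uniq by simp
qed

text \<open>The midline of a triangle is at most half the base. The inequality is used twice: at
  \<open>mid x y\<close> for the pair \<open>x, y'\<close>, and at \<open>y'\<close> for the pair
  \<open>x, y\<close>; the sides from \<open>x\<close> then cancel.\<close>

lemma mid_contract_one:
  assumes "midpoint_radius R r" "x \<in> cball 0 R" "d x y < r" "d x y' < r"
  shows "d (mid x y) (mid x y') \<le> d y y' / 2"
proof -
  note m = mid_ineq[OF assms(1,2,3)] and m' = mid_ineq[OF assms(1,2,4)]
  have "d (mid x y) x < r" using m(2) assms(3) d_nonneg[of x y] d_sym[of "mid x y" x] by linarith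
  then have 1: "(d (mid x y) (mid x y'))\<^sup>2 \<le> (d x (mid x y))\<^sup>2 / 2 + (d y' (mid x y))\<^sup>2 / 2 - (d x y')\<^sup>2 / 4"
    using m'(1)[where q = "mid x y"] by (simp add: d_sym[of "mid x y" x] d_sym[of "mid x y" y'])
  have 2: "(d y' (mid x y))\<^sup>2 \<le> (d x y')\<^sup>2 / 2 + (d y y')\<^sup>2 / 2 - (d x y)\<^sup>2 / 4"
    using m(1)[where q = y'] assms(4) by (simp add: d_sym[of y' x] d_sym[of y' y])
  have 3: "(d x (mid x y))\<^sup>2 \<le> (d x y)\<^sup>2 / 4"
    using power_mono[OF m(2) d_nonneg, of 2] by (simp add: power_divide)
  have "(d (mid x y) (mid x y'))\<^sup>2 \<le> (d y y' / 2)\<^sup>2"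
    using 1 2 3 by (simp add: power_divide)
  then show ?thesis by (rule power2_le_imp_le) (simp add: d_nonneg)
qed

text \<open>The quadrilateral is cut along the diagonal from \<open>x\<close> to \<open>y'\<close>;
  this explains the condition on that diagonal.\<close>

lemma mid_contract:
  assumes "midpoint_radius R r" "x \<in> cball 0 R" "y' \<in> cball 0 R" "d x y < r" "d x y' < r" "d x' y' < r"
  shows "d (mid x y) (mid x' y') \<le> (d x x' + d y y') / 2"
proof -
  have "d (mid x y) (mid x y') \<le> d y y' / 2"
    by (rule mid_contract_one[OF assms(1,2,4,5)])
  moreover have "d (mid y' x) (mid y' x') \<le> d x x' / 2"
    using assms by (intro mid_contract_one[OF assms(1,3)]) (auto simp: d_sym[of y'])
  moreover have "d (mid x y) (mid x' y') \<le> d (mid x y) (mid x y') + d (mid x y') (mid x' y')" by (rule d_triangle)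
  ultimately show ?thesis by (simp add: mid_commute[of y'] field_simps)
qed

section \<open>Rows of points and their smoothing\<close>

definition smooth_row :: "nat \<Rightarrow> (nat \<Rightarrow> complex) \<Rightarrow> nat \<Rightarrow> complex" where
  "smooth_row N X i = (if 0 < i \<and> i < N then mid (X (i - 1)) (X (i + 1)) else X i)"

definition affine_bound :: "nat \<Rightarrow> real \<Rightarrow> real \<Rightarrow> nat \<Rightarrow> real" where
  "affine_bound N a b i = (1 - real i / real N) * a + real i / real N * b"

text \<open>
  Rows are discrete curves, compared with a fixed row \<open>\<alpha>\<close> under repeated replacement of every
  interior point by the midpoint of its neighbours. The distances between two rows evolve as a
  subsolution of the discrete heat equation, whose limit is affine.
\<close>

definition heat_rate :: "nat \<Rightarrow> real" where "heat_rate N = 1 - 1 / (real N)\<^sup>2"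

text \<open>A condition on all iterates: within \<open>V\<close> of \<open>\<alpha>\<close> the
  scale \<open>r\<close> is valid, and edges up to \<open>\<epsilon>\<close> keep all relevant
  points closer than \<open>r\<close>. \<open>V\<close> is the displacement accumulated along the
  homotopy.\<close>

definition tame :: "(nat \<Rightarrow> complex) \<Rightarrow> nat \<Rightarrow> real \<Rightarrow> real \<Rightarrow> (nat \<Rightarrow> complex) \<Rightarrow> bool" where
  "tame \<alpha> N \<epsilon> V X \<longleftrightarrow> (\<forall>n. (\<forall>i\<le>N. d (\<alpha> i) ((smooth_row N ^^ n) X i) \<le> V) \<and>
     (\<forall>i<N. d ((smooth_row N ^^ n) X i) ((smooth_row N ^^ n) X (Suc i)) \<le> \<epsilon>))"

text \<open>\<open>a\<close> and \<open>b\<close> record how far the ends have moved,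
  \<open>K\<close> the transient of the heat flow. \<open>K\<close> may grow from row to row, since
  \<open>n\<close> goes to infinity before anything else changes.\<close>

definition reachable_row :: "(nat \<Rightarrow> complex) \<Rightarrow> nat \<Rightarrow> real \<Rightarrow> real \<Rightarrow> real \<Rightarrow> real \<Rightarrow> (nat \<Rightarrow> complex) \<Rightarrow> bool" where
  "reachable_row \<alpha> N \<epsilon> V a b Y \<longleftrightarrow> tame \<alpha> N \<epsilon> V Y \<and>
    (\<exists>K. \<forall>n. \<forall>i\<le>N. d (\<alpha> i) ((smooth_row N ^^ n) Y i) \<le> affine_bound N a b i + K * heat_rate N ^ n)"

context
  fixes \<alpha> :: "nat \<Rightarrow> complex" and N :: nat and R r \<epsilon> Vmax :: real
  assumes rad: "midpoint_radius R r" and \<epsilon>: "\<epsilon> > 0" "4 * \<epsilon> \<le> r" and N: "N > 0"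
    and region: "\<And>i z. i \<le> N \<Longrightarrow> d (\<alpha> i) z \<le> Vmax \<Longrightarrow> z \<in> cball 0 R"
begin

lemma heat_rate: "0 \<le> heat_rate N" "heat_rate N < 1"
proof -
  have "1 \<le> (real N)\<^sup>2" using N by (simp add: one_le_power)
  then show "0 \<le> heat_rate N" "heat_rate N < 1" using N by (simp_all add: heat_rate_def)
qed

lemma ratio_le_1: "i \<le> N \<Longrightarrow> real i / real N \<le> 1"
  using N by (simp add: divide_le_eq_1)

lemma affine_bound_mean: "(affine_bound N a b i + affine_bound N a b (Suc (Suc i))) / 2 = affine_bound N a b (Suc i)"
proof -
  define x h where "x = real i / real N" "h = 1 / real N"
  have "real (Suc i) / real N = x + h" "real (Suc (Suc i)) / real N = x + 2 * h"
    by (simp_all add: x_h_def add_divide_distrib)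
  then have "affine_bound N a b (Suc i) = (1 - (x + h)) * a + (x + h) * b"
    "affine_bound N a b (Suc (Suc i)) = (1 - (x + 2 * h)) * a + (x + 2 * h) * b"
    "affine_bound N a b i = (1 - x) * a + x * b"
    by (simp_all only: affine_bound_def x_h_def(1))
  then show ?thesis by (simp add: algebra_simps)
qed

lemma two_steps_le:
  assumes "\<And>i. i < N \<Longrightarrow> d (X i) (X (Suc i)) \<le> \<epsilon>" "Suc i < N"
  shows "d (X i) (X (Suc (Suc i))) \<le> 2 * \<epsilon>"
  using assms(1)[of i] assms(1)[of "Suc i"] assms(2) d_triangle[of "X i" "X (Suc (Suc i))" "X (Suc i)"] by linarith

text \<open>A smoothed inner edge joins midpoints of corresponding sides of a quadrilateral, a
  smoothed end edge is half of a double step. Diagonals measure at most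
  \<open>3 * \<epsilon>\<close>, which is the origin of
  \<open>4 * \<epsilon> \<le> r\<close>.\<close>

lemma smooth_row_edges:
  assumes edges: "\<And>i. i < N \<Longrightarrow> d (Y i) (Y (Suc i)) \<le> \<epsilon>" and reg: "\<And>i. i \<le> N \<Longrightarrow> Y i \<in> cball 0 R"
    and i: "i < N"
  shows "d (smooth_row N Y i) (smooth_row N Y (Suc i)) \<le> \<epsilon>"
proof -
  have two: "d (Y j) (Y (Suc (Suc j))) \<le> 2 * \<epsilon>" if "Suc j < N" for j
    by (rule two_steps_le[where X = Y, OF edges that])
  consider "i = 0" "Suc i = N" | "i = 0" "Suc i < N" | j where "i = Suc j" "Suc i = N" | j where "i = Suc j" "Suc i < N"
  proof (cases i)
    case 0
    then show ?thesis using i that(1,2) by (cases "Suc i = N") auto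
  next
    case (Suc j)
    then show ?thesis using i that(3,4)[of j] by (cases "Suc i = N") auto
  qed
  then show ?thesis
  proof cases
    case 1
    then show ?thesis using edges[of 0] i by (simp add: smooth_row_def)
  next
    case 2
    have "d (Y 0) (mid (Y 0) (Y 2)) \<le> d (Y 0) (Y 2) / 2"
      by (rule mid_ineq(2)[OF rad reg]) (use two[of 0] \<epsilon> 2 in \<open>auto simp: numeral_2_eq_2\<close>)
    then show ?thesis using two[of 0] 2 by (simp add: smooth_row_def numeral_2_eq_2)
  next
    case 3
    have "d (Y (Suc i)) (mid (Y j) (Y (Suc i))) \<le> d (Y j) (Y (Suc i)) / 2"
      by (rule mid_ineq(3)[OF rad reg]) (use two[of j] \<epsilon> 3 in auto)
    then show ?thesis using two[of j] 3 by (simp add: smooth_row_def d_sym[of "mid _ _"])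
  next
    case 4
    have 13: "d (Y j) (Y (Suc (Suc (Suc j)))) \<le> 3 * \<epsilon>"
      using two[of j] edges[of "Suc (Suc j)"] 4 d_triangle[of "Y j" "Y (Suc (Suc (Suc j)))" "Y (Suc (Suc j))"] by simp
    have "d (mid (Y j) (Y (Suc (Suc j)))) (mid (Y (Suc j)) (Y (Suc (Suc (Suc j)))))
        \<le> (d (Y j) (Y (Suc j)) + d (Y (Suc (Suc j))) (Y (Suc (Suc (Suc j))))) / 2"
      by (rule mid_contract[OF rad reg reg]) (use 4 13 two[of j] two[of "Suc j"] \<epsilon> in auto)
    also have "\<dots> \<le> \<epsilon>" using edges[of j] edges[of "Suc (Suc j)"] 4 by simp
    finally show ?thesis using 4 by (simp add: smooth_row_def)
  qed
qed

lemma smooth_row_contract: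
  assumes eX: "\<And>i. i < N \<Longrightarrow> d (X i) (X (Suc i)) \<le> \<epsilon>" and eY: "\<And>i. i < N \<Longrightarrow> d (Y i) (Y (Suc i)) \<le> \<epsilon>"
    and rX: "\<And>i. i \<le> N \<Longrightarrow> X i \<in> cball 0 R" and rY: "\<And>i. i \<le> N \<Longrightarrow> Y i \<in> cball 0 R"
    and XY: "\<And>i. i \<le> N \<Longrightarrow> d (X i) (Y i) \<le> \<epsilon>" and i: "Suc i < N"
  shows "d (smooth_row N X (Suc i)) (smooth_row N Y (Suc i)) \<le> (d (X i) (Y i) + d (X (Suc (Suc i))) (Y (Suc (Suc i)))) / 2"
proof -
  have two: "d (X i) (X (Suc (Suc i))) \<le> 2 * \<epsilon>" "d (Y i) (Y (Suc (Suc i))) \<le> 2 * \<epsilon>"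
    by (rule two_steps_le[where X = X, OF eX i], assumption, rule two_steps_le[where X = Y, OF eY i], assumption)
  have "d (X i) (Y (Suc (Suc i))) \<le> 3 * \<epsilon>"
    using two(1) XY[of "Suc (Suc i)"] i d_triangle[of "X i" "Y (Suc (Suc i))" "X (Suc (Suc i))"] by simp
  then have "d (mid (X i) (X (Suc (Suc i)))) (mid (Y i) (Y (Suc (Suc i))))
      \<le> (d (X i) (Y i) + d (X (Suc (Suc i))) (Y (Suc (Suc i)))) / 2"
    by (intro mid_contract[OF rad rX rY]) (use two \<epsilon> i in auto)
  then show ?thesis using i by (simp add: smooth_row_def)
qed

text \<open>A maximum principle with the barrier \<open>B\<close>, an affine function plus a
  decaying term. The uniform bound \<open>\<eta>\<close> and the edges of \<open>Y\<close> belong to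
  the same induction, because they keep the rows where the next contraction estimate is
  valid.\<close>

lemma tame_neighbour:
  assumes X: "tame \<alpha> N \<epsilon> V X" and V: "V + \<eta> \<le> Vmax" and \<eta>: "0 \<le> \<eta>" "\<eta> \<le> \<epsilon>"
    and XY: "\<And>i. i \<le> N \<Longrightarrow> d (X i) (Y i) \<le> \<eta>" and Y: "\<And>i. i < N \<Longrightarrow> d (Y i) (Y (Suc i)) \<le> \<epsilon>"
  shows "tame \<alpha> N \<epsilon> (V + \<eta>) Y" and
    "i \<le> N \<Longrightarrow> d ((smooth_row N ^^ n) X i) ((smooth_row N ^^ n) Y i)
      \<le> affine_bound N (d (X 0) (Y 0)) (d (X N) (Y N)) i + \<eta> * (real N)\<^sup>2 * heat_rate N ^ n"
proof -
  \<comment> \<open>The discrete torsion function: averaging neighbours lowers it by 1, which is at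
    least the fraction \<open>1 / (real N)\<^sup>2\<close> of its value. Hence the rate
    \<open>heat_rate N\<close>.\<close>
  define g :: "nat \<Rightarrow> real" where "g i = real i * (real N - real i)" for i
  define L where "L = affine_bound N (d (X 0) (Y 0)) (d (X N) (Y N))"
  define B where "B n i = L i + \<eta> * g i * heat_rate N ^ n" for n i
  let ?X = "\<lambda>n. (smooth_row N ^^ n) X" and ?Y = "\<lambda>n. (smooth_row N ^^ n) Y"
  have Xd: "d (\<alpha> i) (?X n i) \<le> V" if "i \<le> N" for n i using X that by (simp add: tame_def)
  have Xe: "d (?X n i) (?X n (Suc i)) \<le> \<epsilon>" if "i < N" for n i using X that by (simp add: tame_def)
  have "g i + g (Suc (Suc i)) = 2 * (g (Suc i) - 1)" for i by (simp add: g_def algebra_simps)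
  then have g_mean: "(g i + g (Suc (Suc i))) / 2 = g (Suc i) - 1" for i by simp
  have g_le: "0 \<le> g i" "g i \<le> (real N)\<^sup>2" if "i \<le> N" for i
    using that mult_mono[of "real i" "real N" "real N - real i" "real N"] by (auto simp: g_def power2_eq_square)
  have g_contract: "g i - 1 \<le> heat_rate N * g i" if "i \<le> N" for i
  proof -
    have "g i / (real N)\<^sup>2 \<le> 1" using g_le[OF that] N by (simp add: divide_le_eq_1)
    then show ?thesis by (simp add: heat_rate_def left_diff_distrib)
  qed
  have L0: "0 \<le> L i" if "i \<le> N" for i
    unfolding L_def affine_bound_def using ratio_le_1[OF that]
    by (intro add_nonneg_nonneg mult_nonneg_nonneg d_nonneg) auto
  have region_Y: "Z \<in> cball 0 R" if "i \<le> N" "d (?X n i) Z \<le> \<eta>" for i n Z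
    using that Xd[of i n] V d_triangle[of "\<alpha> i" Z "?X n i"] by (intro region[OF that(1)]) linarith
  have main: "(\<forall>i\<le>N. d (?X n i) (?Y n i) \<le> \<eta> \<and> d (?X n i) (?Y n i) \<le> B n i) \<and>
      (\<forall>i<N. d (?Y n i) (?Y n (Suc i)) \<le> \<epsilon>)" for n
  proof (induction n)
    case 0
    have "d (X i) (Y i) \<le> B 0 i" if "i \<le> N" for i
    proof -
      consider "i = 0" | "i = N" | "0 < i" "i < N" using \<open>i \<le> N\<close> by (metis le_less not_gr_zero)
      then show ?thesis
      proof cases
        \<comment> \<open>At interior indices \<open>g\<close> is at least 1, so
          \<open>\<eta> * g i\<close> alone dominates the initial distance; at the ends the affine
          part is exact.\<close>
        case 3
        then have "1 * 1 \<le> real i * (real N - real i)" by (intro mult_mono) auto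
        then have "\<eta> * 1 \<le> \<eta> * g i" using \<eta> by (intro mult_left_mono) (auto simp: g_def)
        then show ?thesis using XY[OF that] L0[OF that] by (simp add: B_def)
      qed (use N in \<open>auto simp: B_def g_def L_def affine_bound_def\<close>)
    qed
    then show ?case using XY Y by simp
  next
    case (Suc n)
    have XYn: "d (?X n i) (?Y n i) \<le> \<eta>" "d (?X n i) (?Y n i) \<le> B n i" if "i \<le> N" for i using Suc that by auto
    have Yn: "d (?Y n i) (?Y n (Suc i)) \<le> \<epsilon>" if "i < N" for i using Suc that by auto
    have rX: "?X n i \<in> cball 0 R" if "i \<le> N" for i using region_Y[OF that, of n "?X n i"] \<eta> by (simp add: d_self)
    have rY: "?Y n i \<in> cball 0 R" if "i \<le> N" for i using region_Y[OF that XYn(1)[OF that]] .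
    have bdry: "?X (Suc n) i = ?X n i" "?Y (Suc n) i = ?Y n i" if "i = 0 \<or> i = N" for i
      using that by (auto simp: smooth_row_def)
    have inner: "d (?X (Suc n) (Suc i)) (?Y (Suc n) (Suc i))
        \<le> (d (?X n i) (?Y n i) + d (?X n (Suc (Suc i))) (?Y n (Suc (Suc i)))) / 2" if "Suc i < N" for i
      using smooth_row_contract[of "?X n" "?Y n" i] Xe Yn rX rY XYn(1) \<eta>(2) that by force
    have "d (?X (Suc n) i) (?Y (Suc n) i) \<le> \<eta> \<and> d (?X (Suc n) i) (?Y (Suc n) i) \<le> B (Suc n) i" if i: "i \<le> N" for i
    proof -
      consider "i = 0" | "i = N" | j where "i = Suc j" "Suc j < N" using i by (cases i) (auto simp: le_less)
      then show ?thesis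
      proof cases
        case 1
        then show ?thesis using XYn[OF i] unfolding bdry[OF disjI1[OF 1]] by (simp add: B_def g_def)
      next
        case 2
        then show ?thesis using XYn[OF i] unfolding bdry[OF disjI2[OF 2]] by (simp add: B_def g_def)
      next
        case 3
        have 1: "d (?X (Suc n) i) (?Y (Suc n) i) \<le> \<eta>"
          using inner[OF 3(2)] XYn(1)[of j] XYn(1)[of "Suc (Suc j)"] 3 by simp
        have "d (?X (Suc n) i) (?Y (Suc n) i) \<le> (B n j + B n (Suc (Suc j))) / 2"
          using inner[OF 3(2)] XYn(2)[of j] XYn(2)[of "Suc (Suc j)"] 3 by simp
        also have "\<dots> = (L j + L (Suc (Suc j))) / 2 + \<eta> * heat_rate N ^ n * ((g j + g (Suc (Suc j))) / 2)"
          by (simp add: B_def field_simps)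
        also have "\<dots> = L i + \<eta> * heat_rate N ^ n * (g i - 1)"
          by (simp only: g_mean L_def affine_bound_mean 3(1))
        also have "\<dots> \<le> L i + \<eta> * heat_rate N ^ n * (heat_rate N * g i)"
          using \<eta>(1) heat_rate g_contract[OF i] by (intro add_left_mono mult_left_mono) auto
        also have "\<dots> = B (Suc n) i" by (simp add: B_def)
        finally show ?thesis using 1 by simp
      qed
    qed
    moreover have "d (?Y (Suc n) i) (?Y (Suc n) (Suc i)) \<le> \<epsilon>" if "i < N" for i
      using smooth_row_edges[of "?Y n" i] Yn rY that by simp
    ultimately show ?case by blast
  qed
  show "tame \<alpha> N \<epsilon> (V + \<eta>) Y" unfolding tame_def
  proof (intro allI conjI impI)
    fix n i assume "i \<le> N"
    then show "d (\<alpha> i) (?Y n i) \<le> V + \<eta>"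
      using main[of n] Xd[of i n] d_triangle[of "\<alpha> i" "?Y n i" "?X n i"] by force
  qed (use main in auto)
  assume i: "i \<le> N"
  have "\<eta> * g i * heat_rate N ^ n \<le> \<eta> * (real N)\<^sup>2 * heat_rate N ^ n"
    using g_le[OF i] \<eta>(1) heat_rate by (intro mult_right_mono mult_left_mono) auto
  then show "d (?X n i) (?Y n i) \<le> affine_bound N (d (X 0) (Y 0)) (d (X N) (Y N)) i + \<eta> * (real N)\<^sup>2 * heat_rate N ^ n"
    using main[of n] i by (force simp: B_def L_def)
qed

lemma affine_bound_mono: "a \<le> a' \<Longrightarrow> b \<le> b' \<Longrightarrow> i \<le> N \<Longrightarrow> affine_bound N a b i \<le> affine_bound N a' b' i"
  unfolding affine_bound_def by (intro add_mono mult_left_mono) (use ratio_le_1[of i] in auto)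

lemma reachable_row_neighbour:
  assumes X: "reachable_row \<alpha> N \<epsilon> V a b X" and V: "V + \<eta> \<le> Vmax" and \<eta>: "0 \<le> \<eta>" "\<eta> \<le> \<epsilon>"
    and XY: "\<And>i. i \<le> N \<Longrightarrow> d (X i) (Y i) \<le> \<eta>" and Y: "\<And>i. i < N \<Longrightarrow> d (Y i) (Y (Suc i)) \<le> \<epsilon>"
    and a': "a + d (X 0) (Y 0) \<le> a'" and b': "b + d (X N) (Y N) \<le> b'"
  shows "reachable_row \<alpha> N \<epsilon> (V + \<eta>) a' b' Y"
proof -
  from X obtain K where "tame \<alpha> N \<epsilon> V X" and
    K: "\<And>n i. i \<le> N \<Longrightarrow> d (\<alpha> i) ((smooth_row N ^^ n) X i) \<le> affine_bound N a b i + K * heat_rate N ^ n"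
    unfolding reachable_row_def by blast
  note t = tame_neighbour[OF \<open>tame \<alpha> N \<epsilon> V X\<close> V \<eta> XY Y]
  have "d (\<alpha> i) ((smooth_row N ^^ n) Y i) \<le> affine_bound N a' b' i + (K + \<eta> * (real N)\<^sup>2) * heat_rate N ^ n" if "i \<le> N" for n i
  proof -
    have "affine_bound N a b i + affine_bound N (d (X 0) (Y 0)) (d (X N) (Y N)) i
        = affine_bound N (a + d (X 0) (Y 0)) (b + d (X N) (Y N)) i"
      by (simp add: affine_bound_def algebra_simps)
    also have "\<dots> \<le> affine_bound N a' b' i" by (rule affine_bound_mono[OF a' b' that])
    finally show ?thesis
      using K[OF that, of n] t(2)[OF _ _ that, of n] d_triangle[of "\<alpha> i" "(smooth_row N ^^ n) Y i" "(smooth_row N ^^ n) X i"]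
      by (simp add: distrib_right)
  qed
  then show ?thesis unfolding reachable_row_def using t(1) by blast
qed

lemma funpow_fixed: "smooth_row N X = X \<Longrightarrow> (smooth_row N ^^ n) X = X"
  by (induction n) auto

lemma reachable_row_refl:
  assumes "smooth_row N \<alpha> = \<alpha>" "\<And>i. i < N \<Longrightarrow> d (\<alpha> i) (\<alpha> (Suc i)) \<le> \<epsilon>"
  shows "reachable_row \<alpha> N \<epsilon> 0 0 0 \<alpha>"
  unfolding reachable_row_def tame_def
  using assms by (auto simp: funpow_fixed d_self affine_bound_def intro!: exI[of _ 0])

text \<open>The row does not change under smoothing, so the bound holds for every \<open>n\<close>,
  and the transient disappears in the limit whatever \<open>K\<close> has become.\<close>

lemma reachable_stationary_row:
  assumes "reachable_row \<alpha> N \<epsilon> V a b Y" "smooth_row N Y = Y" "i \<le> N"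
  shows "d (\<alpha> i) (Y i) \<le> affine_bound N a b i"
proof -
  from assms obtain K where K: "\<And>n. d (\<alpha> i) (Y i) \<le> affine_bound N a b i + K * heat_rate N ^ n"
    unfolding reachable_row_def by (auto simp: funpow_fixed)
  have "(\<lambda>n. affine_bound N a b i + K * heat_rate N ^ n) \<longlonglongrightarrow> affine_bound N a b i + K * 0"
    using heat_rate by (intro tendsto_intros LIMSEQ_power_zero) auto
  then show ?thesis using K by (intro LIMSEQ_le_const[of _ "affine_bound N a b i"]) auto
qed

end

section \<open>Local geodesics as stationary rows, and passage to the limit\<close>

definition local_geodesic :: "(real \<Rightarrow> complex) \<Rightarrow> bool" where
  "local_geodesic \<alpha> \<longleftrightarrow> (\<exists>A\<ge>0. \<exists>\<delta>>0. \<forall>s\<in>{0..1}. \<forall>t\<in>{0..1}. \<bar>s - t\<bar> < \<delta> \<longrightarrow> d (\<alpha> s) (\<alpha> t) = A * \<bar>s - t\<bar>)"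

lemma local_geodesicE:
  assumes "local_geodesic \<alpha>"
  obtains A \<delta> where "A \<ge> 0" "\<delta> > 0"
    "\<And>s t. s \<in> {0..1} \<Longrightarrow> t \<in> {0..1} \<Longrightarrow> \<bar>s - t\<bar> < \<delta> \<Longrightarrow> d (\<alpha> s) (\<alpha> t) = A * \<bar>s - t\<bar>"
  using assms unfolding local_geodesic_def by metis

lemma continuous_on_local_geodesic:
  assumes "local_geodesic \<alpha>"
  shows "continuous_on {0..1} \<alpha>"
  unfolding continuous_on_iff
proof (intro ballI allI impI)
  fix s e :: real assume s: "s \<in> {0..1}" and "e > 0"
  obtain A \<delta> where A: "A \<ge> 0" "\<delta> > 0"
    "\<And>s t. s \<in> {0..1} \<Longrightarrow> t \<in> {0..1} \<Longrightarrow> \<bar>s - t\<bar> < \<delta> \<Longrightarrow> d (\<alpha> s) (\<alpha> t) = A * \<bar>s - t\<bar>"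
    using local_geodesicE[OF assms] by metis
  obtain h where h: "h > 0" "\<And>y. d (\<alpha> s) y < h \<Longrightarrow> dist (\<alpha> s) y < e" using d_separates[OF \<open>e > 0\<close>] by metis
  show "\<exists>\<delta>>0. \<forall>t\<in>{0..1}. dist t s < \<delta> \<longrightarrow> dist (\<alpha> t) (\<alpha> s) < e"
  proof (intro exI[of _ "min \<delta> (h / (A + 1))"] conjI ballI impI)
    show "min \<delta> (h / (A + 1)) > 0" using A h by simp
    fix t assume t: "t \<in> {0..1}" "dist t s < min \<delta> (h / (A + 1))"
    then have "d (\<alpha> s) (\<alpha> t) = A * \<bar>s - t\<bar>" using A(3)[OF s t(1)] by (simp add: dist_real_def abs_minus_commute)
    also have "\<dots> \<le> (A + 1) * \<bar>s - t\<bar>" by (intro mult_right_mono) auto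
    also have "\<dots> < h" using t(2) A(1) by (simp add: dist_real_def abs_minus_commute field_simps)
    finally show "dist (\<alpha> t) (\<alpha> s) < e" using h(2) by (metis dist_commute)
  qed
qed

text \<open>Three consecutive samples lie within the range of constant speed, so the middle one is
  at half the distance from its neighbours; uniqueness of midpoints does the rest.\<close>

lemma smooth_row_local_geodesic:
  assumes rad: "midpoint_radius R r" and N: "N > 0" "2 / real N < \<delta>"
    and A: "\<And>s t. s \<in> {0..1} \<Longrightarrow> t \<in> {0..1} \<Longrightarrow> \<bar>s - t\<bar> < \<delta> \<Longrightarrow> d (\<alpha> s) (\<alpha> t) = A * \<bar>s - t\<bar>"
    and reg: "\<And>i. i \<le> N \<Longrightarrow> \<alpha> (real i / real N) \<in> cball 0 R"
    and edges: "\<And>i. i < N \<Longrightarrow> d (\<alpha> (real i / real N)) (\<alpha> (real (Suc i) / real N)) < r / 2"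
  shows "smooth_row N (\<lambda>i. \<alpha> (real i / real N)) = (\<lambda>i. \<alpha> (real i / real N))"
proof
  fix i
  let ?X = "\<lambda>i. \<alpha> (real i / real N)"
  show "smooth_row N ?X i = ?X i"
  proof (cases "0 < i \<and> i < N")
    case True
    then obtain j where j: "i = Suc j" "Suc j < N" by (cases i) auto
    define h where "h = 1 / real N"
    have h: "h > 0" "2 * h < \<delta>" using N by (auto simp: h_def)
    have pos: "real (Suc j) / real N = real j / real N + h" "real (Suc (Suc j)) / real N = real j / real N + 2 * h"
      by (simp_all add: h_def add_divide_distrib)
    have in01: "real k / real N \<in> {0..1}" if "k \<le> N" for k using that N by (simp add: divide_le_eq_1)
    have dd: "d (?X j) (?X (Suc j)) = A * h" "d (?X (Suc j)) (?X (Suc (Suc j))) = A * h"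
      "d (?X j) (?X (Suc (Suc j))) = A * (2 * h)"
      using A[OF in01 in01, of j "Suc j"] A[OF in01 in01, of "Suc j" "Suc (Suc j)"] A[OF in01 in01, of j "Suc (Suc j)"] j h
      unfolding pos by simp_all
    have "?X (Suc j) = mid (?X j) (?X (Suc (Suc j)))"
    proof (rule mid_ineq(4)[OF rad])
      show "?X j \<in> cball 0 R" using j by (intro reg) auto
      show "d (?X j) (?X (Suc (Suc j))) < r"
        using edges[of j] edges[of "Suc j"] j d_triangle[of "?X j" "?X (Suc (Suc j))" "?X (Suc j)"] by linarith
    qed (use dd d_sym[of "?X (Suc (Suc j))"] in auto)
    then show ?thesis using j by (simp add: smooth_row_def)
  qed (auto simp: smooth_row_def)
qed

text \<open>A linear homotopy joins the two geodesics; its sides follow almost shortest chains.\<close>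

lemma local_geodesic_convex_approx:
  assumes \<alpha>: "local_geodesic \<alpha>" and \<beta>: "local_geodesic \<beta>" and "e > 0"
  obtains N0 where "\<And>N i. N \<ge> N0 \<Longrightarrow> N > 0 \<Longrightarrow> i \<le> N \<Longrightarrow>
    d (\<alpha> (real i / real N)) (\<beta> (real i / real N)) \<le> affine_bound N (d (\<alpha> 0) (\<beta> 0) + e) (d (\<alpha> 1) (\<beta> 1) + e) i"
proof -
  obtain A \<delta>A where A: "A \<ge> 0" "\<delta>A > 0"
    "\<And>s t. s \<in> {0..1} \<Longrightarrow> t \<in> {0..1} \<Longrightarrow> \<bar>s - t\<bar> < \<delta>A \<Longrightarrow> d (\<alpha> s) (\<alpha> t) = A * \<bar>s - t\<bar>"
    using local_geodesicE[OF \<alpha>] by metis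
  obtain B \<delta>B where B: "B \<ge> 0" "\<delta>B > 0"
    "\<And>s t. s \<in> {0..1} \<Longrightarrow> t \<in> {0..1} \<Longrightarrow> \<bar>s - t\<bar> < \<delta>B \<Longrightarrow> d (\<beta> s) (\<beta> t) = B * \<bar>s - t\<bar>"
    using local_geodesicE[OF \<beta>] by metis
  have c\<alpha>: "continuous_on {0..1} \<alpha>" and c\<beta>: "continuous_on {0..1} \<beta>"
    using \<alpha> \<beta> continuous_on_local_geodesic by auto
  obtain C0 where C0: "\<And>h. h > 0 \<Longrightarrow> \<exists>l' C'. fine_chain d h (\<alpha> 0) (\<beta> 0) l' C' \<and> l' \<le> d (\<alpha> 0) (\<beta> 0) + e \<and> C' \<le> C0"
    using d_length[OF \<open>e > 0\<close>] unfolding chain_reach_def by metis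
  obtain C1 where C1: "\<And>h. h > 0 \<Longrightarrow> \<exists>l' C'. fine_chain d h (\<alpha> 1) (\<beta> 1) l' C' \<and> l' \<le> d (\<alpha> 1) (\<beta> 1) + e \<and> C' \<le> C1"
    using d_length[OF \<open>e > 0\<close>] unfolding chain_reach_def by metis
  have C_nonneg: "0 \<le> C0" "0 \<le> C1"
    using C0[OF zero_less_one] C1[OF zero_less_one] fine_chain_dist_le zero_le_dist by (meson order.trans)+
  have "bounded (\<alpha> ` {0..1} \<union> \<beta> ` {0..1})"
    using c\<alpha> c\<beta> by (simp add: compact_continuous_image compact_imp_bounded)
  then obtain S where S: "S > 0" "\<And>x. x \<in> \<alpha> ` {0..1} \<union> \<beta> ` {0..1} \<Longrightarrow> norm x \<le> S" by (meson bounded_pos)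
  have S\<alpha>: "cmod (\<alpha> t) \<le> S" and S\<beta>: "cmod (\<beta> t) \<le> S" if "t \<in> {0..1}" for t using S(2) that by auto
  \<comment> \<open>Deviations from the chord between the end points. They vanish at 0 and 1, so a
    \<open>row\<close> has the ends \<open>g0\<close> and \<open>g1\<close>, which can be moved
    without touching its shape.\<close>
  define pa where "pa t = \<alpha> t - (of_real (1 - t) * \<alpha> 0 + of_real t * \<alpha> 1)" for t
  define pb where "pb t = \<beta> t - (of_real (1 - t) * \<beta> 0 + of_real t * \<beta> 1)" for t
  define row where "row g0 g1 s t = of_real (1 - t) * g0 + of_real t * g1 + of_real (1 - s) * pa t + of_real s * pb t"
    for g0 g1 :: complex and s t :: real
  have comb: "cmod (of_real (1 - t) * u + of_real t * v) \<le> max (cmod u) (cmod v)" if "t \<in> {0..1}" for t u v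
  proof -
    have "cmod (of_real (1 - t) * u + of_real t * v) \<le> (1 - t) * cmod u + t * cmod v"
      using that norm_triangle_ineq[of "of_real (1 - t) * u" "of_real t * v"] by (simp add: norm_mult del: of_real_diff)
    also have "\<dots> \<le> (1 - t) * max (cmod u) (cmod v) + t * max (cmod u) (cmod v)"
      using that by (intro add_mono mult_left_mono) auto
    finally show ?thesis by (simp add: algebra_simps)
  qed
  have pa: "cmod (pa t) \<le> 2 * S" if "t \<in> {0..1}" for t
    using comb[OF that, of "\<alpha> 0" "\<alpha> 1"] S\<alpha>[of 0] S\<alpha>[of 1] S\<alpha>[OF that] unfolding pa_def
    by (intro order_trans[OF norm_triangle_ineq4]) auto
  have pb: "cmod (pb t) \<le> 2 * S" if "t \<in> {0..1}" for t
    using comb[OF that, of "\<beta> 0" "\<beta> 1"] S\<beta>[of 0] S\<beta>[of 1] S\<beta>[OF that] unfolding pb_def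
    by (intro order_trans[OF norm_triangle_ineq4]) auto
  define G where "G = S + C0 + C1"
  define R0 where "R0 = G + 4 * S"
  have row_bound: "row g0 g1 s t \<in> cball 0 R0" if "cmod g0 \<le> G" "cmod g1 \<le> G" "s \<in> {0..1}" "t \<in> {0..1}" for g0 g1 s t
  proof -
    have "cmod (row g0 g1 s t) \<le> cmod (of_real (1 - t) * g0 + of_real t * g1) + cmod (of_real (1 - s) * pa t + of_real s * pb t)"
      using norm_triangle_ineq[of "of_real (1 - t) * g0 + of_real t * g1" "of_real (1 - s) * pa t + of_real s * pb t"]
      by (simp add: row_def add.assoc)
    also have "\<dots> \<le> G + 2 * S"
      using comb[OF that(4), of g0 g1] comb[OF that(3), of "pa t" "pb t"] that pa[OF that(4)] pb[OF that(4)]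
      by (intro add_mono) auto
    finally show ?thesis using S(1) by (simp add: R0_def)
  qed
  obtain M where M: "M > 0" "\<And>x y. x \<in> cball 0 R0 \<Longrightarrow> y \<in> cball 0 R0 \<Longrightarrow> d x y \<le> M * dist x y"
    using d_lipschitz by metis
  \<comment> \<open>The total displacement of any point during the homotopy: at most
    \<open>C0\<close> and \<open>C1\<close> from the moving ends and \<open>4 * S\<close> from the
    change of shape, with \<open>M\<close> converting to \<open>d\<close>. It determines
    \<open>R\<close>, then \<open>r\<close>, then the mesh \<open>\<eta>\<close> of the chains;
    hence \<open>C0\<close> and \<open>C1\<close> must not depend on the mesh.\<close>
  define Vmax where "Vmax = M * (C0 + C1 + 4 * S)"
  obtain R where R: "\<And>y. d (\<alpha> 0) y \<le> M * (2 * S) + Vmax \<Longrightarrow> cmod y \<le> R" using d_proper by metis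
  have S_R0: "S \<le> R0" using C_nonneg S(1) by (simp add: R0_def G_def)
  have region: "z \<in> cball 0 R" if "t \<in> {0..1}" "d (\<alpha> t) z \<le> Vmax" for t z
  proof -
    have "dist (\<alpha> 0) (\<alpha> t) \<le> 2 * S"
      using norm_triangle_ineq4[of "\<alpha> 0" "\<alpha> t"] S\<alpha>[of 0] S\<alpha>[OF that(1)] by (simp add: dist_norm)
    moreover have "d (\<alpha> 0) (\<alpha> t) \<le> M * dist (\<alpha> 0) (\<alpha> t)"
      using S\<alpha>[of 0] S\<alpha>[OF that(1)] S_R0 by (intro M(2)) auto
    ultimately have "d (\<alpha> 0) (\<alpha> t) \<le> M * (2 * S)" using M(1) by (meson mult_left_mono less_imp_le order.trans)
    then have "d (\<alpha> 0) z \<le> M * (2 * S) + Vmax" using that(2) d_triangle[of "\<alpha> 0" z "\<alpha> t"] by linarith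
    then show ?thesis using R by simp
  qed
  obtain r where r: "r > 0" "midpoint_radius R r"
    using local_midpoints[of R] unfolding midpoint_radius_def by metis
  define \<epsilon> where "\<epsilon> = r / 8"
  have \<epsilon>: "\<epsilon> > 0" "4 * \<epsilon> \<le> r" "2 * \<epsilon> < r / 2 + \<epsilon>" using r by (auto simp: \<epsilon>_def)
  \<comment> \<open>An edge of a row has Euclidean length at most \<open>2 * \<omega>\<close> from
    the affine part and \<open>\<omega>\<close> from the deviations;
    \<open>M * (4 * \<omega>)\<close> is then the permitted \<open>\<epsilon>\<close>.\<close>
  define \<omega> where "\<omega> = \<epsilon> / (4 * M)"
  have \<omega>: "\<omega> > 0" "M * (4 * \<omega>) = \<epsilon>" using \<epsilon> M by (auto simp: \<omega>_def)
  have unif: "uniformly_continuous_on {0..1} \<alpha>" "uniformly_continuous_on {0..1} \<beta>"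
    "uniformly_continuous_on {0..1} pa" "uniformly_continuous_on {0..1} pb"
    unfolding pa_def pb_def using c\<alpha> c\<beta>
    by (auto intro!: compact_uniformly_continuous continuous_intros)
  obtain \<delta>1 where \<delta>1: "\<delta>1 > 0" "\<And>s t. s \<in> {0..1} \<Longrightarrow> t \<in> {0..1} \<Longrightarrow> dist s t < \<delta>1 \<Longrightarrow> dist (pa s) (pa t) < \<omega>"
    using unif(3) \<omega>(1) unfolding uniformly_continuous_on_def by metis
  obtain \<delta>2 where \<delta>2: "\<delta>2 > 0" "\<And>s t. s \<in> {0..1} \<Longrightarrow> t \<in> {0..1} \<Longrightarrow> dist s t < \<delta>2 \<Longrightarrow> dist (pb s) (pb t) < \<omega>"
    using unif(4) \<omega>(1) unfolding uniformly_continuous_on_def by metis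
  define \<delta> where "\<delta> = min (min \<delta>1 \<delta>2) (min (min (\<delta>A / 2) (\<delta>B / 2)) (\<omega> / (G + 1)))"
  have G0: "G \<ge> 0" using C_nonneg S(1) by (simp add: G_def)
  have \<delta>: "\<delta> > 0" "\<delta> \<le> \<delta>1" "\<delta> \<le> \<delta>2" "\<delta> \<le> \<delta>A / 2" "\<delta> \<le> \<delta>B / 2" "\<delta> \<le> \<omega> / (G + 1)"
  proof -
    have "\<omega> / (G + 1) > 0" using \<omega>(1) G0 by simp
    then show "\<delta> > 0" "\<delta> \<le> \<delta>1" "\<delta> \<le> \<delta>2" "\<delta> \<le> \<delta>A / 2" "\<delta> \<le> \<delta>B / 2" "\<delta> \<le> \<omega> / (G + 1)"
      unfolding \<delta>_def using \<delta>1(1) \<delta>2(1) A(2) B(2) by linarith+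
  qed
  obtain N0 :: nat where N0: "1 / \<delta> < real N0" using reals_Archimedean2 by blast
  show ?thesis
  proof (rule that[of N0])
    fix N i :: nat assume "N0 \<le> N" and N: "N > 0" and i: "i \<le> N"
    have h: "1 / real N < \<delta>"
    proof -
      have "1 / \<delta> < real N" using N0 \<open>N0 \<le> N\<close> by linarith
      then show ?thesis using \<delta>(1) N by (simp add: field_simps)
    qed
    define t where "t k = real k / real N" for k
    have t01: "t k \<in> {0..1}" if "k \<le> N" for k using that N by (simp add: t_def divide_le_eq_1)
    have t_step: "t (Suc k) = t k + 1 / real N" for k by (simp add: t_def add_divide_distrib)
    define X where "X g0 g1 s k = row g0 g1 s (t k)" for g0 g1 s k
    have X_in: "X g0 g1 s k \<in> cball 0 R0" if "cmod g0 \<le> G" "cmod g1 \<le> G" "s \<in> {0..1}" "k \<le> N" for g0 g1 s k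
      using row_bound[OF that(1,2,3) t01[OF that(4)]] by (simp add: X_def)
    have X_edge: "d (X g0 g1 s k) (X g0 g1 s (Suc k)) \<le> \<epsilon>"
      if g: "cmod g0 \<le> G" "cmod g1 \<le> G" "s \<in> {0..1}" and k: "k < N" for g0 g1 s k
    proof -
      have "dist (t k) (t (Suc k)) = 1 / real N" by (simp add: t_step dist_real_def)
      then have dab: "dist (pa (t k)) (pa (t (Suc k))) < \<omega>" "dist (pb (t k)) (pb (t (Suc k))) < \<omega>"
        using \<delta>1(2)[OF t01 t01, of k "Suc k"] \<delta>2(2)[OF t01 t01, of k "Suc k"] k h \<delta> by auto
      have "X g0 g1 s (Suc k) - X g0 g1 s k = of_real (1 / real N) * (g1 - g0)
          + (of_real (1 - s) * (pa (t (Suc k)) - pa (t k)) + of_real s * (pb (t (Suc k)) - pb (t k)))"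
        by (simp only: X_def row_def t_step of_real_diff of_real_add of_real_1) (simp add: algebra_simps diff_divide_distrib)
      then have "dist (X g0 g1 s (Suc k)) (X g0 g1 s k) \<le> cmod (of_real (1 / real N) * (g1 - g0))
          + cmod (of_real (1 - s) * (pa (t (Suc k)) - pa (t k)) + of_real s * (pb (t (Suc k)) - pb (t k)))"
        by (simp only: dist_norm norm_triangle_ineq)
      also have "cmod (of_real (1 / real N) * (g1 - g0)) \<le> 1 / real N * (2 * G)"
        using g norm_triangle_ineq4[of g1 g0] by (simp add: norm_mult norm_divide divide_right_mono)
      also have "1 / real N * (2 * G) \<le> \<omega> / (G + 1) * (2 * (G + 1))"
        using h \<delta>(6) G0 \<omega>(1) by (intro mult_mono) auto
      also have "\<omega> / (G + 1) * (2 * (G + 1)) = 2 * \<omega>" using G0 by (simp add: field_simps)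
      also have "cmod (of_real (1 - s) * (pa (t (Suc k)) - pa (t k)) + of_real s * (pb (t (Suc k)) - pb (t k))) \<le> \<omega>"
        using comb[OF g(3), of "pa (t (Suc k)) - pa (t k)" "pb (t (Suc k)) - pb (t k)"] dab
        by (auto simp: dist_norm norm_minus_commute)
      finally have le: "dist (X g0 g1 s k) (X g0 g1 s (Suc k)) \<le> 4 * \<omega>" using \<omega>(1) by (simp add: dist_commute)
      have "d (X g0 g1 s k) (X g0 g1 s (Suc k)) \<le> M * dist (X g0 g1 s k) (X g0 g1 s (Suc k))"
        using k by (intro M(2) X_in g) auto
      also have "\<dots> \<le> \<epsilon>" using le M(1) \<omega>(2) by (metis mult_left_mono less_imp_le)
      finally show ?thesis .
    qed
    have X_ends: "X g0 g1 s 0 = g0" "X g0 g1 s N = g1" for g0 g1 s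
      using N by (simp_all add: X_def row_def t_def pa_def pb_def)
    let ?a = "\<lambda>k. \<alpha> (t k)" and ?b = "\<lambda>k. \<beta> (t k)"
    have X_\<alpha>: "X (\<alpha> 0) (\<alpha> 1) 0 = ?a" and X_\<beta>: "X (\<beta> 0) (\<beta> 1) 1 = ?b"
      by (auto simp: X_def row_def pa_def pb_def fun_eq_iff)
    have S01: "cmod (\<alpha> 0) \<le> S" "cmod (\<alpha> 1) \<le> S" "cmod (\<beta> 0) \<le> S" "cmod (\<beta> 1) \<le> S"
      using S\<alpha>[of 0] S\<alpha>[of 1] S\<beta>[of 0] S\<beta>[of 1] by auto
    have SG: "S \<le> G" using C_nonneg by (simp add: G_def)
    have reg: "\<And>k z. k \<le> N \<Longrightarrow> d (?a k) z \<le> Vmax \<Longrightarrow> z \<in> cball 0 R" using region t01 by blast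
    note ctx = r(2) \<epsilon>(1,2) N reg
    define reach where "reach = reachable_row ?a N \<epsilon>"
    have Vmax0: "0 \<le> Vmax" using M(1) C_nonneg S(1) by (simp add: Vmax_def)
    have edges_\<alpha>: "d (?a k) (?a (Suc k)) \<le> \<epsilon>" if "k < N" for k
      using X_edge[of "\<alpha> 0" "\<alpha> 1" 0 k] S01 SG that by (simp add: X_\<alpha>)
    have edges_\<beta>: "d (?b k) (?b (Suc k)) \<le> \<epsilon>" if "k < N" for k
      using X_edge[of "\<beta> 0" "\<beta> 1" 1 k] S01 SG that by (simp add: X_\<beta>)
    have h2: "2 / real N < \<delta>A" "2 / real N < \<delta>B" using h \<delta>(4,5) by auto
    have "smooth_row N ?a = ?a" unfolding t_def
    proof (rule smooth_row_local_geodesic[OF r(2) N h2(1) A(3)])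
      show "\<alpha> (real k / real N) \<in> cball 0 R" if "k \<le> N" for k
        using reg[OF that, of "?a k"] Vmax0 by (simp add: d_self t_def)
      show "d (\<alpha> (real k / real N)) (\<alpha> (real (Suc k) / real N)) < r / 2" if "k < N" for k
        using edges_\<alpha>[OF that] \<epsilon> by (simp add: t_def)
    qed
    then have "reach 0 0 0 ?a"
      unfolding reach_def by (intro reachable_row_refl[OF ctx] edges_\<alpha>)
    then have start: "reach 0 0 0 (X (\<alpha> 0) (\<alpha> 1) 0)" by (simp add: X_\<alpha>)
    have step: "reach (V + M * D) a' b' (X g0' g1' s')"
      if "reach V a b (X g0 g1 s)" and g: "cmod g0 \<le> G" "cmod g1 \<le> G" "s \<in> {0..1}" "cmod g0' \<le> G" "cmod g1' \<le> G" "s' \<in> {0..1}"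
        and near: "\<And>k. k \<le> N \<Longrightarrow> dist (X g0 g1 s k) (X g0' g1' s' k) \<le> D" and D: "0 \<le> D" "M * D \<le> \<epsilon>"
        and V: "V + M * D \<le> Vmax" and ab: "a + d g0 g0' \<le> a'" "b + d g1 g1' \<le> b'"
      for V a b g0 g1 s a' b' g0' g1' s' D
      unfolding reach_def
    proof (rule reachable_row_neighbour[OF ctx that(1)[unfolded reach_def] V])
      show "0 \<le> M * D" using M(1) D by simp
      show "d (X g0 g1 s k) (X g0' g1' s' k) \<le> M * D" if "k \<le> N" for k
        using M(2)[OF X_in[OF g(1-3) that] X_in[OF g(4-6) that]] near[OF that] M(1)
        by (meson mult_left_mono less_imp_le order.trans)
    qed (use D ab g in \<open>auto simp: X_ends intro!: X_edge\<close>)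
    define \<eta> where "\<eta> = \<epsilon> / M"
    have \<eta>: "\<eta> > 0" "M * \<eta> = \<epsilon>" using \<epsilon> M(1) by (auto simp: \<eta>_def)
    have near_bound: "cmod y \<le> cmod x + dist x y" for x y :: complex
      using norm_triangle_ineq2[of y x] by (simp add: dist_norm norm_minus_commute)
    \<comment> \<open>The homotopy has three stages: \<open>left\<close> moves the first end along
      its chain with the shape of \<open>\<alpha>\<close>, \<open>right\<close> the last end, and
      \<open>across\<close> changes the shape with fixed ends in \<open>K\<close> equal steps. Only
      the first two contribute to \<open>a\<close> and \<open>b\<close>, and they contribute the
      lengths of the chains.\<close>
    have left: "fine_chain d \<eta> (\<alpha> 0) z l C \<Longrightarrow> C \<le> C0 \<Longrightarrow> reach (M * C) l 0 (X z (\<alpha> 1) 0)" for z l C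
    proof (induction "\<alpha> 0" z l C rule: fine_chain.induct)
      case fine_chain_refl
      then show ?case using start by simp
    next
      case (fine_chain_step y l C z)
      have bd: "cmod y \<le> G" "cmod z \<le> G"
        using near_bound[of y "\<alpha> 0"] near_bound[of z "\<alpha> 0"] fine_chain_dist_le[OF fine_chain_step(1)]
          dist_triangle[of "\<alpha> 0" z y] zero_le_dist[of y z] fine_chain_step(4) S01 C_nonneg
        unfolding G_def by linarith+
      have "reach (M * C + M * dist y z) (l + d y z) 0 (X z (\<alpha> 1) 0)"
      proof (rule step[OF fine_chain_step(2)])
        show "C \<le> C0" using fine_chain_step(4) zero_le_dist[of y z] by linarith
        fix k assume "k \<le> N"
        have "X y (\<alpha> 1) 0 k - X z (\<alpha> 1) 0 k = of_real (1 - t k) * (y - z)"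
          by (simp add: X_def row_def algebra_simps)
        then show "dist (X y (\<alpha> 1) 0 k) (X z (\<alpha> 1) 0 k) \<le> dist y z"
          using t01[OF \<open>k \<le> N\<close>] by (simp add: dist_norm norm_mult mult_left_le_one_le del: of_real_diff)
      next
        show "M * dist y z \<le> \<epsilon>" using fine_chain_step(3) \<eta>(2) M(1) by (metis mult_left_mono less_imp_le)
        have "M * (C + dist y z) \<le> M * (C0 + C1 + 4 * S)"
          using fine_chain_step(4) C_nonneg S(1) M(1) by (intro mult_left_mono) auto
        then show "M * C + M * dist y z \<le> Vmax" by (simp add: Vmax_def distrib_left)
      qed (use bd S01 SG in \<open>auto simp: d_self\<close>)
      then show ?case by (simp add: distrib_left)
    qed
    obtain l0 C0' where l0: "fine_chain d \<eta> (\<alpha> 0) (\<beta> 0) l0 C0'" "l0 \<le> d (\<alpha> 0) (\<beta> 0) + e" "C0' \<le> C0"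
      using C0[OF \<eta>(1)] by blast
    have right: "fine_chain d \<eta> (\<alpha> 1) z l C \<Longrightarrow> C \<le> C1 \<Longrightarrow> reach (M * (C0' + C)) l0 l (X (\<beta> 0) z 0)" for z l C
    proof (induction "\<alpha> 1" z l C rule: fine_chain.induct)
      case fine_chain_refl
      then show ?case using left[OF l0(1,3)] by simp
    next
      case (fine_chain_step y l C z)
      have bd: "cmod y \<le> G" "cmod z \<le> G"
        using near_bound[of y "\<alpha> 1"] near_bound[of z "\<alpha> 1"] fine_chain_dist_le[OF fine_chain_step(1)]
          dist_triangle[of "\<alpha> 1" z y] zero_le_dist[of y z] fine_chain_step(4) S01 C_nonneg
        unfolding G_def by linarith+
      have "reach (M * (C0' + C) + M * dist y z) l0 (l + d y z) (X (\<beta> 0) z 0)"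
      proof (rule step[OF fine_chain_step(2)])
        show "C \<le> C1" using fine_chain_step(4) zero_le_dist[of y z] by linarith
        fix k assume "k \<le> N"
        have "X (\<beta> 0) y 0 k - X (\<beta> 0) z 0 k = of_real (t k) * (y - z)"
          by (simp add: X_def row_def algebra_simps)
        then show "dist (X (\<beta> 0) y 0 k) (X (\<beta> 0) z 0 k) \<le> dist y z"
          using t01[OF \<open>k \<le> N\<close>] by (simp add: dist_norm norm_mult mult_left_le_one_le)
      next
        show "M * dist y z \<le> \<epsilon>" using fine_chain_step(3) \<eta>(2) M(1) by (metis mult_left_mono less_imp_le)
        have "M * (C0' + C + dist y z) \<le> M * (C0 + C1 + 4 * S)"
          using fine_chain_step(4) l0(3) S(1) M(1) by (intro mult_left_mono) auto
        then show "M * (C0' + C) + M * dist y z \<le> Vmax" by (simp add: Vmax_def distrib_left)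
      qed (use bd S01 SG in \<open>auto simp: d_self\<close>)
      then show ?case by (simp add: distrib_left add.assoc)
    qed
    obtain l1 C1' where l1: "fine_chain d \<eta> (\<alpha> 1) (\<beta> 1) l1 C1'" "l1 \<le> d (\<alpha> 1) (\<beta> 1) + e" "C1' \<le> C1"
      using C1[OF \<eta>(1)] by blast
    obtain K :: nat where K: "K > 0" "M * (4 * S / real K) \<le> \<epsilon>"
    proof -
      obtain K :: nat where K: "M * (4 * S) / \<epsilon> < real K" using reals_Archimedean2 by blast
      moreover have "0 \<le> M * (4 * S) / \<epsilon>" using M(1) S(1) \<epsilon>(1) by simp
      ultimately have "real K > 0" by linarith
      then show ?thesis using K \<epsilon>(1) by (intro that[of K]) (auto simp: field_simps)
    qed
    have across: "k \<le> K \<Longrightarrow> reach (M * (C0' + C1' + real k / real K * (4 * S))) l0 l1 (X (\<beta> 0) (\<beta> 1) (real k / real K))" for k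
    proof (induction k)
      case 0
      then show ?case using right[OF l1(1,3)] by simp
    next
      case (Suc k)
      have kK: "real (Suc k) / real K = real k / real K + 1 / real K" by (simp add: add_divide_distrib)
      have in01: "real k / real K \<in> {0..1}" "real (Suc k) / real K \<in> {0..1}"
        using Suc.prems K(1) by (auto simp: divide_le_eq_1 simp del: of_nat_Suc)
      have "reach (M * (C0' + C1' + real k / real K * (4 * S)) + M * (4 * S / real K)) l0 l1 (X (\<beta> 0) (\<beta> 1) (real (Suc k) / real K))"
      proof (rule step[OF Suc.IH])
        fix j assume "j \<le> N"
        have "X (\<beta> 0) (\<beta> 1) (real k / real K) j - X (\<beta> 0) (\<beta> 1) (real (Suc k) / real K) j
            = of_real (1 / real K) * (pa (t j) - pb (t j))"
          unfolding X_def row_def kK by (simp add: algebra_simps)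
        moreover have "cmod (pa (t j) - pb (t j)) \<le> 4 * S"
          using norm_triangle_ineq4[of "pa (t j)" "pb (t j)"] pa[OF t01[OF \<open>j \<le> N\<close>]] pb[OF t01[OF \<open>j \<le> N\<close>]] by linarith
        ultimately show "dist (X (\<beta> 0) (\<beta> 1) (real k / real K) j) (X (\<beta> 0) (\<beta> 1) (real (Suc k) / real K) j) \<le> 4 * S / real K"
          by (simp add: dist_norm norm_mult norm_divide divide_right_mono)
      next
        have "real k / real K * (4 * S) + 4 * S / real K = real (Suc k) / real K * (4 * S)"
          unfolding kK by (simp add: algebra_simps)
        also have "\<dots> \<le> 1 * (4 * S)" using in01(2) S(1) by (intro mult_right_mono) auto
        finally have "M * (C0' + C1' + (real k / real K * (4 * S) + 4 * S / real K)) \<le> M * (C0 + C1 + 4 * S)"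
          using l0(3) l1(3) M(1) by (intro mult_left_mono) auto
        then show "M * (C0' + C1' + real k / real K * (4 * S)) + M * (4 * S / real K) \<le> Vmax"
          by (simp add: Vmax_def distrib_left)
      qed (use Suc.prems in01 K S01 SG S(1) in \<open>auto simp: d_self simp del: of_nat_Suc\<close>)
      moreover have "M * (C0' + C1' + real k / real K * (4 * S)) + M * (4 * S / real K)
          = M * (C0' + C1' + real (Suc k) / real K * (4 * S))"
        unfolding kK by (simp add: algebra_simps)
      ultimately show ?case by simp
    qed
    have "smooth_row N ?b = ?b" unfolding t_def
    proof (rule smooth_row_local_geodesic[OF r(2) N h2(2) B(3)])
      have "reach (M * (C0' + C1' + 1 * (4 * S))) l0 l1 ?b"
        using across[of K] K(1) by (simp add: X_\<beta>)
      then have tame_b: "\<forall>n. (\<forall>i\<le>N. d (?a i) ((smooth_row N ^^ n) ?b i) \<le> M * (C0' + C1' + 1 * (4 * S))) \<and>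
          (\<forall>i<N. d ((smooth_row N ^^ n) ?b i) ((smooth_row N ^^ n) ?b (Suc i)) \<le> \<epsilon>)"
        unfolding reach_def reachable_row_def tame_def by (rule conjunct1)
      have Vb: "M * (C0' + C1' + 1 * (4 * S)) \<le> Vmax"
        unfolding Vmax_def using l0(3) l1(3) M(1) by (intro mult_left_mono) auto
      show "\<beta> (real k / real N) \<in> cball 0 R" if "k \<le> N" for k
      proof -
        have "d (?a k) (?b k) \<le> M * (C0' + C1' + 1 * (4 * S))"
          using tame_b[THEN spec[of _ "0::nat"]] that by simp
        then show ?thesis using reg[OF that, of "?b k"] Vb by (simp add: t_def)
      qed
      show "d (\<beta> (real k / real N)) (\<beta> (real (Suc k) / real N)) < r / 2" if "k < N" for k
        using edges_\<beta>[OF that] \<epsilon> by (simp add: t_def)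
    qed
    moreover have "reach (M * (C0' + C1' + 1 * (4 * S))) l0 l1 ?b"
      using across[of K] K(1) by (simp add: X_\<beta>)
    ultimately have "d (?a i) (?b i) \<le> affine_bound N l0 l1 i"
      unfolding reach_def by (intro reachable_stationary_row[OF ctx _ _ i])
    also have "\<dots> \<le> affine_bound N (d (\<alpha> 0) (\<beta> 0) + e) (d (\<alpha> 1) (\<beta> 1) + e) i"
      by (rule affine_bound_mono[OF ctx l0(2) l1(2) i])
    finally show "d (\<alpha> (real i / real N)) (\<beta> (real i / real N))
        \<le> affine_bound N (d (\<alpha> 0) (\<beta> 0) + e) (d (\<alpha> 1) (\<beta> 1) + e) i" by (simp add: t_def)
  qed
qed

theorem local_geodesic_convex:
  assumes \<alpha>: "local_geodesic \<alpha>" and \<beta>: "local_geodesic \<beta>" and t: "t \<in> {0..1}"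
  shows "d (\<alpha> t) (\<beta> t) \<le> (1 - t) * d (\<alpha> 0) (\<beta> 0) + t * d (\<alpha> 1) (\<beta> 1)"
proof (rule field_le_epsilon)
  fix e :: real assume "e > 0"
  define e' where "e' = e / 2"
  have e': "e' > 0" using \<open>e > 0\<close> by (simp add: e'_def)
  obtain A \<delta>A where A: "A \<ge> 0" "\<delta>A > 0"
    "\<And>s t. s \<in> {0..1} \<Longrightarrow> t \<in> {0..1} \<Longrightarrow> \<bar>s - t\<bar> < \<delta>A \<Longrightarrow> d (\<alpha> s) (\<alpha> t) = A * \<bar>s - t\<bar>"
    using local_geodesicE[OF \<alpha>] by metis
  obtain B \<delta>B where B: "B \<ge> 0" "\<delta>B > 0"
    "\<And>s t. s \<in> {0..1} \<Longrightarrow> t \<in> {0..1} \<Longrightarrow> \<bar>s - t\<bar> < \<delta>B \<Longrightarrow> d (\<beta> s) (\<beta> t) = B * \<bar>s - t\<bar>"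
    using local_geodesicE[OF \<beta>] by metis
  define D0 D1 where "D0 = d (\<alpha> 0) (\<beta> 0)" "D1 = d (\<alpha> 1) (\<beta> 1)"
  have D: "0 \<le> D0" "0 \<le> D1" using d_nonneg by (auto simp: D0_D1_def)
  obtain N0 where N0: "\<And>N i. N \<ge> N0 \<Longrightarrow> N > 0 \<Longrightarrow> i \<le> N \<Longrightarrow>
    d (\<alpha> (real i / real N)) (\<beta> (real i / real N)) \<le> affine_bound N (D0 + e') (D1 + e') i"
    using local_geodesic_convex_approx[OF \<alpha> \<beta> e'] unfolding D0_D1_def by metis
  \<comment> \<open>\<open>c / real N\<close> covers the errors of replacing \<open>t\<close> by the
    grid point below it: motion at speeds \<open>A\<close> and \<open>B\<close> along the curves,
    and the change of the affine bound.\<close>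
  define c where "c = A + B + D0 + D1 + 1"
  have c: "c > 0" using A(1) B(1) D by (simp add: c_def)
  obtain N1 :: nat where N1: "1 / \<delta>A + 1 / \<delta>B + c / e' + real N0 + 1 < real N1" using reals_Archimedean2 by blast
  define N where "N = N1"
  have pos: "1 / \<delta>A > 0" "1 / \<delta>B > 0" "c / e' > 0" using A(2) B(2) c e' by auto
  have N: "N > 0" "N0 \<le> N" "1 / \<delta>A < real N" "1 / \<delta>B < real N" "c / e' < real N"
  proof -
    have "0 < real N" "real N0 \<le> real N" using N1 pos unfolding N_def by linarith+
    then show "N > 0" "N0 \<le> N" by simp_all
    show "1 / \<delta>A < real N" "1 / \<delta>B < real N" "c / e' < real N" using N1 pos unfolding N_def by linarith+
  qed
  have hN: "1 / real N < \<delta>A" "1 / real N < \<delta>B" "c / real N < e'"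
    using N A(2) B(2) e' by (simp_all add: field_simps)
  define i where "i = nat \<lfloor>t * real N\<rfloor>"
  define s where "s = real i / real N"
  have ri: "real i = of_int \<lfloor>t * real N\<rfloor>" using t by (simp add: i_def)
  have "real i \<le> t * real N" "t * real N < real i + 1" unfolding ri by linarith+
  then have st: "s \<le> t" "t < s + 1 / real N" using N(1) by (auto simp: s_def field_simps)
  have s01: "s \<in> {0..1}" using st t by (auto simp: s_def)
  have "i \<le> N" using s01 N(1) by (auto simp: s_def divide_le_eq_1 split: if_splits)
  have dist_st: "\<bar>t - s\<bar> = t - s" "\<bar>s - t\<bar> = t - s" "t - s \<le> 1 / real N" using st by auto
  have a: "d (\<alpha> t) (\<alpha> s) \<le> A * (1 / real N)"
    using A(3)[OF t s01] mult_left_mono[OF dist_st(3) A(1)] dist_st hN by simp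
  have b: "d (\<beta> s) (\<beta> t) \<le> B * (1 / real N)"
    using B(3)[OF s01 t] mult_left_mono[OF dist_st(3) B(1)] dist_st hN by simp
  have "affine_bound N (D0 + e') (D1 + e') i = (1 - s) * D0 + s * D1 + e'"
    unfolding affine_bound_def s_def[symmetric] by (simp add: algebra_simps)
  then have m: "d (\<alpha> s) (\<beta> s) \<le> (1 - s) * D0 + s * D1 + e'"
    using N0[OF N(2) N(1) \<open>i \<le> N\<close>] by (simp add: s_def)
  have "(1 - s) * D0 + s * D1 = (1 - t) * D0 + t * D1 + (t - s) * D0 - (t - s) * D1" by (simp add: algebra_simps)
  moreover have "(t - s) * D0 \<le> 1 / real N * D0" using dist_st D by (intro mult_right_mono) auto
  moreover have "0 \<le> (t - s) * D1" using st D by (intro mult_nonneg_nonneg) auto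
  ultimately have "(1 - s) * D0 + s * D1 \<le> (1 - t) * D0 + t * D1 + 1 / real N * D0" by linarith
  moreover have "d (\<alpha> t) (\<beta> t) \<le> d (\<alpha> t) (\<alpha> s) + d (\<alpha> s) (\<beta> s) + d (\<beta> s) (\<beta> t)"
    using d_triangle[of "\<alpha> t" "\<beta> t" "\<alpha> s"] d_triangle[of "\<alpha> s" "\<beta> t" "\<beta> s"] by linarith
  ultimately have "d (\<alpha> t) (\<beta> t) \<le> (1 - t) * D0 + t * D1 + e' + (A + B + D0) / real N"
    using a b m by (simp add: add_divide_distrib)
  also have "(A + B + D0) / real N \<le> c / real N" using D N(1) by (intro divide_right_mono) (auto simp: c_def)
  also have "c / real N \<le> e'" using hN by simp
  finally show "d (\<alpha> t) (\<beta> t) \<le> (1 - t) * d (\<alpha> 0) (\<beta> 0) + t * d (\<alpha> 1) (\<beta> 1) + e"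
    by (simp add: e'_def D0_D1_def)
qed

text \<open>Comparison with the constant curve at \<open>\<alpha> 0\<close>, a local geodesic of
  speed 0: the distance from the start lies below its chord but equals \<open>A * t\<close> for
  small \<open>t\<close>. Thus local geodesics realize the distance of their ends.\<close>

lemma local_geodesic_minimal:
  assumes "local_geodesic \<alpha>" "\<delta> > 0" "A \<ge> 0"
    and A: "\<And>s t. s \<in> {0..1} \<Longrightarrow> t \<in> {0..1} \<Longrightarrow> \<bar>s - t\<bar> < \<delta> \<Longrightarrow> d (\<alpha> s) (\<alpha> t) = A * \<bar>s - t\<bar>"
  shows "A \<le> d (\<alpha> 0) (\<alpha> 1)"
proof -
  define t where "t = min 1 (\<delta> / 2)"
  have t: "t > 0" "t \<le> 1" "t < \<delta>" using assms(2) by (auto simp: t_def)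
  have "local_geodesic (\<lambda>_. \<alpha> 0)"
    unfolding local_geodesic_def by (intro exI[of _ 0] exI[of _ 1] conjI) (auto simp: d_self)
  from local_geodesic_convex[OF this assms(1), of t] t
  have "d (\<alpha> 0) (\<alpha> t) \<le> t * d (\<alpha> 0) (\<alpha> 1)" by (simp add: d_self)
  moreover have "d (\<alpha> 0) (\<alpha> t) = A * t" using A[of 0 t] t by simp
  ultimately show ?thesis using t by (simp add: mult.commute[of A])
qed

section \<open>Tripods with common end points\<close>

definition unit_speed :: "(real \<Rightarrow> complex) \<Rightarrow> real \<Rightarrow> bool" where
  "unit_speed c L \<longleftrightarrow> L > 0 \<and> (\<exists>\<delta>>0. \<forall>u\<in>{0..L}. \<forall>v\<in>{0..L}. \<bar>u - v\<bar> < \<delta> \<longrightarrow> d (c u) (c v) = \<bar>u - v\<bar>)"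

lemma unit_speed_scaled:
  assumes "unit_speed c L" "0 \<le> R" "R \<le> L"
  obtains \<delta> where "\<delta> > 0"
    "\<And>s t. s \<in> {0..1} \<Longrightarrow> t \<in> {0..1} \<Longrightarrow> \<bar>s - t\<bar> < \<delta> \<Longrightarrow> d (c (R * s)) (c (R * t)) = R * \<bar>s - t\<bar>"
proof -
  obtain \<delta> where \<delta>: "\<delta> > 0" "\<And>u v. u \<in> {0..L} \<Longrightarrow> v \<in> {0..L} \<Longrightarrow> \<bar>u - v\<bar> < \<delta> \<Longrightarrow> d (c u) (c v) = \<bar>u - v\<bar>"
    using assms(1) unfolding unit_speed_def by metis
  show ?thesis
  proof (rule that[of "\<delta> / (R + 1)"])
    show "\<delta> / (R + 1) > 0" using \<delta>(1) assms(2) by simp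
    fix s t :: real assume st: "s \<in> {0..1}" "t \<in> {0..1}" "\<bar>s - t\<bar> < \<delta> / (R + 1)"
    have in_L: "R * x \<in> {0..L}" if "x \<in> {0..1}" for x
      using that assms(2,3) mult_left_le[of x R] by auto
    have eq: "\<bar>R * s - R * t\<bar> = R * \<bar>s - t\<bar>" using assms(2) by (simp add: abs_mult right_diff_distrib[symmetric])
    also have "\<dots> \<le> (R + 1) * \<bar>s - t\<bar>" by (intro mult_right_mono) auto
    also have "\<dots> < \<delta>" using st(3) assms(2) by (simp add: field_simps)
    finally show "d (c (R * s)) (c (R * t)) = R * \<bar>s - t\<bar>" using \<delta>(2)[OF in_L in_L] st eq by simp
  qed
qed

lemma local_geodesic_unit_speed:
  assumes "unit_speed c L" "0 \<le> R" "R \<le> L"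
  shows "local_geodesic (\<lambda>t. c (R * t))"
  using unit_speed_scaled[OF assms] assms(2) unfolding local_geodesic_def by metis

lemma unit_speed_le:
  assumes "unit_speed c L" "0 \<le> u" "u \<le> v" "v \<le> L"
  shows "d (c u) (c v) \<le> v - u"
proof -
  obtain \<delta> where \<delta>: "\<delta> > 0" "\<And>u v. u \<in> {0..L} \<Longrightarrow> v \<in> {0..L} \<Longrightarrow> \<bar>u - v\<bar> < \<delta> \<Longrightarrow> d (c u) (c v) = \<bar>u - v\<bar>"
    using assms(1) unfolding unit_speed_def by metis
  have "u \<le> u \<longrightarrow> v \<le> v \<longrightarrow> d (c u) (c v) \<le> v - u"
  proof (rule Bolzano[where P = "\<lambda>a b. u \<le> a \<longrightarrow> b \<le> v \<longrightarrow> d (c a) (c b) \<le> b - a", OF \<open>u \<le> v\<close>], goal_cases)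
    case (1 x y z)
    then show ?case using d_triangle[of "c x" "c z" "c y"] by auto
  next
    case (2 x)
    have "d (c a) (c b) \<le> b - a" if "a \<le> x" "x \<le> b" "b - a < \<delta>" "u \<le> a" "b \<le> v" for a b
      using \<delta>(2)[of a b] that assms by simp
    then show ?case using \<delta>(1) by blast
  qed
  then show ?thesis by simp
qed

lemma unit_speed_dist:
  assumes "unit_speed c L" "0 \<le> u" "u \<le> L"
  shows "d (c 0) (c u) = u"
proof -
  obtain \<delta> where \<delta>: "\<delta> > 0"
    "\<And>s t. s \<in> {0..1} \<Longrightarrow> t \<in> {0..1} \<Longrightarrow> \<bar>s - t\<bar> < \<delta> \<Longrightarrow> d (c (u * s)) (c (u * t)) = u * \<bar>s - t\<bar>"
    using unit_speed_scaled[OF assms] by metis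
  have "u \<le> d (c 0) (c u)"
    using local_geodesic_minimal[OF local_geodesic_unit_speed[OF assms] \<delta>(1) assms(2) \<delta>(2)] by simp
  then show ?thesis using unit_speed_le[OF assms(1) order_refl assms(2,3)] by simp
qed

lemma unit_speed_unique:
  assumes c: "unit_speed c L" and c': "unit_speed c' L'" and ends: "c 0 = c' 0" "c L = c' L'" and u: "0 \<le> u" "u \<le> L"
  shows "L = L'" "c u = c' u"
proof -
  have L: "L > 0" "L' > 0" using c c' by (auto simp: unit_speed_def)
  show "L = L'" using unit_speed_dist[OF c, of L] unit_speed_dist[OF c', of L'] L ends by simp
  have "d (c (L * (u / L))) (c' (L * (u / L))) \<le> (1 - u / L) * d (c (L * 0)) (c' (L * 0)) + u / L * d (c (L * 1)) (c' (L * 1))"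
    by (rule local_geodesic_convex[OF local_geodesic_unit_speed[OF c] local_geodesic_unit_speed[OF c']])
      (use L u \<open>L = L'\<close> in \<open>auto simp: divide_le_eq_1\<close>)
  then have "d (c u) (c' u) \<le> 0" using ends L \<open>L = L'\<close> by (simp add: d_self)
  then show "c u = c' u" using d_nonneg[of "c u" "c' u"] d_eq_0D by force
qed

text \<open>
  In a metric without a linear structure, \<open>p\<close> being the barycentre of the three points at distance \<open>r\<close> on
  the legs is expressed by two short geodesics.
\<close>

definition balanced :: "complex \<Rightarrow> (nat \<Rightarrow> real \<Rightarrow> complex) \<Rightarrow> bool" where
  "balanced p c \<longleftrightarrow> (\<exists>s>0. \<forall>r. 0 < r \<longrightarrow> r < s \<longrightarrow> (\<exists>\<sigma> \<tau>. local_geodesic \<sigma> \<and> local_geodesic \<tau> \<and>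
     \<sigma> 0 = c 1 r \<and> \<sigma> 1 = c 2 r \<and> \<tau> 0 = c 0 r \<and> \<tau> 1 = \<sigma> (1/2) \<and> \<tau> (2/3) = p))"

text \<open>Convexity along \<open>\<sigma>\<close> with weights 1/2, then along
  \<open>\<tau>\<close> with weights 1/3 and 2/3, gives every leg the weight 1/3. Different radii
  \<open>r\<close>, \<open>r'\<close> are allowed because the tripods will be traversed at different
  speeds.\<close>

lemma balanced_contract:
  assumes "balanced p c" "balanced p' c'"
  obtains s where "s > 0" "\<And>r r'. 0 < r \<Longrightarrow> r < s \<Longrightarrow> 0 < r' \<Longrightarrow> r' < s \<Longrightarrow> d p p' \<le> (\<Sum>k<3. d (c k r) (c' k r')) / 3"
proof -
  obtain s where s: "s > 0" "\<And>r. 0 < r \<Longrightarrow> r < s \<Longrightarrow> (\<exists>\<sigma> \<tau>. local_geodesic \<sigma> \<and> local_geodesic \<tau> \<and>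
     \<sigma> 0 = c 1 r \<and> \<sigma> 1 = c 2 r \<and> \<tau> 0 = c 0 r \<and> \<tau> 1 = \<sigma> (1/2) \<and> \<tau> (2/3) = p)"
    using assms(1) unfolding balanced_def by metis
  obtain s' where s': "s' > 0" "\<And>r. 0 < r \<Longrightarrow> r < s' \<Longrightarrow> (\<exists>\<sigma> \<tau>. local_geodesic \<sigma> \<and> local_geodesic \<tau> \<and>
     \<sigma> 0 = c' 1 r \<and> \<sigma> 1 = c' 2 r \<and> \<tau> 0 = c' 0 r \<and> \<tau> 1 = \<sigma> (1/2) \<and> \<tau> (2/3) = p')"
    using assms(2) unfolding balanced_def by metis
  show ?thesis
  proof (rule that[of "min s s'"])
    show "min s s' > 0" using s s' by simp
    fix r r' assume r: "0 < r" "r < min s s'" "0 < r'" "r' < min s s'"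
    obtain \<sigma> \<tau> where st: "local_geodesic \<sigma>" "local_geodesic \<tau>"
      "\<sigma> 0 = c 1 r" "\<sigma> 1 = c 2 r" "\<tau> 0 = c 0 r" "\<tau> 1 = \<sigma> (1/2)" "\<tau> (2/3) = p"
      using s(2)[of r] r by auto
    obtain \<sigma>' \<tau>' where st': "local_geodesic \<sigma>'" "local_geodesic \<tau>'"
      "\<sigma>' 0 = c' 1 r'" "\<sigma>' 1 = c' 2 r'" "\<tau>' 0 = c' 0 r'" "\<tau>' 1 = \<sigma>' (1/2)" "\<tau>' (2/3) = p'"
      using s'(2)[of r'] r by auto
    have "d (\<sigma> (1/2)) (\<sigma>' (1/2)) \<le> (1 - 1/2) * d (\<sigma> 0) (\<sigma>' 0) + 1/2 * d (\<sigma> 1) (\<sigma>' 1)"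
      by (rule local_geodesic_convex[OF st(1) st'(1)]) auto
    moreover have "d (\<tau> (2/3)) (\<tau>' (2/3)) \<le> (1 - 2/3) * d (\<tau> 0) (\<tau>' 0) + 2/3 * d (\<tau> 1) (\<tau>' 1)"
      by (rule local_geodesic_convex[OF st(2) st'(2)]) auto
    ultimately show "d p p' \<le> (\<Sum>k<3. d (c k r) (c' k r')) / 3"
      unfolding st st' by (simp add: numeral_3_eq_3 numeral_2_eq_2 field_simps)
  qed
qed

definition is_tripod :: "complex \<Rightarrow> (nat \<Rightarrow> real) \<Rightarrow> (nat \<Rightarrow> real \<Rightarrow> complex) \<Rightarrow> bool" where
  "is_tripod p L c \<longleftrightarrow> balanced p c \<and> (\<forall>k<3. unit_speed (c k) (L k) \<and> c k 0 = p)"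

text \<open>
  The first variation of the distances between corresponding points, when one tripod is traversed
  at \<open>l\<close> times the speed of the other.
\<close>

lemma tripod_first_variation:
  assumes T: "is_tripod p L c" and T': "is_tripod p' L' c'" and "l > 0"
  defines "R \<equiv> \<lambda>k. min (L k) (L' k / l)"
  shows "0 \<le> (\<Sum>k<3. (d (c k (R k)) (c' k (l * R k)) - d p p') / R k)"
proof -
  let ?D = "d p p'"
  define E where "E k = d (c k (R k)) (c' k (l * R k))" for k
  have us: "unit_speed (c k) (L k)" "c k 0 = p" "unit_speed (c' k) (L' k)" "c' k 0 = p'" "0 < L k" "0 < L' k" if "k < 3" for k
    using T T' that by (auto simp: is_tripod_def unit_speed_def)
  have R: "0 < R k" "R k \<le> L k" "l * R k \<le> L' k" if "k < 3" for k
    using us[OF that] \<open>l > 0\<close> by (auto simp: R_def min_def field_simps)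
  obtain s where s: "s > 0" "\<And>r r'. 0 < r \<Longrightarrow> r < s \<Longrightarrow> 0 < r' \<Longrightarrow> r' < s \<Longrightarrow> ?D \<le> (\<Sum>k<3. d (c k r) (c' k r')) / 3"
    using balanced_contract[of p c p' c'] T T' unfolding is_tripod_def by metis
  define r where "r = Min {s / 2, s / (2 * l), R 0, R 1, R 2}"
  have r: "r > 0" "r \<le> s / 2" "r \<le> s / (2 * l)" "r \<le> R 0" "r \<le> R 1" "r \<le> R 2"
    using s(1) \<open>l > 0\<close> R[of 0] R[of 1] R[of 2] by (auto simp: r_def)
  have rR: "r \<le> R k" if "k < 3" for k
    using r that by (auto simp: less_Suc_eq numeral_3_eq_3 numeral_2_eq_2)
  have lr: "l * r < s" using r(3) \<open>l > 0\<close> s(1) by (simp add: field_simps)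
  \<comment> \<open>\<open>R k\<close> is the time at which the first of the two legs ends. On the
    common part, the distance at the small time \<open>r\<close> lies below the chord between times
    0 and \<open>R k\<close>.\<close>
  have u: "d (c k r) (c' k (l * r)) \<le> ?D + r * ((E k - ?D) / R k)" if k: "k < 3" for k
  proof -
    have 1: "r / R k \<in> {0..1}" using r(1) rR[OF k] R[OF k] by (auto simp: divide_le_eq_1)
    have "d (c k (R k * (r / R k))) (c' k ((l * R k) * (r / R k)))
        \<le> (1 - r / R k) * d (c k (R k * 0)) (c' k ((l * R k) * 0)) + r / R k * d (c k (R k * 1)) (c' k ((l * R k) * 1))"
      by (rule local_geodesic_convex[OF local_geodesic_unit_speed[OF us(1)[OF k]] local_geodesic_unit_speed[OF us(3)[OF k]] 1])
        (use R[OF k] \<open>l > 0\<close> in auto)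
    moreover have "(1 - r / R k) * ?D + r / R k * E k = ?D + r * ((E k - ?D) / R k)"
      by (simp add: left_diff_distrib diff_divide_distrib right_diff_distrib)
    ultimately show ?thesis using R[OF k] us[OF k] by (simp add: E_def)
  qed
  have "3 * ?D \<le> (\<Sum>k<3. d (c k r) (c' k (l * r)))" using s(2)[of r "l * r"] r s(1) lr \<open>l > 0\<close> by simp
  also have "\<dots> \<le> (\<Sum>k<3. ?D + r * ((E k - ?D) / R k))" by (intro sum_mono u) auto
  also have "\<dots> = 3 * ?D + r * (\<Sum>k<3. (E k - ?D) / R k)" by (simp add: sum.distrib sum_distrib_left)
  finally have "0 \<le> r * (\<Sum>k<3. (E k - ?D) / R k)" by simp
  then show ?thesis using r(1) by (simp add: zero_le_mult_iff E_def)
qed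

text \<open>At time \<open>R k\<close> one of the two points has arrived at the common end; what
  separates it from the other is at most the rest of the other leg.\<close>

lemma tripod_end_bounds:
  assumes T: "is_tripod p L c" and T': "is_tripod p' L' c'" and "l > 0" and k: "k < 3" and ends: "c k (L k) = c' k (L' k)"
  shows "L k \<le> L' k / l \<Longrightarrow> d (c k (min (L k) (L' k / l))) (c' k (l * min (L k) (L' k / l))) \<le> L' k - l * L k"
    and "L' k / l \<le> L k \<Longrightarrow> d (c k (min (L k) (L' k / l))) (c' k (l * min (L k) (L' k / l))) \<le> L k - L' k / l"
    and "\<bar>L k - L' k\<bar> \<le> d p p'"
proof -
  have us: "unit_speed (c k) (L k)" "c k 0 = p" "unit_speed (c' k) (L' k)" "c' k 0 = p'" "0 < L k" "0 < L' k"
    using T T' k by (auto simp: is_tripod_def unit_speed_def)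
  show "d (c k (min (L k) (L' k / l))) (c' k (l * min (L k) (L' k / l))) \<le> L' k - l * L k" if "L k \<le> L' k / l"
  proof -
    have "l * L k \<le> L' k" using that \<open>l > 0\<close> by (simp add: field_simps)
    then have "d (c' k (l * L k)) (c' k (L' k)) \<le> L' k - l * L k"
      using us \<open>l > 0\<close> by (intro unit_speed_le[OF us(3)]) auto
    then show ?thesis using that ends by (simp add: d_sym[of "c' k (l * L k)"])
  qed
  show "d (c k (min (L k) (L' k / l))) (c' k (l * min (L k) (L' k / l))) \<le> L k - L' k / l" if "L' k / l \<le> L k"
  proof -
    have "d (c k (L' k / l)) (c k (L k)) \<le> L k - L' k / l"
      using us \<open>l > 0\<close> that by (intro unit_speed_le[OF us(1)]) auto
    then show ?thesis using that ends \<open>l > 0\<close> by (simp add: min_def)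
  qed
  have "d p (c k (L k)) = L k" "d p' (c k (L k)) = L' k"
    using unit_speed_dist[OF us(1), of "L k"] unit_speed_dist[OF us(3), of "L' k"] us ends by simp_all
  then show "\<bar>L k - L' k\<bar> \<le> d p p'"
    using d_triangle[of p "c k (L k)" p'] d_triangle[of p' "c k (L k)" p] d_sym[of p p'] by linarith
qed

text \<open>At equal speeds every summand of the first variation is nonpositive, because the
  distance at the end is at most the difference of lengths, hence at most \<open>d p p'\<close>.
  Their sum is nonnegative, so equality holds in each.\<close>

lemma tripod_lengths_differ:
  assumes T: "is_tripod p L c" and T': "is_tripod p' L' c'" and ends: "\<And>k. k < 3 \<Longrightarrow> c k (L k) = c' k (L' k)" and "k < 3"
  shows "\<bar>L k - L' k\<bar> = d p p'"
proof (rule ccontr)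
  let ?D = "d p p'"
  define R where "R k = min (L k) (L' k / 1)" for k
  define E where "E k = d (c k (R k)) (c' k (1 * R k))" for k
  have R: "R j > 0" if "j < 3" for j using T T' that by (auto simp: R_def is_tripod_def unit_speed_def)
  have E: "E j \<le> \<bar>L j - L' j\<bar>" if "j < 3" for j
    using tripod_end_bounds(1,2)[OF T T' zero_less_one that ends[OF that]] unfolding E_def R_def by (cases "L j \<le> L' j") auto
  have nonpos: "(E j - ?D) / R j \<le> 0" if "j < 3" for j
    using E[OF that] tripod_end_bounds(3)[OF T T' zero_less_one that ends[OF that]] R[OF that]
    by (intro divide_nonpos_pos) auto
  assume "\<bar>L k - L' k\<bar> \<noteq> ?D"
  then have "\<bar>L k - L' k\<bar> < ?D"
    using tripod_end_bounds(3)[OF T T' zero_less_one \<open>k < 3\<close> ends[OF \<open>k < 3\<close>]] by simp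
  then have "(E k - ?D) / R k < 0" using E[OF \<open>k < 3\<close>] R[OF \<open>k < 3\<close>] by (intro divide_neg_pos) auto
  then have "(\<Sum>j<3. (E j - ?D) / R j) < (\<Sum>j<(3::nat). 0 :: real)"
    using nonpos \<open>k < 3\<close> by (intro sum_strict_mono_ex1) auto
  then show False using tripod_first_variation[OF T T' zero_less_one] unfolding E_def R_def by simp
qed

text \<open>If two legs become shorter, slowing the second tripod slightly contradicts the first variation.\<close>

lemma tripod_not_two_shorter:
  assumes T: "is_tripod p L c" and T': "is_tripod p' L' c'" and ends: "\<And>k. k < 3 \<Longrightarrow> c k (L k) = c' k (L' k)"
    and ij: "i < 3" "j < 3" "i \<noteq> j" and shorter: "L' i < L i" "L' j < L j"
  shows False
proof -
  let ?D = "d p p'"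
  have D: "\<bar>L k - L' k\<bar> = ?D" if "k < 3" for k by (rule tripod_lengths_differ[OF T T' ends that])
  have D0: "?D > 0" using D[OF ij(1)] shorter(1) by simp
  have pos: "0 < L k" "0 < L' k" if "k < 3" for k
    using T T' that by (auto simp: is_tripod_def unit_speed_def)
  \<comment> \<open>For a leg that is shorter in the second tripod, \<open>L' k = L k - ?D\<close>.
    Any \<open>l\<close> between \<open>1 - ?D / (2 * L k)\<close> and 1 therefore keeps
    \<open>L' k \<le> l * L k\<close>, so that the slowed second tripod still arrives first.\<close>
  define l where "l = max (max (1 / 2) (1 - ?D / (2 * L 0))) (max (1 - ?D / (2 * L 1)) (1 - ?D / (2 * L 2)))"
  have "?D / (2 * L 0) > 0" "?D / (2 * L 1) > 0" "?D / (2 * L 2) > 0"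
    using D0 pos[of 0] pos[of 1] pos[of 2] by auto
  then have l: "0 < l" "l < 1" "1 - ?D / (2 * L 0) \<le> l" "1 - ?D / (2 * L 1) \<le> l" "1 - ?D / (2 * L 2) \<le> l"
    unfolding l_def by linarith+
  have lk: "1 - ?D / (2 * L k) \<le> l" if "k < 3" for k
    using l that by (auto simp: less_Suc_eq numeral_3_eq_3 numeral_2_eq_2)
  define R where "R k = min (L k) (L' k / l)" for k
  define E where "E k = d (c k (R k)) (c' k (l * R k))" for k
  define f where "f k = (E k - ?D) / R k" for k
  have plus: "f k \<le> l - 1" if k: "k < 3" "L' k < L k" for k
  proof -
    have L: "L k = L' k + ?D" using D[OF k(1)] k(2) by simp
    have "L' k = L k * (1 - ?D / L k)" using pos[OF k(1)] L by (simp add: field_simps)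
    also have "\<dots> \<le> L k * (1 - ?D / (2 * L k))" using pos[OF k(1)] D0 by (intro mult_left_mono) (auto simp: field_simps)
    also have "\<dots> \<le> L k * l" using lk[OF k(1)] pos[OF k(1)] by (intro mult_left_mono) auto
    finally have le: "L' k / l \<le> L k" using l(1) by (simp add: field_simps)
    then have R: "R k = L' k / l" by (simp add: R_def)
    have "E k \<le> L k - L' k / l"
      using tripod_end_bounds(2)[OF T T' l(1) k(1) ends[OF k(1)] le] by (simp add: E_def R_def)
    then have "f k \<le> (L' k - L' k / l) / (L' k / l)"
      unfolding f_def R using L pos[OF k(1)] l(1) by (intro divide_right_mono) auto
    also have "\<dots> = l - 1" using pos[OF k(1)] l(1) by (simp add: field_simps)
    finally show ?thesis .
  qed
  have minus: "f k \<le> 1 - l" if k: "k < 3" "L k \<le> L' k" for k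
  proof -
    have L: "L' k = L k + ?D" using D[OF k(1)] k(2) by simp
    have "L' k * l \<le> L' k * 1" using pos[OF k(1)] l by (intro mult_left_mono) auto
    then have "L' k \<le> L' k / l" using l(1) by (simp add: field_simps)
    then have le: "L k \<le> L' k / l" using k(2) by linarith
    then have R: "R k = L k" by (simp add: R_def)
    have "E k \<le> L' k - l * L k"
      using tripod_end_bounds(1)[OF T T' l(1) k(1) ends[OF k(1)] le] by (simp add: E_def R_def)
    then have "f k \<le> (L k - l * L k) / L k"
      unfolding f_def R using L pos[OF k(1)] by (intro divide_right_mono) auto
    also have "\<dots> = 1 - l" using pos[OF k(1)] by (simp add: field_simps)
    finally show ?thesis .
  qed
  have any: "f k \<le> 1 - l" if "k < 3" for k
    using plus[OF that] minus[OF that] l(2) by linarith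
  \<comment> \<open>Two terms of at most \<open>l - 1\<close> outweigh a single one of at most
    \<open>1 - l\<close>.\<close>
  have "f 0 + f 1 + f 2 < 0"
    using plus[OF ij(1) shorter(1)] plus[OF ij(2) shorter(2)] any[of 0] any[of 1] any[of 2] ij l(2)
    by (auto simp: less_Suc_eq numeral_3_eq_3 numeral_2_eq_2)
  moreover have "0 \<le> (\<Sum>k<3. f k)"
    using tripod_first_variation[OF T T' l(1)] unfolding f_def E_def R_def .
  ultimately show False by (simp add: numeral_3_eq_3 numeral_2_eq_2)
qed

text \<open>If the centres differ, every leg changes its length, and by the pigeonhole principle two
  legs are shorter in the same one of the two tripods.\<close>

theorem tripod_unique:
  assumes T: "is_tripod p L c" and T': "is_tripod p' L' c'" and ends: "\<And>k. k < 3 \<Longrightarrow> c k (L k) = c' k (L' k)"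
    and k: "k < 3"
  shows "L k = L' k" "u \<in> {0..L k} \<Longrightarrow> c k u = c' k u"
proof -
  have D: "\<bar>L k - L' k\<bar> = d p p'" if "k < 3" for k by (rule tripod_lengths_differ[OF T T' ends that])
  have "p = p'"
  proof (rule ccontr)
    assume "p \<noteq> p'"
    then have "L k \<noteq> L' k" if "k < 3" for k using D[OF that] d_eq_0D by force
    then have "L' k < L k \<or> L k < L' k" if "k < 3" for k using that by (meson linorder_neqE)
    from this[of 0] this[of 1] this[of 2]
    show False
      using tripod_not_two_shorter[OF T T' ends, of 0 1] tripod_not_two_shorter[OF T T' ends, of 0 2]
        tripod_not_two_shorter[OF T T' ends, of 1 2]
        tripod_not_two_shorter[OF T' T ends[symmetric], of 0 1] tripod_not_two_shorter[OF T' T ends[symmetric], of 0 2]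
        tripod_not_two_shorter[OF T' T ends[symmetric], of 1 2]
      by auto
  qed
  then have us: "unit_speed (c k) (L k)" "unit_speed (c' k) (L' k)" "c k 0 = c' k 0"
    using T T' k by (auto simp: is_tripod_def)
  show "L k = L' k"
    using unit_speed_unique(1)[OF us ends[OF k], of 0] us(1) by (simp add: unit_speed_def)
  show "c k u = c' k u" if "u \<in> {0..L k}"
    using unit_speed_unique(2)[OF us ends[OF k], of u] that by simp
qed

text \<open>Local length functions are glued by bisection, with constants adjusted at the junction
  \<open>b\<close>. The function given around \<open>b\<close> provides additivity for intervals
  that straddle it.\<close>

lemma arc_length_parameter:
  fixes \<gamma> :: "real \<Rightarrow> complex"
  assumes add: "\<And>x. x \<in> {0..1} \<Longrightarrow> \<exists>e>0. \<exists>h. \<forall>s t. 0 \<le> s \<longrightarrow> s \<le> t \<longrightarrow> t \<le> 1 \<longrightarrow> \<bar>s - x\<bar> < e \<longrightarrow> \<bar>t - x\<bar> < e \<longrightarrow> d (\<gamma> s) (\<gamma> t) = h t - h s"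
  obtains \<sigma> \<delta> where "\<delta> > 0" "\<And>s t. 0 \<le> s \<Longrightarrow> s \<le> t \<Longrightarrow> t \<le> 1 \<Longrightarrow> t - s < \<delta> \<Longrightarrow> d (\<gamma> s) (\<gamma> t) = \<sigma> t - (\<sigma> s :: real)"
proof -
  let ?P = "\<lambda>(a::real) (b::real). 0 \<le> a \<longrightarrow> b \<le> 1 \<longrightarrow> (\<exists>\<sigma> \<delta>. \<delta> > 0 \<and> (\<forall>s t. a \<le> s \<longrightarrow> s \<le> t \<longrightarrow> t \<le> b \<longrightarrow> t - s < \<delta> \<longrightarrow> d (\<gamma> s) (\<gamma> t) = \<sigma> t - (\<sigma> s :: real)))"
  have "?P 0 1"
  proof (rule Bolzano[where P = ?P, OF zero_le_one], goal_cases)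
    case (1 a b c)
    show ?case
    proof (intro impI)
      assume ac: "0 \<le> a" "c \<le> 1"
      then have "b \<in> {0..1}" using 1 by auto
      then obtain e h where e: "e > 0" "\<And>s t. 0 \<le> s \<Longrightarrow> s \<le> t \<Longrightarrow> t \<le> 1 \<Longrightarrow> \<bar>s - b\<bar> < e \<Longrightarrow> \<bar>t - b\<bar> < e \<Longrightarrow> d (\<gamma> s) (\<gamma> t) = h t - h s"
        using add by metis
      obtain \<sigma>1 \<delta>1 where 11: "\<delta>1 > 0" "\<And>s t. a \<le> s \<Longrightarrow> s \<le> t \<Longrightarrow> t \<le> b \<Longrightarrow> t - s < \<delta>1 \<Longrightarrow> d (\<gamma> s) (\<gamma> t) = \<sigma>1 t - (\<sigma>1 s :: real)"
        using 1 ac by force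
      obtain \<sigma>2 \<delta>2 where 22: "\<delta>2 > 0" "\<And>s t. b \<le> s \<Longrightarrow> s \<le> t \<Longrightarrow> t \<le> c \<Longrightarrow> t - s < \<delta>2 \<Longrightarrow> d (\<gamma> s) (\<gamma> t) = \<sigma>2 t - (\<sigma>2 s :: real)"
        using 1 ac by force
      define \<sigma> where "\<sigma> t = (if t \<le> b then \<sigma>1 t else \<sigma>2 t + (\<sigma>1 b - \<sigma>2 b))" for t
      have \<sigma>2: "\<sigma> t = \<sigma>2 t + (\<sigma>1 b - \<sigma>2 b)" if "b \<le> t" for t using that by (auto simp: \<sigma>_def)
      have "d (\<gamma> s) (\<gamma> t) = \<sigma> t - \<sigma> s" if st: "a \<le> s" "s \<le> t" "t \<le> c" "t - s < min e (min \<delta>1 \<delta>2)" for s t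
      proof -
        consider "t \<le> b" | "b \<le> s" | "s \<le> b" "b \<le> t" by linarith
        then show ?thesis
        proof cases
          case 1
          then show ?thesis using 11(2)[of s t] st by (simp add: \<sigma>_def)
        next
          case 2
          then show ?thesis using 22(2)[of s t] st by (simp add: \<sigma>2)
        next
          case 3
          have "d (\<gamma> s) (\<gamma> t) = h t - h s" "d (\<gamma> s) (\<gamma> b) = h b - h s" "d (\<gamma> b) (\<gamma> t) = h t - h b"
            using e(2)[of s t] e(2)[of s b] e(2)[of b t] 3 st ac e(1) by auto
          moreover have "d (\<gamma> s) (\<gamma> b) = \<sigma>1 b - \<sigma>1 s" "d (\<gamma> b) (\<gamma> t) = \<sigma>2 t - \<sigma>2 b"
            using 11(2)[of s b] 22(2)[of b t] 3 st by auto
          ultimately show ?thesis using 3 \<sigma>2[of t] by (simp add: \<sigma>_def[of s])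
        qed
      qed
      then show "\<exists>\<sigma> \<delta>. \<delta> > 0 \<and> (\<forall>s t. a \<le> s \<longrightarrow> s \<le> t \<longrightarrow> t \<le> c \<longrightarrow> t - s < \<delta> \<longrightarrow> d (\<gamma> s) (\<gamma> t) = \<sigma> t - (\<sigma> s :: real))"
        using e(1) 11(1) 22(1) by (intro exI[of _ \<sigma>] exI[of _ "min e (min \<delta>1 \<delta>2)"]) auto
    qed
  next
    case (2 x)
    then obtain e h where e: "e > 0" "\<And>s t. 0 \<le> s \<Longrightarrow> s \<le> t \<Longrightarrow> t \<le> 1 \<Longrightarrow> \<bar>s - x\<bar> < e \<Longrightarrow> \<bar>t - x\<bar> < e \<Longrightarrow> d (\<gamma> s) (\<gamma> t) = h t - h s"
      using add[of x] by (metis atLeastAtMost_iff)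
    show ?case
    proof (intro exI[of _ e] conjI allI impI e(1))
      fix a b assume ab: "a \<le> x \<and> x \<le> b \<and> b - a < e" "0 \<le> a" "b \<le> 1"
      then have "d (\<gamma> s) (\<gamma> t) = h t - h s" if "a \<le> s" "s \<le> t" "t \<le> b" for s t
        using that by (intro e(2)) auto
      then show "\<exists>\<sigma> \<delta>. \<delta> > 0 \<and> (\<forall>s t. a \<le> s \<longrightarrow> s \<le> t \<longrightarrow> t \<le> b \<longrightarrow> t - s < \<delta> \<longrightarrow> d (\<gamma> s) (\<gamma> t) = \<sigma> t - (\<sigma> s :: real))"
        by (intro exI[of _ h] exI[of _ 1]) auto
    qed
  qed
  then show ?thesis using that by auto
qed

end

section \<open>Properness and a uniform scale for midpoints\<close>

context conformal_density
begin

text \<open>Outside a disc the density is at least 1, so the Euclidean distance to that disc is a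
  test function.\<close>

lemma d_ball_bounded:
  assumes R1: "\<And>z. cmod z \<ge> R1 \<Longrightarrow> \<rho> z \<ge> 1"
  shows "\<exists>R. \<forall>y. d x y \<le> C \<longrightarrow> cmod y \<le> R"
proof -
  define f where "f z = max (cmod z - R1) 0" for z
  have "admissible f" unfolding admissible_def
  proof
    fix z
    show "ptwise_lipschitz f z (\<rho> z)"
    proof (cases "cmod z < R1")
      case True
      then have "\<forall>\<^sub>F y in nhds z. y \<in> ball 0 R1" by (intro eventually_nhds_in_open) auto
      then have "\<forall>\<^sub>F y in nhds z. \<bar>f y - f z\<bar> \<le> 0 * dist y z"
        by eventually_elim (use True in \<open>auto simp: f_def\<close>)
      then show ?thesis by (rule ptwise_lipschitz_mono[OF ptwise_lipschitz_of_bound \<rho>_nonneg])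
    next
      case False
      have "\<bar>f y - f z\<bar> \<le> 1 * dist y z" for y
        using norm_triangle_ineq3[of y z] by (simp add: f_def dist_norm)
      then show ?thesis
        using False by (intro ptwise_lipschitz_mono[OF ptwise_lipschitz_of_bound R1] always_eventually) auto
    qed
  qed
  then have "f y - f x \<le> d x y" for y by (rule admissible_le_d)
  then have "cmod y \<le> C + f x + R1" if "d x y \<le> C" for y
    using that by (smt (verit) f_def)
  then show ?thesis by blast
qed

text \<open>A Lebesgue number argument: finitely many balls of a quarter of the permitted radius
  cover the disc, and anything close to \<open>x\<close> is then well inside the full ball of its
  centre.\<close>

lemma local_midpoints_from_cone_charts:
  assumes ch: "\<And>z0. \<exists>e \<kappa> \<zeta>. cone_chart z0 e \<kappa> \<zeta>"
  shows "\<exists>r>0. \<forall>x y. x \<in> cball 0 R \<longrightarrow> d x y < r \<longrightarrow>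
      (\<exists>m. \<forall>q. d q x < r \<longrightarrow> (d q m)\<^sup>2 \<le> (d q x)\<^sup>2 / 2 + (d q y)\<^sup>2 / 2 - (d x y)\<^sup>2 / 4)"
proof -
  have "\<exists>r>0. \<forall>x y. d z x < r \<longrightarrow> d z y < r \<longrightarrow>
      (\<exists>m. \<forall>q. d z q < r \<longrightarrow> (d q m)\<^sup>2 \<le> (d q x)\<^sup>2 / 2 + (d q y)\<^sup>2 / 2 - (d x y)\<^sup>2 / 4)" for z
  proof -
    obtain e \<kappa> \<zeta> where "cone_chart z e \<kappa> \<zeta>" using ch by blast
    from cone_chart_isometry[OF this] show ?thesis by blast
  qed
  then obtain rad where rad: "\<And>z. rad z > 0" "\<And>z x y. d z x < rad z \<Longrightarrow> d z y < rad z \<Longrightarrow>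
      (\<exists>m. \<forall>q. d z q < rad z \<longrightarrow> (d q m)\<^sup>2 \<le> (d q x)\<^sup>2 / 2 + (d q y)\<^sup>2 / 2 - (d x y)\<^sup>2 / 4)"
    by metis
  obtain T where T: "T \<subseteq> cball 0 R" "finite T" "cball 0 R \<subseteq> (\<Union>z\<in>T. {y. d z y < rad z / 4})"
  proof (rule compactE_image[OF compact_cball[of 0 R], of "cball 0 R" "\<lambda>z. {y. d z y < rad z / 4}"])
    show "open {y. d z y < rad z / 4}" for z by (rule open_d_ball)
    show "cball 0 R \<subseteq> (\<Union>z\<in>cball 0 R. {y. d z y < rad z / 4})"
      using rad(1) by (force simp: d_self)
  qed (use that in blast)
  define r where "r = Min (insert 1 ((\<lambda>z. rad z / 4) ` T))"
  have r: "r > 0" using T(2) rad(1) by (auto simp: r_def)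
  have r_le: "r \<le> rad z / 4" if "z \<in> T" for z
    unfolding r_def using T(2) that by (intro Min_le) auto
  show ?thesis
  proof (intro exI[of _ r] conjI allI impI r)
    fix x y assume x: "x \<in> cball 0 R" and xy: "d x y < r"
    obtain z where z: "z \<in> T" "d z x < rad z / 4" using T(3) x by blast
    have near: "d z q < rad z" if "d x q < r" for q
      using d_triangle[of z q x] z r_le[OF z(1)] that rad(1)[of z] by linarith
    obtain m where m: "\<And>q. d z q < rad z \<Longrightarrow> (d q m)\<^sup>2 \<le> (d q x)\<^sup>2 / 2 + (d q y)\<^sup>2 / 2 - (d x y)\<^sup>2 / 4"
      using rad(2)[of z x y] near[OF xy] z(2) rad(1)[of z] by fastforce
    show "\<exists>m. \<forall>q. d q x < r \<longrightarrow> (d q m)\<^sup>2 \<le> (d q x)\<^sup>2 / 2 + (d q y)\<^sup>2 / 2 - (d x y)\<^sup>2 / 4"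
      using m near by (auto simp: d_sym[of _ x])
  qed
qed

end

section \<open>The flat metric of a cubic differential\<close>

locale nonconstant_cubic =
  fixes P :: "complex poly"
  assumes degree_pos: "degree P > 0"
begin

lemma P_nonzero: "P \<noteq> 0"
  using degree_pos by auto

sublocale flat: conformal_density "cubic_density P"
  by (rule conformal_density_cubic)

abbreviation dP :: "complex \<Rightarrow> complex \<Rightarrow> real" where "dP \<equiv> flat.d"

lemma density_large: "\<exists>R. \<forall>z. cmod z \<ge> R \<longrightarrow> cubic_density P z \<ge> 1"
proof -
  obtain a p where P: "P = pCons a p" by (cases P) auto
  then have "p \<noteq> 0" using degree_pos by auto
  then obtain R where "\<And>z. R \<le> cmod z \<Longrightarrow> 1 \<le> cmod (poly P z)"
    using poly_infinity[of p 1 a] P by auto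
  then have "cubic_density P z \<ge> 1" if "cmod z \<ge> R" for z
    using real_root_le_mono[of 3 1 "cmod (poly P z)"] that by (simp add: cubic_density_def)
  then show ?thesis by blast
qed

sublocale npc_metric dP
proof
  fix x y z :: complex and R e C :: real
  show "0 \<le> dP x y" "dP x x = 0" "dP x y = dP y x" "dP x z \<le> dP x y + dP y z"
    by (rule flat.d_nonneg flat.d_self flat.d_sym flat.d_triangle)+
  show "\<exists>M>0. \<forall>x\<in>cball 0 R. \<forall>y\<in>cball 0 R. dP x y \<le> M * dist x y" by (rule flat.d_Lipschitz_on_cball)
  show "\<exists>R. \<forall>y. dP x y \<le> C \<longrightarrow> cmod y \<le> R" using density_large flat.d_ball_bounded by metis
  show "\<exists>h>0. \<forall>y. dP x y < h \<longrightarrow> dist x y < e" if "e > 0"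
    using cone_chart_exists[OF P_nonzero] flat.cone_chart_small_d_ball[OF _ that] by metis
  show "chain_reach dP x y (dP x y + e)" if "e > 0" using flat.length_space that .
  show "\<exists>r>0. \<forall>x y. x \<in> cball 0 R \<longrightarrow> dP x y < r \<longrightarrow>
      (\<exists>m. \<forall>q. dP q x < r \<longrightarrow> (dP q m)\<^sup>2 \<le> (dP q x)\<^sup>2 / 2 + (dP q y)\<^sup>2 / 2 - (dP x y)\<^sup>2 / 4)"
    by (rule flat.local_midpoints_from_cone_charts) (use cone_chart_exists[OF P_nonzero] in metis)
qed

text \<open>Test functions are integrated along straight segments of the image, and
  \<open>dist (w x)\<close> composed with \<open>w\<close> is a local test function for the
  converse. The ball of radius \<open>s\<close> allows short segments of the plane to be lifted into
  the isometric ball.\<close>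

lemma flat_chart_isometry:
  assumes ch: "flat_chart P U w" and z0: "z0 \<in> U"
  obtains r s where "r > 0" "s > 0" "ball z0 r \<subseteq> U" "ball (w z0) s \<subseteq> w ` ball z0 r"
    "\<And>x y. x \<in> ball z0 r \<Longrightarrow> y \<in> ball z0 r \<Longrightarrow> dP x y = dist (w x) (w y)"
proof -
  have U: "open U" "w holomorphic_on U" "inj_on w U" "\<And>z. z \<in> U \<Longrightarrow> deriv w z ^ 3 = poly P z"
    "\<And>z. z \<in> U \<Longrightarrow> poly P z \<noteq> 0"
    using ch by (auto simp: flat_chart_def)
  have dens: "cubic_density P z = cmod (deriv w z)" if "z \<in> U" for z
    by (rule cubic_density_eqI) (use U(4)[OF that] in simp)
  obtain g where g: "g holomorphic_on (w ` U)" "\<And>z. z \<in> U \<Longrightarrow> deriv w z * deriv g (w z) = 1" "\<And>z. z \<in> U \<Longrightarrow> g (w z) = z"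
    using holomorphic_has_inverse[OF U(2,1,3)] by metis
  have oW: "open (w ` U)" using U by (intro open_mapping_thm3) auto
  then obtain s0 where s0: "s0 > 0" "ball (w z0) s0 \<subseteq> w ` U" using z0 open_contains_ball by blast
  have upper: "dP x y \<le> dist (w x) (w y)" if x: "x \<in> U" "w x \<in> ball (w z0) s0" and y: "y \<in> U" "w y \<in> ball (w z0) s0" for x y
  proof (rule flat.d_leI)
    fix f assume f: "flat.admissible f"
    have "\<bar>f (g (linepath (w x) (w y) 1)) - f (g (linepath (w x) (w y) 0))\<bar> \<le> dist (w x) (w y) * 1 - dist (w x) (w y) * 0"
    proof (rule ptwise_lipschitz_increment_open[where G' = "\<lambda>_. dist (w x) (w y)"])
      fix t :: real assume "t \<in> {0..1}"
      then have "linepath (w x) (w y) t \<in> ball (w z0) s0"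
        using closed_segment_subset[OF x(2) y(2) convex_ball] linepath_in_path by blast
      then obtain z where z: "z \<in> U" "linepath (w x) (w y) t = w z" using s0(2) by blast
      have "(g has_field_derivative deriv g (w z)) (at (w z))"
        using holomorphic_derivI[OF g(1) oW] z by blast
      from ptwise_lipschitz_compose_field[OF _ this, of f "cubic_density P (g (w z))"]
      have "ptwise_lipschitz (\<lambda>v. f (g v)) (w z) (cubic_density P (g (w z)) * cmod (deriv g (w z)))"
        using f flat.\<rho>_nonneg by (simp add: flat.admissible_def)
      moreover have "cubic_density P (g (w z)) * cmod (deriv g (w z)) = 1"
        using dens[OF z(1)] g(2,3)[OF z(1)] by (metis norm_mult norm_one)
      ultimately have lip: "ptwise_lipschitz (\<lambda>v. f (g v)) (linepath (w x) (w y) t) 1" using z by simp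
      have der: "(linepath (w x) (w y) has_vector_derivative (w y - w x)) (at t)"
        unfolding linepath_def by (auto intro!: derivative_eq_intros simp: algebra_simps)
      show "ptwise_lipschitz (\<lambda>t. f (g (linepath (w x) (w y) t))) t (dist (w x) (w y))"
        using ptwise_lipschitz_compose_curve[OF lip der] by (simp add: dist_norm norm_minus_commute)
    qed (auto intro!: derivative_eq_intros)
    then show "f y - f x \<le> dist (w x) (w y)" using g(3) x y by (simp add: linepath_def)
  qed
  obtain e0 where e0: "e0 > 0" "ball z0 e0 \<subseteq> U" using U(1) z0 open_contains_ball by blast
  obtain h where h: "h > 0" "\<And>y. dP z0 y < h \<Longrightarrow> dist z0 y < e0" using d_separates[OF e0(1)] by metis
  have lower: "dist (w x) (w y) \<le> dP x y" if "dP z0 x < h / 8" "dP z0 y < h / 8" for x y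
  proof -
    have "\<bar>dist (w x) (w y) - dist (w x) (w x)\<bar> \<le> dP x y"
    proof (rule flat.abs_diff_le_d_local[of z0 "h / 4"])
      fix v assume "dP z0 v < 4 * (h / 4)"
      then have v: "v \<in> U" using h(2) e0(2) by auto
      have "\<bar>dist (w x) b - dist (w x) a\<bar> \<le> 1 * dist b a" for a b
        using dist_triangle[of "w x" b a] dist_triangle[of "w x" a b] by (simp add: dist_commute abs_le_iff)
      then have "ptwise_lipschitz (dist (w x)) (w v) 1"
        by (intro ptwise_lipschitz_of_bound always_eventually) auto
      from ptwise_lipschitz_compose_field[OF this holomorphic_derivI[OF U(2,1) v]]
      show "ptwise_lipschitz (\<lambda>v. dist (w x) (w v)) v (cubic_density P v)" by (simp add: dens[OF v])
    qed (use that in auto)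
    then show ?thesis by simp
  qed
  have cw: "continuous_on U w" using U(2) holomorphic_on_imp_continuous_on by blast
  have "open {z \<in> U. w z \<in> ball (w z0) s0}"
    using continuous_open_preimage[OF cw U(1), of "ball (w z0) s0"] by (simp add: vimage_def Int_def)
  then have "open ({z \<in> U. w z \<in> ball (w z0) s0} \<inter> {y. dP z0 y < h / 8})"
    using flat.open_d_ball by (intro open_Int)
  moreover have "z0 \<in> {z \<in> U. w z \<in> ball (w z0) s0} \<inter> {y. dP z0 y < h / 8}"
    using z0 s0(1) h(1) by (simp add: d_self)
  ultimately obtain r where r: "r > 0" "ball z0 r \<subseteq> {z \<in> U. w z \<in> ball (w z0) s0} \<inter> {y. dP z0 y < h / 8}"
    by (meson open_contains_ball)
  have "ball z0 r \<subseteq> U" using r(2) by auto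
  moreover from this have "open (w ` ball z0 r)"
    using U by (intro open_mapping_thm3) (auto intro: holomorphic_on_subset inj_on_subset)
  then obtain s where "s > 0" "ball (w z0) s \<subseteq> w ` ball z0 r"
    using r(1) by (meson centre_in_ball image_eqI open_contains_ball)
  moreover have "dP x y = dist (w x) (w y)" if "x \<in> ball z0 r" "y \<in> ball z0 r" for x y
    using upper[of x y] lower[of x y] subsetD[OF r(2) that(1)] subsetD[OF r(2) that(2)] by (intro antisym) auto
  ultimately show ?thesis using r(1) that by blast
qed

end

text \<open>The quotient of the derivatives is continuous with values in the finite set of cube
  roots of unity, hence constant on the ball.\<close>

lemma cube_derivatives_eq:
  fixes F G :: "complex \<Rightarrow> complex"
  assumes F: "F holomorphic_on ball z0 r" and G: "G holomorphic_on ball z0 r" and "r > 0"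
    and eq: "\<And>z. z \<in> ball z0 r \<Longrightarrow> deriv F z ^ 3 = deriv G z ^ 3" and nz: "\<And>z. z \<in> ball z0 r \<Longrightarrow> deriv G z \<noteq> 0"
  obtains \<omega> where "\<omega> ^ 3 = 1" "\<And>x y. x \<in> ball z0 r \<Longrightarrow> y \<in> ball z0 r \<Longrightarrow> F x - F y = \<omega> * (G x - G y)"
proof -
  define q where "q z = deriv F z / deriv G z" for z
  have q3: "q z ^ 3 = 1" if "z \<in> ball z0 r" for z using eq[OF that] nz[OF that] by (simp add: q_def power_divide)
  have "continuous_on (ball z0 r) q"
    unfolding q_def using F G nz
    by (intro continuous_on_divide holomorphic_on_imp_continuous_on holomorphic_deriv) auto
  moreover have "finite (q ` ball z0 r)"
    using q3 by (intro finite_subset[OF _ finite_roots_unity[of 3]]) auto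
  ultimately have "q constant_on ball z0 r" by (intro continuous_finite_range_constant connected_ball)
  then obtain \<omega> where \<omega>: "\<And>z. z \<in> ball z0 r \<Longrightarrow> q z = \<omega>" unfolding constant_on_def by blast
  have "\<exists>c. \<forall>z\<in>ball z0 r. F z - \<omega> * G z = c"
  proof (rule has_field_derivative_zero_constant[OF convex_ball])
    fix z assume z: "z \<in> ball z0 r"
    have "deriv F z = \<omega> * deriv G z" using \<omega>[OF z] nz[OF z] by (simp add: q_def field_simps)
    then show "((\<lambda>z. F z - \<omega> * G z) has_field_derivative 0) (at z within ball z0 r)"
      using holomorphic_derivI[OF F open_ball z] holomorphic_derivI[OF G open_ball z]
      by (auto intro!: derivative_eq_intros)
  qed
  then obtain c where c: "\<And>z. z \<in> ball z0 r \<Longrightarrow> F z - \<omega> * G z = c" by blast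
  show ?thesis
  proof (rule that[of \<omega>])
    show "\<omega> ^ 3 = 1" using q3[of z0] \<omega>[of z0] \<open>r > 0\<close> by simp
    show "F x - F y = \<omega> * (G x - G y)" if "x \<in> ball z0 r" "y \<in> ball z0 r" for x y
      using c[OF that(1)] c[OF that(2)] by (simp add: algebra_simps)
  qed
qed

text \<open>Directions agree on overlaps, so there is a single direction on \<open>{0<..t1}\<close>.
  The limit 0 puts the curve on the ray from the origin, where norms add. Nothing is asked at 0,
  where the curve to be developed meets a zero.\<close>

lemma locally_straight_from_origin:
  fixes \<phi> :: "real \<Rightarrow> complex"
  assumes loc: "\<And>t0. 0 < t0 \<Longrightarrow> t0 \<le> t1 \<Longrightarrow> \<exists>e>0. \<exists>u. cmod u = 1 \<and>
      (\<forall>s t. 0 < s \<longrightarrow> s < t \<longrightarrow> t \<le> t1 \<longrightarrow> \<bar>s - t0\<bar> < e \<longrightarrow> \<bar>t - t0\<bar> < e \<longrightarrow> (\<exists>a>0. \<phi> t - \<phi> s = of_real a * u))"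
    and lim: "(\<phi> \<longlongrightarrow> 0) (at_right 0)" and st: "0 < s" "s < t" "t \<le> t1"
  shows "cmod (\<phi> t - \<phi> s) = cmod (\<phi> t) - cmod (\<phi> s)"
proof -
  let ?S = "\<lambda>u a b. \<forall>s t. a \<le> s \<longrightarrow> s < t \<longrightarrow> t \<le> b \<longrightarrow> (\<exists>r>0. \<phi> t - \<phi> s = of_real r * u)"
  have same: "u = v" if "cmod u = 1" "cmod v = 1" "of_real a * u = of_real b * v" "a > 0" "b > 0" for u v :: complex and a b :: real
  proof -
    have "cmod (of_real a * u) = a" "cmod (of_real b * v) = b" using that(1,2,4,5) by (simp_all add: norm_mult)
    then have "a = b" using that(3) by simp
    then show ?thesis using that by simp
  qed
  let ?P = "\<lambda>a b. 0 < a \<longrightarrow> b \<le> t1 \<longrightarrow> (\<exists>u. cmod u = 1 \<and> ?S u a b)"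
  have straight: "\<exists>u. cmod u = 1 \<and> ?S u a0 t1" if a0: "0 < a0" "a0 \<le> t1" for a0
  proof -
    have "?P a0 t1"
    proof (rule Bolzano[where P = ?P, OF a0(2)], goal_cases)
      case (1 a b c)
      show ?case
      proof (intro impI)
        assume ac: "0 < a" "c \<le> t1"
        consider "a = b" | "b = c" | "a < b" "b < c" using 1 by linarith
        then show "\<exists>u. cmod u = 1 \<and> ?S u a c"
        proof cases
          case 1
          then show ?thesis using \<open>?P b c\<close> ac by blast
        next
          case 2
          then show ?thesis using \<open>?P a b\<close> ac by blast
        next
          case 3
          obtain u where u: "cmod u = 1" "?S u a b" using \<open>?P a b\<close> ac 3 by auto
          obtain v where v: "cmod v = 1" "?S v b c" using \<open>?P b c\<close> ac 3 by auto
          obtain e u0 where e: "e > 0" "cmod u0 = 1" "\<And>s t. 0 < s \<Longrightarrow> s < t \<Longrightarrow> t \<le> t1 \<Longrightarrow> \<bar>s - b\<bar> < e \<Longrightarrow> \<bar>t - b\<bar> < e \<Longrightarrow> (\<exists>a>0. \<phi> t - \<phi> s = of_real a * u0)"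
            using loc[of b] ac 3 by (smt (verit))
          define x where "x = max a (b - e / 2)"
          define y where "y = min c (b + e / 2)"
          have xy: "a \<le> x" "x < b" "\<bar>x - b\<bar> < e" "b < y" "y \<le> c" "\<bar>y - b\<bar> < e"
            using e(1) 3 by (auto simp: x_def y_def)
          obtain a1 a2 where "a1 > 0" "a2 > 0" "\<phi> b - \<phi> x = of_real a1 * u0" "\<phi> b - \<phi> x = of_real a2 * u"
            using e(3)[of x b] u(2) xy ac 3 e(1) by (smt (verit))
          then have uu: "u = u0" using same u(1) e(2) by metis
          obtain b1 b2 where "b1 > 0" "b2 > 0" "\<phi> y - \<phi> b = of_real b1 * u0" "\<phi> y - \<phi> b = of_real b2 * v"
            using e(3)[of b y] v(2) xy ac 3 e(1) by (smt (verit))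
          then have vu: "v = u0" using same v(1) e(2) by metis
          have "\<exists>r>0. \<phi> t - \<phi> s = of_real r * u0" if "a \<le> s" "s < t" "t \<le> c" for s t
          proof -
            consider "t \<le> b" | "b \<le> s" | "s < b" "b < t" by linarith
            then show ?thesis
            proof cases
              case 1
              then show ?thesis using u(2) uu that by blast
            next
              case 2
              then show ?thesis using v(2) vu that by blast
            next
              case 3
              obtain r1 r2 where "r1 > 0" "\<phi> b - \<phi> s = of_real r1 * u0" "r2 > 0" "\<phi> t - \<phi> b = of_real r2 * u0"
                using u(2)[rule_format, of s b] v(2)[rule_format, of b t] uu vu 3 \<open>a \<le> s\<close> \<open>t \<le> c\<close> by auto
              then show ?thesis
                by (intro exI[of _ "r1 + r2"]) (auto simp: algebra_simps)
            qed
          qed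
          then show ?thesis using e(2) by blast
        qed
      qed
    next
      case (2 x)
      then obtain e u where e: "e > 0" "cmod u = 1" "\<And>s t. 0 < s \<Longrightarrow> s < t \<Longrightarrow> t \<le> t1 \<Longrightarrow> \<bar>s - x\<bar> < e \<Longrightarrow> \<bar>t - x\<bar> < e \<Longrightarrow> (\<exists>a>0. \<phi> t - \<phi> s = of_real a * u)"
        using loc[of x] a0(1) by (smt (verit))
      show ?case
      proof (intro exI[of _ e] conjI allI impI e(1))
        fix a b assume ab: "a \<le> x \<and> x \<le> b \<and> b - a < e" "0 < a" "b \<le> t1"
        have "?S u a b" using ab by (intro allI impI e(3)) auto
        then show "\<exists>u. cmod u = 1 \<and> ?S u a b" using e(2) by blast
      qed
    qed
    then show ?thesis using a0 by simp
  qed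
  obtain u where u: "cmod u = 1" "?S u s t1" using straight[of s] st by auto
  have all: "?S u a t1" if "0 < a" "a \<le> s" for a
  proof -
    obtain v where v: "cmod v = 1" "?S v a t1" using straight[of a] \<open>0 < a\<close> \<open>a \<le> s\<close> st by auto
    obtain r1 r2 where "r1 > 0" "r2 > 0" "\<phi> t - \<phi> s = of_real r1 * u" "\<phi> t - \<phi> s = of_real r2 * v"
      using u(2)[rule_format, of s t] v(2)[rule_format, of s t] \<open>a \<le> s\<close> st by auto
    then have "u = v" using same u(1) v(1) by metis
    then show ?thesis using v by simp
  qed
  have cnj_u: "u * cnj u = 1" using u(1) complex_norm_square[of u] by simp
  have diff: "\<exists>r>0. (\<phi> y - \<phi> x) * cnj u = of_real r" if "0 < x" "x < y" "y \<le> t1" for x y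
  proof -
    obtain r where "r > 0" "\<phi> y - \<phi> x = of_real r * u"
      using all[of "min x s", rule_format, of x y] \<open>0 < x\<close> \<open>x < y\<close> \<open>y \<le> t1\<close> st by auto
    then show ?thesis using cnj_u by (intro exI[of _ r]) (simp add: mult.assoc)
  qed
  define \<psi> where "\<psi> x = \<phi> x * cnj u" for x
  have diff': "Im (\<psi> y) = Im (\<psi> x)" "Re (\<psi> x) < Re (\<psi> y)" if "0 < x" "x < y" "y \<le> t1" for x y
  proof -
    obtain r where r: "r > 0" "\<psi> y - \<psi> x = of_real r" using diff[OF \<open>0 < x\<close> \<open>x < y\<close> \<open>y \<le> t1\<close>] by (auto simp: \<psi>_def left_diff_distrib)
    from arg_cong[OF r(2), of Im] show "Im (\<psi> y) = Im (\<psi> x)" by simp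
    from arg_cong[OF r(2), of Re] show "Re (\<psi> x) < Re (\<psi> y)" using r(1) by simp
  qed
  have "((\<lambda>x. \<phi> x * cnj u) \<longlongrightarrow> 0 * cnj u) (at_right 0)" by (intro tendsto_mult lim tendsto_const)
  then have lim\<psi>: "(\<psi> \<longlongrightarrow> 0) (at_right 0)" by (simp add: \<psi>_def[abs_def])
  have real: "\<psi> y = of_real (Re (\<psi> y))" "0 \<le> Re (\<psi> y)" if "0 < y" "y \<le> t1" for y
  proof -
    have ev: "\<forall>\<^sub>F x in at_right 0. x \<in> {0<..<y}" using eventually_at_right_real[OF that(1)] by simp
    have "((\<lambda>x. Im (\<psi> x)) \<longlongrightarrow> Im 0) (at_right 0)" by (intro tendsto_Im lim\<psi>)
    moreover have "\<forall>\<^sub>F x in at_right 0. Im (\<psi> x) = Im (\<psi> y)"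
      using ev by eventually_elim (use diff'(1) that in auto)
    ultimately have "((\<lambda>x. Im (\<psi> y)) \<longlongrightarrow> 0) (at_right (0::real))" by (simp add: tendsto_cong)
    then have "Im (\<psi> y) = 0" by (simp add: tendsto_const_iff)
    then show "\<psi> y = of_real (Re (\<psi> y))" by (simp add: complex_eq_iff)
    have "((\<lambda>x. Re (\<psi> x)) \<longlongrightarrow> Re 0) (at_right 0)" by (intro tendsto_Re lim\<psi>)
    moreover have "\<forall>\<^sub>F x in at_right 0. Re (\<psi> x) \<le> Re (\<psi> y)"
      using ev by eventually_elim (use diff'(2) that less_imp_le in auto)
    ultimately show "0 \<le> Re (\<psi> y)"
      using tendsto_upperbound[of "\<lambda>x. Re (\<psi> x)" "Re 0" "at_right 0" "Re (\<psi> y)"] by simp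
  qed
  have norm\<psi>: "cmod (\<psi> x) = cmod (\<phi> x)" for x using u(1) by (simp add: \<psi>_def norm_mult)
  have "cmod (\<phi> t - \<phi> s) = cmod (\<psi> t - \<psi> s)"
    using u(1) by (simp add: \<psi>_def left_diff_distrib[symmetric] norm_mult)
  also have "\<psi> t - \<psi> s = of_real (Re (\<psi> t) - Re (\<psi> s))"
    using real(1)[of t] real(1)[of s] st by simp
  also have "cmod (of_real (Re (\<psi> t) - Re (\<psi> s))) = Re (\<psi> t) - Re (\<psi> s)"
    unfolding norm_of_real using diff'(2)[of s t] st by simp
  also have "\<dots> = cmod (\<psi> t) - cmod (\<psi> s)"
    using real[of t] real[of s] st by (metis abs_of_nonneg norm_of_real less_imp_le order.trans order_less_le_trans)
  finally show ?thesis by (simp add: norm\<psi>)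
qed

section \<open>Trajectories at regular points and at their starting points\<close>

context nonconstant_cubic
begin

lemma straight_in_chart_dist:
  assumes ch: "flat_chart P U w" and st: "straight_in_chart U w \<gamma> \<theta> t0" and t0: "t0 \<in> {0..1}"
    and cont: "continuous_on {0..1} \<gamma>"
  obtains e where "e > 0"
    "\<And>t. t \<in> {0..1} \<Longrightarrow> \<bar>t - t0\<bar> < e \<Longrightarrow> \<gamma> t \<in> U"
    "\<And>s t. s \<in> {0..1} \<Longrightarrow> t \<in> {0..1} \<Longrightarrow> \<bar>s - t0\<bar> < e \<Longrightarrow> \<bar>t - t0\<bar> < e \<Longrightarrow> s < t \<Longrightarrow>
      dP (\<gamma> s) (\<gamma> t) > 0 \<and> w (\<gamma> t) - w (\<gamma> s) = of_real (dP (\<gamma> s) (\<gamma> t)) * cis \<theta>"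
proof -
  obtain e0 where e0: "e0 > 0" "\<gamma> ` (ball t0 e0 \<inter> {0..1}) \<subseteq> U"
    "\<And>s t. s \<in> ball t0 e0 \<inter> {0..1} \<Longrightarrow> t \<in> ball t0 e0 \<inter> {0..1} \<Longrightarrow> s < t \<Longrightarrow>
      \<exists>a>0. w (\<gamma> t) - w (\<gamma> s) = of_real a * cis \<theta>"
    using st unfolding straight_in_chart_def by metis
  have "\<gamma> t0 \<in> U" using e0 t0 by auto
  then obtain r where r: "r > 0" "\<And>x y. x \<in> ball (\<gamma> t0) r \<Longrightarrow> y \<in> ball (\<gamma> t0) r \<Longrightarrow> dP x y = dist (w x) (w y)"
    using flat_chart_isometry[OF ch] by metis
  obtain e1 where e1: "e1 > 0" "\<And>t. t \<in> {0..1} \<Longrightarrow> dist t t0 < e1 \<Longrightarrow> dist (\<gamma> t) (\<gamma> t0) < r"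
    using cont t0 r(1) unfolding continuous_on_iff by metis
  show ?thesis
  proof (rule that[of "min e0 e1"])
    show "min e0 e1 > 0" using e0 e1 by simp
    show "\<gamma> t \<in> U" if "t \<in> {0..1}" "\<bar>t - t0\<bar> < min e0 e1" for t
      using e0(2) that by (auto simp: dist_real_def abs_minus_commute image_subset_iff)
    fix s t assume st: "s \<in> {0..1}" "t \<in> {0..1}" "\<bar>s - t0\<bar> < min e0 e1" "\<bar>t - t0\<bar> < min e0 e1" "s < t"
    obtain a where a: "a > 0" "w (\<gamma> t) - w (\<gamma> s) = of_real a * cis \<theta>"
      using e0(3)[of s t] st by (auto simp: dist_real_def abs_minus_commute)
    have "dP (\<gamma> s) (\<gamma> t) = dist (w (\<gamma> s)) (w (\<gamma> t))"
      using e1(2)[of s] e1(2)[of t] st by (intro r(2)) (auto simp: dist_real_def dist_commute)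
    also have "\<dots> = cmod (w (\<gamma> t) - w (\<gamma> s))" by (simp add: dist_norm norm_minus_commute)
    also have "\<dots> = a" unfolding a(2) using a(1) by (simp add: norm_mult)
    finally show "dP (\<gamma> s) (\<gamma> t) > 0 \<and> w (\<gamma> t) - w (\<gamma> s) = of_real (dP (\<gamma> s) (\<gamma> t)) * cis \<theta>"
      using a by simp
  qed
qed

lemma straight_at_additive:
  assumes "straight_at P \<gamma> \<theta> x" and x: "x \<in> {0..1}" and cont: "continuous_on {0..1} \<gamma>"
  shows "\<exists>e>0. \<exists>h. \<forall>s t. 0 \<le> s \<longrightarrow> s \<le> t \<longrightarrow> t \<le> 1 \<longrightarrow> \<bar>s - x\<bar> < e \<longrightarrow> \<bar>t - x\<bar> < e \<longrightarrow> dP (\<gamma> s) (\<gamma> t) = h t - h s"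
proof -
  obtain U w where "flat_chart P U w" "straight_in_chart U w \<gamma> \<theta> x" using assms(1) unfolding straight_at_def by blast
  then obtain e where e: "e > 0" "\<And>s t. s \<in> {0..1} \<Longrightarrow> t \<in> {0..1} \<Longrightarrow> \<bar>s - x\<bar> < e \<Longrightarrow> \<bar>t - x\<bar> < e \<Longrightarrow> s < t \<Longrightarrow>
      dP (\<gamma> s) (\<gamma> t) > 0 \<and> w (\<gamma> t) - w (\<gamma> s) = of_real (dP (\<gamma> s) (\<gamma> t)) * cis \<theta>"
    using straight_in_chart_dist[OF _ _ x cont] by metis
  define h where "h t = Re (w (\<gamma> t) * cnj (cis \<theta>))" for t
  have "dP (\<gamma> s) (\<gamma> t) = h t - h s" if st: "0 \<le> s" "s \<le> t" "t \<le> 1" "\<bar>s - x\<bar> < e" "\<bar>t - x\<bar> < e" for s t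
  proof (cases "s = t")
    case False
    have "h t - h s = Re ((w (\<gamma> t) - w (\<gamma> s)) * cnj (cis \<theta>))" by (simp add: h_def left_diff_distrib)
    also have "w (\<gamma> t) - w (\<gamma> s) = of_real (dP (\<gamma> s) (\<gamma> t)) * cis \<theta>" using e(2)[of s t] st False by auto
    also have "Re (of_real (dP (\<gamma> s) (\<gamma> t)) * cis \<theta> * cnj (cis \<theta>)) = dP (\<gamma> s) (\<gamma> t)"
      by (simp add: mult.assoc cis_cnj cis_mult)
    finally show ?thesis by simp
  qed (simp add: d_self)
  then show ?thesis using e(1) by blast
qed

text \<open>
  Near the starting point, the multivalued coordinate \<open>\<zeta>\<^bsup>\<kappa>\<^esup>\<close> of a cone chart, continued along the
  curve, maps the curve to a straight curve that starts at the origin.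
\<close>

lemma start_additive:
  assumes cont: "continuous_on {0..1} \<gamma>" and inj: "inj_on \<gamma> {0..1}"
    and st: "\<And>t. 0 < t \<Longrightarrow> t < 1 \<Longrightarrow> \<exists>\<theta>. straight_at P \<gamma> \<theta> t"
  shows "\<exists>e>0. \<exists>h. \<forall>s t. 0 \<le> s \<longrightarrow> s \<le> t \<longrightarrow> t \<le> 1 \<longrightarrow> \<bar>s - 0\<bar> < e \<longrightarrow> \<bar>t - 0\<bar> < e \<longrightarrow> dP (\<gamma> s) (\<gamma> t) = h t - h s"
proof -
  let ?a = "\<gamma> 0"
  obtain e0 \<kappa> \<zeta> m where ch: "flat.cone_chart ?a e0 \<kappa> \<zeta>" and \<kappa>m: "\<kappa> = (real m + 3) / 3"
    and nf: "\<And>z. z \<in> ball ?a e0 \<Longrightarrow> of_real \<kappa> ^ 3 * deriv \<zeta> z ^ 3 * \<zeta> z ^ m = poly P z"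
    using cone_chart_exists[OF P_nonzero, of ?a] by metis
  have \<kappa>: "\<kappa> > 0" by (simp add: \<kappa>m)
  have hol: "\<zeta> holomorphic_on ball ?a e0" and e00: "e0 > 0" and \<zeta>0: "\<zeta> ?a = 0"
    using ch by (auto simp: flat.cone_chart_def)
  obtain r where r: "r > 0" "\<And>x. dP ?a x < r \<Longrightarrow> x \<in> ball ?a e0"
    "\<And>x y. dP ?a x < r \<Longrightarrow> dP ?a y < r \<Longrightarrow> dP x y = cone_dist \<kappa> (\<zeta> x) (\<zeta> y)"
    using flat.cone_chart_isometry[OF ch] by metis
  have rad: "dP ?a x = cmod (\<zeta> x) powr \<kappa>" if "dP ?a x < r" for x
    using r(3)[OF _ that, of ?a] r(1) by (simp add: d_self \<zeta>0 cone_dist_0[OF \<kappa>])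
  have "continuous_on {0..1} (\<lambda>t. dP ?a (\<gamma> t))"
    by (rule continuous_on_compose2[OF flat.continuous_on_d[of UNIV] cont]) auto
  then obtain e1 where e1: "e1 > 0" "\<And>t. t \<in> {0..1} \<Longrightarrow> dist t 0 < e1 \<Longrightarrow> dist (dP ?a (\<gamma> t)) (dP ?a (\<gamma> 0)) < r"
    unfolding continuous_on_iff using r(1) by (metis atLeastAtMost_iff order_refl zero_le_one)
  define t1 where "t1 = min (1 / 2) (e1 / 2)"
  have t1: "0 < t1" "t1 < 1" "t1 < e1" using e1(1) by (auto simp: t1_def)
  have near: "dP ?a (\<gamma> t) < r" if "0 \<le> t" "t \<le> t1" for t
    using e1(2)[of t] that t1 d_nonneg[of ?a "\<gamma> t"] by (simp add: d_self dist_real_def)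
  have in_ball: "\<gamma> t \<in> ball ?a e0" if "0 \<le> t" "t \<le> t1" for t by (rule r(2)[OF near[OF that]])
  have ne: "\<gamma> t \<noteq> ?a" if "0 < t" "t \<le> t1" for t
    using inj_onD[OF inj, of t 0] that t1 by auto
  define f where "f t = \<zeta> (\<gamma> t)" for t
  have f0: "f t \<noteq> 0" if "0 < t" "t \<le> t1" for t
    unfolding f_def using in_ball[of t] ne[OF that] that by (intro flat.cone_chart_pos(1)[OF ch]) auto
  have cf: "continuous_on {0..t1} f" unfolding f_def
    by (rule continuous_on_compose2[OF holomorphic_on_imp_continuous_on[OF hol]])
      (use in_ball t1 in \<open>auto intro!: continuous_on_subset[OF cont]\<close>)
  \<comment> \<open>The curve might wind around the starting point, so no fixed branch of the power
    serves; a continuous logarithm along the curve provides the continuation.\<close>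
  obtain L where L: "continuous_on {0<..t1} L" "\<And>t. t \<in> {0<..t1} \<Longrightarrow> f t = exp (L t)"
  proof (rule continuous_logarithm_on_contractible[of "{0<..t1}" f])
    show "continuous_on {0<..t1} f" using cf by (rule continuous_on_subset) auto
    show "contractible {0<..t1}" by (intro convex_imp_contractible convex_real_interval)
  qed (use f0 in auto)
  define W where "W t = exp (of_real \<kappa> * L t)" for t
  have normW: "cmod (W t) = dP ?a (\<gamma> t)" if "0 < t" "t \<le> t1" for t
  proof -
    have "cmod (f t) = exp (Re (L t))" using L(2)[of t] that by simp
    then have "cmod (f t) powr \<kappa> = exp (\<kappa> * Re (L t))" by (simp add: powr_def)
    then show ?thesis using rad[OF near, of t] that by (simp add: W_def f_def)
  qed
  have local: "\<exists>e>0. \<exists>u. cmod u = 1 \<and> (\<forall>s t. 0 < s \<longrightarrow> s < t \<longrightarrow> t \<le> t1 \<longrightarrow> \<bar>s - t0\<bar> < e \<longrightarrow> \<bar>t - t0\<bar> < e \<longrightarrow>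
      dP (\<gamma> s) (\<gamma> t) > 0 \<and> W t - W s = of_real (dP (\<gamma> s) (\<gamma> t)) * u)" if t0: "0 < t0" "t0 \<le> t1" for t0
  proof -
    obtain \<theta> U w where ch': "flat_chart P U w" and stc: "straight_in_chart U w \<gamma> \<theta> t0"
      using st[of t0] t0 t1 unfolding straight_at_def by auto
    have t00: "t0 \<in> {0..1}" using t0 t1 by simp
    obtain e2 where e2: "e2 > 0" "\<And>t. t \<in> {0..1} \<Longrightarrow> \<bar>t - t0\<bar> < e2 \<Longrightarrow> \<gamma> t \<in> U"
      "\<And>s t. s \<in> {0..1} \<Longrightarrow> t \<in> {0..1} \<Longrightarrow> \<bar>s - t0\<bar> < e2 \<Longrightarrow> \<bar>t - t0\<bar> < e2 \<Longrightarrow> s < t \<Longrightarrow>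
      dP (\<gamma> s) (\<gamma> t) > 0 \<and> w (\<gamma> t) - w (\<gamma> s) = of_real (dP (\<gamma> s) (\<gamma> t)) * cis \<theta>"
      using straight_in_chart_dist[OF ch' stc t00 cont] by metis
    let ?z = "\<gamma> t0"
    have z: "?z \<in> U" "?z \<in> ball ?a e0" "f t0 \<noteq> 0" using e2(2)[of t0] e2(1) in_ball f0 t0 t1 by auto
    have U: "open U" "w holomorphic_on U" "\<And>z. z \<in> U \<Longrightarrow> deriv w z ^ 3 = poly P z" "\<And>z. z \<in> U \<Longrightarrow> poly P z \<noteq> 0"
      using ch' by (auto simp: flat_chart_def)
    have "isCont \<zeta> ?z" using holomorphic_on_imp_continuous_on[OF hol] z(2) by (simp add: continuous_on_eq_continuous_at)
    then obtain e3 where e3: "e3 > 0" "\<And>z. z \<in> ball ?z e3 \<Longrightarrow> Re (\<zeta> z / \<zeta> ?z) > 0"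
      using ball_Re_ratio_pos[where f = \<zeta>] z(3) unfolding f_def by metis
    have "open (U \<inter> ball ?a e0)" "?z \<in> U \<inter> ball ?a e0" using U(1) z by auto
    then obtain e4 where e4: "e4 > 0" "ball ?z e4 \<subseteq> U \<inter> ball ?a e0" by (meson open_contains_ball)
    define e5 where "e5 = min e3 e4"
    have e5: "e5 > 0" "ball ?z e5 \<subseteq> U" "ball ?z e5 \<subseteq> ball ?a e0" "\<And>z. z \<in> ball ?z e5 \<Longrightarrow> Re (\<zeta> z / \<zeta> ?z) > 0"
      using e3 e4 by (auto simp: e5_def)
    \<comment> \<open>A branch of the developed coordinate near \<open>\<gamma> t0\<close> that
      agrees with \<open>W\<close> along the curve. The cube of its derivative is \<open>P\<close>,
      so it differs from the flat chart \<open>w\<close> by a cube root of unity and a constant, and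
      turns straight pieces into straight pieces.\<close>
    define V where "V z = exp (of_real \<kappa> * (L t0 + Ln (\<zeta> z / \<zeta> ?z)))" for z
    have derV: "(V has_field_derivative V z * (of_real \<kappa> * (deriv \<zeta> z / \<zeta> z))) (at z)" if zz: "z \<in> ball ?z e5" for z
    proof -
      have "(\<zeta> has_field_derivative deriv \<zeta> z) (at z)"
        using zz e5(3) by (intro holomorphic_derivI[OF hol]) auto
      moreover have "\<zeta> z / \<zeta> ?z \<notin> \<real>\<^sub>\<le>\<^sub>0" using e5(4)[OF zz] by (force simp: complex_nonpos_Reals_iff)
      moreover have "\<zeta> z \<noteq> 0" using e5(4)[OF zz] by auto
      ultimately show ?thesis unfolding V_def using z(3)
        by (auto intro!: derivative_eq_intros simp: f_def)
    qed
    have V3: "deriv V z ^ 3 = poly P z" if zz: "z \<in> ball ?z e5" for z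
    proof -
      have \<zeta>z: "\<zeta> z \<noteq> 0" using e5(4)[OF zz] by auto
      have "exp (L t0 + Ln (\<zeta> z / \<zeta> ?z)) = \<zeta> z"
        using \<zeta>z z(3) L(2)[of t0] t0 by (simp add: exp_add f_def)
      moreover have "V z ^ 3 = exp (of_nat (m + 3) * (L t0 + Ln (\<zeta> z / \<zeta> ?z)))"
      proof -
        have "of_nat 3 * (of_real \<kappa> * (L t0 + Ln (\<zeta> z / \<zeta> ?z))) = of_nat (m + 3) * (L t0 + Ln (\<zeta> z / \<zeta> ?z))"
          by (simp add: \<kappa>m field_simps)
        then show ?thesis unfolding V_def by (metis exp_of_nat_mult)
      qed
      ultimately have V3: "V z ^ 3 = \<zeta> z ^ (m + 3)" by (simp only: exp_of_nat_mult)
      have "deriv V z ^ 3 = V z ^ 3 * of_real \<kappa> ^ 3 * (deriv \<zeta> z ^ 3 / \<zeta> z ^ 3)"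
        using DERIV_imp_deriv[OF derV[OF zz]] by (simp add: power_mult_distrib power_divide)
      also have "\<dots> = of_real \<kappa> ^ 3 * deriv \<zeta> z ^ 3 * \<zeta> z ^ m" unfolding V3 using \<zeta>z by (simp add: power_add)
      also have "\<dots> = poly P z" using nf zz e5(3) by auto
      finally show ?thesis .
    qed
    obtain \<omega> where \<omega>: "\<omega> ^ 3 = 1" "\<And>x y. x \<in> ball ?z e5 \<Longrightarrow> y \<in> ball ?z e5 \<Longrightarrow> V x - V y = \<omega> * (w x - w y)"
    proof (rule cube_derivatives_eq[of V ?z e5 w])
      show "V holomorphic_on ball ?z e5"
        unfolding holomorphic_on_open[OF open_ball] using derV by blast
      show "w holomorphic_on ball ?z e5" using U(2) e5(2) holomorphic_on_subset by blast
      show "deriv V z ^ 3 = deriv w z ^ 3" if "z \<in> ball ?z e5" for z using V3[OF that] U(3) e5(2) that by auto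
      show "deriv w z \<noteq> 0" if "z \<in> ball ?z e5" for z
        using U(3,4) e5(2) that by (metis power_zero_numeral subsetD)
    qed (use e5(1) in auto)
    have t01: "t0 \<in> {0<..t1}" using t0 by simp
    \<comment> \<open>Keeps the imaginary part of \<open>L t - L t0\<close> within
      \<open>pi\<close>, so that the principal logarithm in \<open>V\<close> recovers this
      difference.\<close>
    obtain e6 where e6: "e6 > 0" "\<And>t. t \<in> {0<..t1} \<Longrightarrow> dist t t0 < e6 \<Longrightarrow> dist (L t) (L t0) < pi"
      using L(1) t01 unfolding continuous_on_iff by (metis pi_gt_zero)
    obtain e7 where e7: "e7 > 0" "\<And>t. t \<in> {0..1} \<Longrightarrow> dist t t0 < e7 \<Longrightarrow> dist (\<gamma> t) ?z < e5"
      using cont e5(1) t00 unfolding continuous_on_iff by metis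
    have WV: "W t = V (\<gamma> t)" "\<gamma> t \<in> ball ?z e5" if t: "0 < t" "t \<le> t1" "\<bar>t - t0\<bar> < min e6 e7" for t
    proof -
      have "\<bar>Im (L t - L t0)\<bar> < pi"
        using e6(2)[of t] abs_Im_le_cmod[of "L t - L t0"] t by (auto simp: dist_real_def dist_norm)
      then have "Ln (exp (L t - L t0)) = L t - L t0" by (intro Ln_exp) auto
      moreover have "exp (L t - L t0) = \<zeta> (\<gamma> t) / \<zeta> ?z"
        using L(2)[of t] L(2)[of t0] t t0 by (simp add: exp_diff f_def[symmetric])
      ultimately show "W t = V (\<gamma> t)" by (simp add: W_def V_def)
      show "\<gamma> t \<in> ball ?z e5" using e7(2)[of t] t t1 by (simp add: dist_real_def dist_commute)
    qed
    have "cmod \<omega> = 1" using \<omega>(1) by (metis norm_power norm_one power_eq_1_iff norm_ge_zero zero_neq_numeral)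
    moreover have "dP (\<gamma> s) (\<gamma> t) > 0 \<and> W t - W s = of_real (dP (\<gamma> s) (\<gamma> t)) * (\<omega> * cis \<theta>)"
      if s: "0 < s" "s < t" "t \<le> t1" "\<bar>s - t0\<bar> < min e2 (min e6 e7)" "\<bar>t - t0\<bar> < min e2 (min e6 e7)" for s t
      using e2(3)[of s t] WV[of s] WV[of t] \<omega>(2)[of "\<gamma> t" "\<gamma> s"] s t1 by auto
    ultimately show ?thesis
      using e2(1) e6(1) e7(1) by (intro exI[of _ "min e2 (min e6 e7)"] conjI exI[of _ "\<omega> * cis \<theta>"]) (auto simp: norm_mult)
  qed
  have limW: "(W \<longlongrightarrow> 0) (at_right 0)"
  proof -
    have cd: "continuous_on {0..t1} (\<lambda>t. dP ?a (\<gamma> t))"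
      using \<open>continuous_on {0..1} (\<lambda>t. dP ?a (\<gamma> t))\<close> t1 by (rule_tac continuous_on_subset) auto
    have "((\<lambda>t. dP ?a (\<gamma> t)) \<longlongrightarrow> dP ?a (\<gamma> 0)) (at_right 0)"
      using continuous_on_Icc_at_rightD[OF cd t1(1)] .
    moreover have "\<forall>\<^sub>F t in at_right 0. cmod (W t) = dP ?a (\<gamma> t)"
      using eventually_at_right_real[OF t1(1)] by eventually_elim (use normW in auto)
    ultimately have "((\<lambda>t. cmod (W t)) \<longlongrightarrow> 0) (at_right 0)" by (simp add: tendsto_cong d_self)
    then show ?thesis by (rule tendsto_norm_zero_cancel)
  qed
  have W_add: "cmod (W t - W s) = dP ?a (\<gamma> t) - dP ?a (\<gamma> s)" if "0 < s" "s < t" "t \<le> t1" for s t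
  proof -
    have "cmod (W t - W s) = cmod (W t) - cmod (W s)"
    proof (rule locally_straight_from_origin[OF _ limW that])
      show "\<exists>e>0. \<exists>u. cmod u = 1 \<and> (\<forall>s t. 0 < s \<longrightarrow> s < t \<longrightarrow> t \<le> t1 \<longrightarrow> \<bar>s - t0\<bar> < e \<longrightarrow> \<bar>t - t0\<bar> < e \<longrightarrow>
        (\<exists>a>0. W t - W s = of_real a * u))" if t0: "0 < t0" "t0 \<le> t1" for t0
        using local[OF t0] by blast
    qed
    then show ?thesis using normW[of t] normW[of s] that by simp
  qed
  define h where "h t = dP ?a (\<gamma> t)" for t
  \<comment> \<open>Locally the distance is the norm of an increment of \<open>W\<close>, hence an
    increment of \<open>h\<close>; adding up gives the upper bound. The lower bound is the triangle
    inequality with the starting point.\<close>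
  have le: "dP (\<gamma> s) (\<gamma> t) \<le> h t - h s" if st: "0 < s" "s \<le> t" "t \<le> t1" for s t
  proof -
    let ?P = "\<lambda>a b. s \<le> a \<longrightarrow> b \<le> t \<longrightarrow> dP (\<gamma> a) (\<gamma> b) \<le> h b - h a"
    have "?P s t"
    proof (rule Bolzano[where P = ?P, OF st(2)], goal_cases)
      case (1 x y z)
      then show ?case using d_triangle[of "\<gamma> x" "\<gamma> z" "\<gamma> y"] by auto
    next
      case (2 x)
      then have "0 < x" "x \<le> t1" using st by auto
      then obtain e u where e: "e > 0" "cmod u = 1" "\<And>s t. 0 < s \<Longrightarrow> s < t \<Longrightarrow> t \<le> t1 \<Longrightarrow> \<bar>s - x\<bar> < e \<Longrightarrow> \<bar>t - x\<bar> < e \<Longrightarrow>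
        dP (\<gamma> s) (\<gamma> t) > 0 \<and> W t - W s = of_real (dP (\<gamma> s) (\<gamma> t)) * u"
        using local[of x] by metis
      show ?case
      proof (intro exI[of _ e] conjI allI impI e(1))
        fix a b assume ab: "a \<le> x \<and> x \<le> b \<and> b - a < e" "s \<le> a" "b \<le> t"
        show "dP (\<gamma> a) (\<gamma> b) \<le> h b - h a"
        proof (cases "a = b")
          case False
          then have "W b - W a = of_real (dP (\<gamma> a) (\<gamma> b)) * u" using e(3)[of a b] ab st by auto
          then have "cmod (W b - W a) = dP (\<gamma> a) (\<gamma> b)" using e(2) d_nonneg by (simp add: norm_mult)
          then show ?thesis using W_add[of a b] ab st False by (simp add: h_def)
        qed (simp add: d_self)
      qed
    qed
    then show ?thesis by simp
  qed
  have "dP (\<gamma> s) (\<gamma> t) = h t - h s" if st: "0 \<le> s" "s \<le> t" "t \<le> t1" for s t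
  proof (cases "s = 0")
    case False
    then show ?thesis using le[of s t] d_triangle[of ?a "\<gamma> t" "\<gamma> s"] st by (simp add: h_def)
  qed (simp add: h_def d_self)
  then show ?thesis using t1(1) by (intro exI[of _ t1] conjI exI[of _ h]) auto
qed

section \<open>Critical tripods\<close>

text \<open>Parametrization by arc length, reversed so that it emanates from the point where the
  legs meet; this also accounts for the sign of the direction. Injectivity of the arc makes
  \<open>\<sigma>\<close> strictly increasing, hence invertible.\<close>

lemma trajectory_parameter:
  assumes \<gamma>: "trajectory P \<gamma>" and ch: "flat_chart P U w" and st: "straight_in_chart U w \<gamma> \<theta> 1"
  obtains L c where "unit_speed c L" "c 0 = \<gamma> 1" "c L = \<gamma> 0" "c ` {0..L} = path_image \<gamma>"
    "\<exists>s>0. \<forall>u. 0 \<le> u \<longrightarrow> u < s \<longrightarrow> w (c u) = w (\<gamma> 1) - of_real u * cis \<theta>"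
proof -
  have cont: "continuous_on {0..1} \<gamma>" and inj: "inj_on \<gamma> {0..1}"
    using \<gamma> by (auto simp: trajectory_def arc_def path_def)
  have st_in: "\<exists>\<theta>. straight_at P \<gamma> \<theta> t" if "0 < t" "t < 1" for t
    using \<gamma> that by (auto simp: trajectory_def)
  have add: "\<exists>e>0. \<exists>h. \<forall>s t. 0 \<le> s \<longrightarrow> s \<le> t \<longrightarrow> t \<le> 1 \<longrightarrow> \<bar>s - x\<bar> < e \<longrightarrow> \<bar>t - x\<bar> < e \<longrightarrow> dP (\<gamma> s) (\<gamma> t) = h t - h s"
    if x: "x \<in> {0..1}" for x
  proof -
    consider "x = 0" | "0 < x" "x < 1" | "x = 1" using x by force
    then show ?thesis
    proof cases
      case 1
      then show ?thesis using start_additive[OF cont inj st_in] by simp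
    next
      case 2
      then show ?thesis using st_in[OF 2] straight_at_additive[OF _ x cont] by blast
    next
      case 3
      then have "straight_at P \<gamma> \<theta> x" using ch st unfolding straight_at_def by blast
      then show ?thesis by (rule straight_at_additive[OF _ x cont])
    qed
  qed
  obtain \<sigma> \<delta> where \<sigma>: "\<delta> > 0" "\<And>s t. 0 \<le> s \<Longrightarrow> s \<le> t \<Longrightarrow> t \<le> 1 \<Longrightarrow> t - s < \<delta> \<Longrightarrow> dP (\<gamma> s) (\<gamma> t) = \<sigma> t - (\<sigma> s :: real)"
    using arc_length_parameter[OF add] by metis
  have mono: "\<sigma> s < \<sigma> t" if "0 \<le> s" "s < t" "t \<le> 1" for s t
  proof -
    let ?P = "\<lambda>a b. 0 \<le> a \<longrightarrow> b \<le> 1 \<longrightarrow> a < b \<longrightarrow> \<sigma> a < \<sigma> b"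
    have "?P s t"
    proof (rule Bolzano[where P = ?P, OF less_imp_le[OF that(2)]], goal_cases)
      case (1 a b c)
      then show ?case by (cases "a = b"; cases "b = c") auto
    next
      case (2 x)
      show ?case
      proof (intro exI[of _ \<delta>] conjI allI impI \<sigma>(1))
        fix a b assume ab: "a \<le> x \<and> x \<le> b \<and> b - a < \<delta>" "0 \<le> a" "b \<le> 1" "a < b"
        then have "\<gamma> a \<noteq> \<gamma> b" using inj_onD[OF inj, of a b] by auto
        then have "0 < dP (\<gamma> a) (\<gamma> b)" using d_eq_0D d_nonneg by (metis less_le)
        then show "\<sigma> a < \<sigma> b" using \<sigma>(2)[of a b] ab by auto
      qed
    qed
    then show ?thesis using that by simp
  qed
  have c\<sigma>: "continuous_on {0..1} \<sigma>"
    unfolding continuous_on_iff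
  proof (intro ballI allI impI)
    fix x e :: real assume x: "x \<in> {0..1}" and "e > 0"
    have "continuous_on {0..1} (\<lambda>t. dP (\<gamma> x) (\<gamma> t))"
      by (rule continuous_on_compose2[OF flat.continuous_on_d[of UNIV] cont]) auto
    then obtain h where h: "h > 0" "\<And>t. t \<in> {0..1} \<Longrightarrow> dist t x < h \<Longrightarrow> dist (dP (\<gamma> x) (\<gamma> t)) (dP (\<gamma> x) (\<gamma> x)) < e"
      unfolding continuous_on_iff using x \<open>e > 0\<close> by metis
    show "\<exists>h>0. \<forall>t\<in>{0..1}. dist t x < h \<longrightarrow> dist (\<sigma> t) (\<sigma> x) < e"
    proof (intro exI[of _ "min h \<delta>"] conjI ballI impI)
      show "min h \<delta> > 0" using h(1) \<sigma>(1) by simp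
      fix t :: real assume t: "t \<in> {0..1}" "dist t x < min h \<delta>"
      then have "dP (\<gamma> x) (\<gamma> t) < e" using h(2)[of t] d_nonneg[of "\<gamma> x" "\<gamma> t"] by (simp add: d_self dist_real_def)
      moreover have "\<bar>\<sigma> t - \<sigma> x\<bar> = dP (\<gamma> x) (\<gamma> t)"
      proof (cases "x \<le> t")
        case True
        then have "dP (\<gamma> x) (\<gamma> t) = \<sigma> t - \<sigma> x" using t x by (intro \<sigma>(2)) (auto simp: dist_real_def)
        then show ?thesis using d_nonneg[of "\<gamma> x" "\<gamma> t"] by simp
      next
        case False
        then have "dP (\<gamma> t) (\<gamma> x) = \<sigma> x - \<sigma> t" using t x by (intro \<sigma>(2)) (auto simp: dist_real_def)
        then show ?thesis using d_nonneg[of "\<gamma> t" "\<gamma> x"] by (simp add: d_sym[of "\<gamma> x"] abs_minus_commute)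
      qed
      ultimately show "dist (\<sigma> t) (\<sigma> x) < e" by (simp add: dist_real_def)
    qed
  qed
  have mono_le: "\<sigma> s \<le> \<sigma> t" if "0 \<le> s" "s \<le> t" "t \<le> 1" for s t
    using mono[of s t] that by (cases "s = t") auto
  have inj\<sigma>: "inj_on \<sigma> {0..1}"
    using mono by (intro linorder_inj_onI) (force simp: less_le)+
  have image: "\<sigma> ` {0..1} = {\<sigma> 0..\<sigma> 1}"
  proof
    show "\<sigma> ` {0..1} \<subseteq> {\<sigma> 0..\<sigma> 1}" using mono_le by auto
    show "{\<sigma> 0..\<sigma> 1} \<subseteq> \<sigma> ` {0..1}"
      using IVT'[of \<sigma> 0 _ 1] c\<sigma> by fastforce
  qed
  define \<tau> where "\<tau> = the_inv_into {0..1} \<sigma>"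
  have c\<tau>: "continuous_on {\<sigma> 0..\<sigma> 1} \<tau>"
    unfolding \<tau>_def image[symmetric] by (intro continuous_on_inv_into c\<sigma> inj\<sigma> compact_Icc)
  have \<tau>01: "\<tau> v \<in> {0..1}" "\<sigma> (\<tau> v) = v" if "v \<in> {\<sigma> 0..\<sigma> 1}" for v
    unfolding \<tau>_def using that image the_inv_into_into[OF inj\<sigma>, of v "{0..1}"] f_the_inv_into_f[OF inj\<sigma>, of v] by auto
  have \<tau>\<sigma>: "\<tau> (\<sigma> t) = t" if "t \<in> {0..1}" for t
    unfolding \<tau>_def by (rule the_inv_into_f_f[OF inj\<sigma> that])
  define L where "L = \<sigma> 1 - \<sigma> 0"
  have L: "L > 0" using mono[of 0 1] by (simp add: L_def)
  define c where "c u = \<gamma> (\<tau> (\<sigma> 1 - u))" for u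
  have range: "\<sigma> 1 - u \<in> {\<sigma> 0..\<sigma> 1}" if "u \<in> {0..L}" for u using that by (auto simp: L_def)
  \<comment> \<open>Additivity is known for parameters of the arc closer than
    \<open>\<delta>\<close>; uniform continuity of the inverse expresses this in arc length.\<close>
  have "uniformly_continuous_on {\<sigma> 0..\<sigma> 1} \<tau>" using c\<tau> by (intro compact_uniformly_continuous compact_Icc)
  then obtain \<delta>2 where \<delta>2: "\<delta>2 > 0" "\<And>x y. x \<in> {\<sigma> 0..\<sigma> 1} \<Longrightarrow> y \<in> {\<sigma> 0..\<sigma> 1} \<Longrightarrow> dist x y < \<delta>2 \<Longrightarrow> dist (\<tau> x) (\<tau> y) < \<delta>"
    unfolding uniformly_continuous_on_def using \<sigma>(1) by metis
  have dc: "dP (c u) (c v) = v - u" if uv: "u \<in> {0..L}" "v \<in> {0..L}" "\<bar>u - v\<bar> < \<delta>2" "u \<le> v" for u v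
  proof -
    have \<tau>le: "\<tau> (\<sigma> 1 - v) \<le> \<tau> (\<sigma> 1 - u)"
    proof (rule ccontr)
      assume "\<not> \<tau> (\<sigma> 1 - v) \<le> \<tau> (\<sigma> 1 - u)"
      then have "\<sigma> (\<tau> (\<sigma> 1 - u)) < \<sigma> (\<tau> (\<sigma> 1 - v))" using mono \<tau>01(1)[OF range[OF uv(1)]] \<tau>01(1)[OF range[OF uv(2)]] by auto
      then show False using \<tau>01(2)[OF range[OF uv(1)]] \<tau>01(2)[OF range[OF uv(2)]] uv(4) by simp
    qed
    have "dist (\<tau> (\<sigma> 1 - v)) (\<tau> (\<sigma> 1 - u)) < \<delta>"
      using uv by (intro \<delta>2(2) range) (auto simp: dist_real_def)
    then have "dP (c v) (c u) = \<sigma> (\<tau> (\<sigma> 1 - u)) - \<sigma> (\<tau> (\<sigma> 1 - v))"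
      unfolding c_def using \<tau>le \<tau>01(1)[OF range[OF uv(1)]] \<tau>01(1)[OF range[OF uv(2)]]
      by (intro \<sigma>(2)) (auto simp: dist_real_def)
    then show ?thesis using \<tau>01(2)[OF range[OF uv(1)]] \<tau>01(2)[OF range[OF uv(2)]] by (simp add: d_sym[of "c v"])
  qed
  have us: "unit_speed c L" unfolding unit_speed_def
  proof (intro conjI exI[of _ \<delta>2] ballI impI L \<delta>2(1))
    fix u v assume uv: "u \<in> {0..L}" "v \<in> {0..L}" "\<bar>u - v\<bar> < \<delta>2"
    show "dP (c u) (c v) = \<bar>u - v\<bar>"
    proof (cases "u \<le> v")
      case True
      then show ?thesis using dc[OF uv] by simp
    next
      case False
      then have "dP (c v) (c u) = u - v" using uv by (intro dc) auto
      then show ?thesis using False d_sym[of "c u" "c v"] by simp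
    qed
  qed
  have near_end: "\<exists>e>0. \<forall>s\<in>{0..1}. \<bar>s - x\<bar> < e \<longrightarrow> s < x \<longrightarrow> w (\<gamma> x) - w (\<gamma> s) = of_real (dP (\<gamma> s) (\<gamma> x)) * cis \<theta>"
    if "x \<in> {0..1}" "straight_in_chart U w \<gamma> \<theta> x" for x
  proof (rule straight_in_chart_dist[OF ch that(2,1) cont])
    fix e :: real assume "e > 0" and near: "\<And>s t. s \<in> {0..1} \<Longrightarrow> t \<in> {0..1} \<Longrightarrow> \<bar>s - x\<bar> < e \<Longrightarrow> \<bar>t - x\<bar> < e \<Longrightarrow> s < t \<Longrightarrow>
      dP (\<gamma> s) (\<gamma> t) > 0 \<and> w (\<gamma> t) - w (\<gamma> s) = of_real (dP (\<gamma> s) (\<gamma> t)) * cis \<theta>"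
    then show ?thesis using near[of _ x] that(1) by (intro exI[of _ e]) auto
  qed
  obtain e where e: "e > 0"
    "\<And>s. s \<in> {0..1} \<Longrightarrow> \<bar>s - 1\<bar> < e \<Longrightarrow> s < 1 \<Longrightarrow> w (\<gamma> 1) - w (\<gamma> s) = of_real (dP (\<gamma> s) (\<gamma> 1)) * cis \<theta>"
    using near_end[of 1] st by auto
  have "\<sigma> 1 \<in> {\<sigma> 0..\<sigma> 1}" using mono[of 0 1] by simp
  then obtain \<delta>3 where \<delta>3: "\<delta>3 > 0" "\<And>v. v \<in> {\<sigma> 0..\<sigma> 1} \<Longrightarrow> dist v (\<sigma> 1) < \<delta>3 \<Longrightarrow> dist (\<tau> v) (\<tau> (\<sigma> 1)) < e"
    using c\<tau> e(1) unfolding continuous_on_iff by metis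
  have c0: "c 0 = \<gamma> 1" "c L = \<gamma> 0" by (simp_all add: c_def L_def \<tau>\<sigma>)
  show ?thesis
  proof (rule that[OF us c0])
    show "c ` {0..L} = path_image \<gamma>"
    proof
      show "c ` {0..L} \<subseteq> path_image \<gamma>" using \<tau>01(1)[OF range] by (auto simp: c_def path_image_def)
      show "path_image \<gamma> \<subseteq> c ` {0..L}"
      proof
        fix z assume "z \<in> path_image \<gamma>"
        then obtain t where t: "t \<in> {0..1}" "z = \<gamma> t" by (auto simp: path_image_def)
        then have "z = c (\<sigma> 1 - \<sigma> t)" by (simp add: c_def \<tau>\<sigma>)
        moreover have "\<sigma> 1 - \<sigma> t \<in> {0..L}" using mono_le[of t 1] mono_le[of 0 t] t by (auto simp: L_def)
        ultimately show "z \<in> c ` {0..L}" by blast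
      qed
    qed
    show "\<exists>s>0. \<forall>u. 0 \<le> u \<longrightarrow> u < s \<longrightarrow> w (c u) = w (\<gamma> 1) - of_real u * cis \<theta>"
    proof (intro exI[of _ "min L (min \<delta>2 \<delta>3)"] conjI allI impI)
      show "min L (min \<delta>2 \<delta>3) > 0" using L \<delta>2(1) \<delta>3(1) by simp
      fix u assume u: "0 \<le> u" "u < min L (min \<delta>2 \<delta>3)"
      show "w (c u) = w (\<gamma> 1) - of_real u * cis \<theta>"
      proof (cases "u = 0")
        case False
        let ?t = "\<tau> (\<sigma> 1 - u)"
        have uL: "u \<in> {0..L}" using u by auto
        have t: "?t \<in> {0..1}" "\<sigma> ?t = \<sigma> 1 - u" using \<tau>01[OF range[OF uL]] by auto
        then have "?t \<noteq> 1" using False by auto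
        then have "?t < 1" using t(1) by auto
        moreover have "dist ?t 1 < e" using \<delta>3(2)[OF range[OF uL]] u \<tau>\<sigma>[of 1] by (simp add: dist_real_def)
        ultimately have "w (\<gamma> 1) - w (c u) = of_real (dP (c u) (c 0)) * cis \<theta>"
          using e(2)[of ?t] t(1) unfolding c0 c_def[of u] by (auto simp: dist_real_def)
        moreover have "dP (c u) (c 0) = u" using dc[of 0 u] u L by (simp add: d_sym[of "c u"])
        ultimately show ?thesis by (simp add: algebra_simps)
      qed (simp add: c0)
    qed
  qed
qed

text \<open>In the flat chart the points at distance \<open>x\<close> on the legs are
  \<open>w p + x * e k\<close>, with barycentre \<open>w p\<close>. Straight segments of the chart
  lift to the two local geodesics.\<close>

lemma balanced_from_chart:
  assumes ch: "flat_chart P U w" and p: "p \<in> U" and legs: "\<And>k. k < 3 \<Longrightarrow> unit_speed (c k) (L k) \<and> c k 0 = p"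
    and dir: "\<And>k. k < 3 \<Longrightarrow> \<exists>s>0. \<forall>u. 0 \<le> u \<longrightarrow> u < s \<longrightarrow> w (c k u) = w p + of_real u * e k"
    and e: "\<And>k. k < 3 \<Longrightarrow> cmod (e k) = 1" "e 0 + e 1 + e 2 = (0 :: complex)"
  shows "balanced p c"
proof -
  obtain r s0 where r: "r > 0" "s0 > 0" "ball p r \<subseteq> U" "ball (w p) s0 \<subseteq> w ` ball p r"
    "\<And>x y. x \<in> ball p r \<Longrightarrow> y \<in> ball p r \<Longrightarrow> dP x y = dist (w x) (w y)"
    using flat_chart_isometry[OF ch p] by metis
  have inj: "inj_on w (ball p r)" using ch r(3) by (auto simp: flat_chart_def intro: inj_on_subset)
  define g where "g = the_inv_into (ball p r) w"
  have g: "g v \<in> ball p r" "w (g v) = v" if "v \<in> ball (w p) s0" for v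
    using that r(4) the_inv_into_into[OF inj, of v "ball p r"] f_the_inv_into_f[OF inj, of v] unfolding g_def by blast+
  have gw: "g (w x) = x" if "x \<in> ball p r" for x unfolding g_def by (rule the_inv_into_f_f[OF inj that])
  define seg where "seg a b t = g (of_real (1 - t) * a + of_real t * b)" for a b and t :: real
  have seg_in: "of_real (1 - t) * a + of_real t * b \<in> ball (w p) s0"
    if "a \<in> ball (w p) s0" "b \<in> ball (w p) s0" "t \<in> {0..1}" for a b t
    using convexD[OF convex_ball that(1,2), of "1 - t" t] that(3) by (simp add: scaleR_conv_of_real)
  have seg: "local_geodesic (seg a b)" if ab: "a \<in> ball (w p) s0" "b \<in> ball (w p) s0" for a b
    unfolding local_geodesic_def
  proof (rule exI[of _ "cmod (b - a)"], intro conjI norm_ge_zero, rule exI[of _ 1], intro conjI zero_less_one ballI impI)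
    fix s t :: real assume st: "s \<in> {0..1}" "t \<in> {0..1}"
    have "dP (seg a b s) (seg a b t) = dist (of_real (1 - s) * a + of_real s * b) (of_real (1 - t) * a + of_real t * b)"
      unfolding seg_def using r(5)[OF g(1)[OF seg_in[OF ab st(1)]] g(1)[OF seg_in[OF ab st(2)]]]
        g(2)[OF seg_in[OF ab st(1)]] g(2)[OF seg_in[OF ab st(2)]] by simp
    also have "\<dots> = cmod (of_real (s - t) * (b - a))" by (simp add: dist_norm algebra_simps)
    also have "\<dots> = cmod (b - a) * \<bar>s - t\<bar>" by (simp add: norm_mult del: of_real_diff)
    finally show "dP (seg a b s) (seg a b t) = cmod (b - a) * \<bar>s - t\<bar>" .
  qed
  obtain h where h: "h > 0" "\<And>y. dP p y < h \<Longrightarrow> dist p y < r" using d_separates[OF r(1)] by metis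
  obtain s where s: "\<And>k. k < 3 \<Longrightarrow> s k > 0" "\<And>k u. k < 3 \<Longrightarrow> 0 \<le> u \<Longrightarrow> u < s k \<Longrightarrow> w (c k u) = w p + of_real u * e k"
    using dir by metis
  define s' where "s' = Min (insert h (insert s0 ((\<lambda>k. min (s k) (L k)) ` {..<3})))"
  have L: "L k > 0" if "k < 3" for k using legs[OF that] by (simp add: unit_speed_def)
  have "s' > 0" using h(1) r(2) s(1) L by (auto simp: s'_def)
  have s'_le: "s' \<le> h" "s' \<le> s0" unfolding s'_def by (intro Min_le; simp)+
  have s'_le': "s' \<le> min (s k) (L k)" if "k < 3" for k unfolding s'_def using that by (intro Min_le) auto
  show ?thesis unfolding balanced_def
  proof (intro exI[of _ s'] conjI allI impI \<open>s' > 0\<close>)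
    fix x assume x: "0 < x" "x < s'"
    define v where "v k = w p + of_real x * e k" for k
    have v_in: "v k \<in> ball (w p) s0" if "k < 3" for k
      using x s'_le e(1)[OF that] by (simp add: v_def dist_norm norm_mult)
    have wc: "w (c k x) = v k" "c k x \<in> ball p r" if "k < 3" for k
    proof -
      show "w (c k x) = v k" unfolding v_def using s(2)[OF that, of x] x s'_le'[OF that] by simp
      have "dP p (c k x) = x" using unit_speed_dist[of "c k" "L k" x] legs[OF that] x s'_le'[OF that] by simp
      then show "c k x \<in> ball p r" using h(2) x s'_le by simp
    qed
    have gv: "g (v k) = c k x" if "k < 3" for k using gw[OF wc(2)[OF that]] wc(1)[OF that] by simp
    let ?m = "of_real (1 - 1/2) * v 1 + of_real (1/2) * v 2"
    have m: "?m \<in> ball (w p) s0" using seg_in[of "v 1" "v 2" "1/2"] v_in by simp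
    have "of_real (1 - 2/3) * v 0 + of_real (2/3) * ?m = w p + of_real (x / 3) * (e 0 + e 1 + e 2)"
      by (simp add: v_def field_simps)
    then have bary: "of_real (1 - 2/3) * v 0 + of_real (2/3) * ?m = w p" unfolding e(2) by simp
    show "\<exists>\<sigma> \<tau>. local_geodesic \<sigma> \<and> local_geodesic \<tau> \<and> \<sigma> 0 = c 1 x \<and> \<sigma> 1 = c 2 x \<and> \<tau> 0 = c 0 x \<and> \<tau> 1 = \<sigma> (1/2) \<and> \<tau> (2/3) = p"
    proof (rule exI[of _ "seg (v 1) (v 2)"], rule exI[of _ "seg (v 0) ?m"], intro conjI)
      show "local_geodesic (seg (v 1) (v 2))" "local_geodesic (seg (v 0) ?m)"
        using v_in m by (intro seg; simp)+
      show "seg (v 0) ?m (2/3) = p" unfolding seg_def bary using gw[of p] r(1) by simp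
      show "seg (v 0) ?m 1 = seg (v 1) (v 2) (1/2)" unfolding seg_def by simp
    qed (simp_all add: seg_def gv)
  qed
qed

text \<open>
  All numberings are allowed, so that two tripods can be compared leg by leg whenever the sets of
  their starting points agree.
\<close>

lemma critical_tripod_legs:
  assumes "critical_tripod P \<gamma>"
  obtains p L c where
    "\<And>\<pi>. bij_betw \<pi> {..<3} {..<3} \<Longrightarrow> is_tripod p (L \<circ> \<pi>) (c \<circ> \<pi>)"
    "\<And>k. k < 3 \<Longrightarrow> c k (L k) = \<gamma> k 0 \<and> c k ` {0..L k} = path_image (\<gamma> k)"
    "inj_on (\<lambda>k. \<gamma> k 0) {..<3}"
proof -
  obtain \<theta> p U w where tr: "\<And>k. k < 3 \<Longrightarrow> trajectory P (\<gamma> k)" and fin: "\<And>k. k < 3 \<Longrightarrow> \<gamma> k 1 = p"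
    and ch: "flat_chart P U w" and p: "p \<in> U"
    and st: "\<And>k. k < 3 \<Longrightarrow> straight_in_chart U w (\<gamma> k) (\<theta> + 2 * pi * real k / 3) 1"
    using assms unfolding critical_tripod_def tripod_def pathfinish_def by metis
  \<comment> \<open>The minus sign reflects that the legs are oriented towards
    \<open>p\<close>.\<close>
  define e where "e k = - cis (\<theta> + 2 * pi * real k / 3)" for k
  have "\<exists>c L. unit_speed c L \<and> c 0 = p \<and> c L = \<gamma> k 0 \<and> c ` {0..L} = path_image (\<gamma> k) \<and>
      (\<exists>s>0. \<forall>u. 0 \<le> u \<longrightarrow> u < s \<longrightarrow> w (c u) = w p + of_real u * e k)" if k: "k < 3" for k
  proof -
    obtain L c where "unit_speed c L" "c 0 = \<gamma> k 1" "c L = \<gamma> k 0" "c ` {0..L} = path_image (\<gamma> k)"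
      "\<exists>s>0. \<forall>u. 0 \<le> u \<longrightarrow> u < s \<longrightarrow> w (c u) = w (\<gamma> k 1) - of_real u * cis (\<theta> + 2 * pi * real k / 3)"
      using trajectory_parameter[OF tr[OF k] ch st[OF k]] by metis
    then show ?thesis unfolding fin[OF k] e_def by (intro exI[of _ c] exI[of _ L]) auto
  qed
  then obtain c L where cL: "\<And>k. k < 3 \<Longrightarrow> unit_speed (c k) (L k) \<and> c k 0 = p"
    "\<And>k. k < 3 \<Longrightarrow> c k (L k) = \<gamma> k 0 \<and> c k ` {0..L k} = path_image (\<gamma> k)"
    "\<And>k. k < 3 \<Longrightarrow> \<exists>s>0. \<forall>u. 0 \<le> u \<longrightarrow> u < s \<longrightarrow> w (c k u) = w p + of_real u * e k"
    by metis
  have e1: "cmod (e k) = 1" for k by (simp add: e_def)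
  have rot: "e k = e 0 * cis (2 * pi * real k / 3)" for k by (simp add: e_def cis_mult)
  have c1: "cis (2 * pi / 3) = Complex (- 1 / 2) (sqrt 3 / 2)" "cis (4 * pi / 3) = Complex (- 1 / 2) (- sqrt 3 / 2)"
  proof -
    have "cos (2 * pi / 3) = - 1 / 2" "sin (2 * pi / 3) = sqrt 3 / 2"
      using cos_120 sin_120 by (simp_all add: mult.commute)
    then show 1: "cis (2 * pi / 3) = Complex (- 1 / 2) (sqrt 3 / 2)" by (simp add: complex_eq_iff)
    have "cis (4 * pi / 3) = cis (2 * pi / 3) * cis (2 * pi / 3)" by (simp add: cis_mult)
    then show "cis (4 * pi / 3) = Complex (- 1 / 2) (- sqrt 3 / 2)" unfolding 1 by (simp add: complex_eq_iff)
  qed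
  have e12: "e 1 = e 0 * Complex (- 1 / 2) (sqrt 3 / 2)" "e 2 = e 0 * Complex (- 1 / 2) (- sqrt 3 / 2)"
    using rot[of 1] rot[of 2] c1 by simp_all
  have e_sum: "e 0 + e 1 + e 2 = 0"
  proof -
    have "e 0 + e 1 + e 2 = e 0 * (1 + Complex (- 1 / 2) (sqrt 3 / 2) + Complex (- 1 / 2) (- sqrt 3 / 2))"
      unfolding e12 by (simp add: distrib_left)
    also have "1 + Complex (- 1 / 2) (sqrt 3 / 2) + Complex (- 1 / 2) (- sqrt 3 / 2) = 0" by (simp add: complex_eq_iff)
    finally show ?thesis by simp
  qed
  have e_inj: "inj_on e {..<3}"
  proof (rule inj_onI)
    fix i j :: nat assume ij: "i \<in> {..<3}" "j \<in> {..<3}" "e i = e j"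
    have "e 0 \<noteq> 0" using e1[of 0] by auto
    moreover have "Complex (- 1 / 2) (sqrt 3 / 2) \<noteq> 1" "Complex (- 1 / 2) (- sqrt 3 / 2) \<noteq> 1"
      "Complex (- 1 / 2) (sqrt 3 / 2) \<noteq> Complex (- 1 / 2) (- sqrt 3 / 2)"
      by (simp_all add: complex_eq_iff)
    ultimately have "e 0 \<noteq> e 1" "e 0 \<noteq> e 2" "e 1 \<noteq> e 2"
      unfolding e12 by simp_all
    then show "i = j" using ij by (auto simp: less_Suc_eq numeral_3_eq_3 numeral_2_eq_2)
  qed
  show ?thesis
  proof (rule that[OF _ cL(2)])
    fix \<pi> :: "nat \<Rightarrow> nat" assume \<pi>: "bij_betw \<pi> {..<3} {..<3}"
    have lt: "\<pi> k < 3" if "k < 3" for k using \<pi> that by (auto simp: bij_betw_def)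
    have "(\<Sum>k<3. e (\<pi> k)) = (\<Sum>k<3. e k)" by (rule sum.reindex_bij_betw[OF \<pi>])
    then have "e (\<pi> 0) + e (\<pi> 1) + e (\<pi> 2) = 0" using e_sum by (simp add: numeral_3_eq_3 numeral_2_eq_2)
    then have "balanced p (c \<circ> \<pi>)"
      by (intro balanced_from_chart[OF ch p, where e = "e \<circ> \<pi>" and L = "L \<circ> \<pi>"]) (use cL lt e1 in auto)
    then show "is_tripod p (L \<circ> \<pi>) (c \<circ> \<pi>)"
      using cL lt by (auto simp: is_tripod_def)
  next
    \<comment> \<open>Two legs from \<open>p\<close> to the same zero would coincide by uniqueness
      of geodesics, although their initial directions differ.\<close>
    show "inj_on (\<lambda>k. \<gamma> k 0) {..<3}"
    proof (rule inj_onI)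
      fix i j :: nat assume ij: "i \<in> {..<3}" "j \<in> {..<3}" "\<gamma> i 0 = \<gamma> j 0"
      then have i: "i < 3" and j: "j < 3" by auto
      have ends: "c i 0 = c j 0" "c i (L i) = c j (L j)" using cL ij by auto
      obtain s where s: "s > 0" "\<And>u. 0 \<le> u \<Longrightarrow> u < s \<Longrightarrow> w (c i u) = w p + of_real u * e i" using cL(3)[OF i] by metis
      obtain s' where s': "s' > 0" "\<And>u. 0 \<le> u \<Longrightarrow> u < s' \<Longrightarrow> w (c j u) = w p + of_real u * e j" using cL(3)[OF j] by metis
      define u where "u = min (L i) (min (s / 2) (s' / 2))"
      have u: "0 < u" "u \<le> L i" "u < s" "u < s'"
        using s(1) s'(1) cL(1)[OF i] by (auto simp: u_def unit_speed_def min_def)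
      have "c i u = c j u" using unit_speed_unique(2)[of "c i" "L i" "c j" "L j" u] cL(1)[OF i] cL(1)[OF j] ends u by simp
      then have "of_real u * e i = of_real u * e j" using s(2)[of u] s'(2)[of u] u by simp
      then have "e i = e j" using u(1) by simp
      then show "i = j" using e_inj ij by (auto dest: inj_onD)
    qed
  qed auto
qed

text \<open>Starting points of a tripod are distinct, so legs with a common starting point are
  matched by a permutation; uniqueness is applied after renumbering the second tripod.\<close>

lemma critical_tripods_eqI:
  assumes \<gamma>: "critical_tripod P \<gamma>" and \<gamma>': "critical_tripod P \<gamma>'"
    and eq: "(\<lambda>k. \<gamma> k 0) ` {..<3} = (\<lambda>k. \<gamma>' k 0) ` {..<3}"
  shows "(\<lambda>k. path_image (\<gamma> k)) ` {..<3} = (\<lambda>k. path_image (\<gamma>' k)) ` {..<3}"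
proof -
  obtain p L c where T: "\<And>\<pi>. bij_betw \<pi> {..<3} {..<3} \<Longrightarrow> is_tripod p (L \<circ> \<pi>) (c \<circ> \<pi>)"
    and c: "\<And>k. k < 3 \<Longrightarrow> c k (L k) = \<gamma> k 0 \<and> c k ` {0..L k} = path_image (\<gamma> k)"
    and inj: "inj_on (\<lambda>k. \<gamma> k 0) {..<3}"
    using critical_tripod_legs[OF \<gamma>] by metis
  obtain p' L' c' where T': "\<And>\<pi>. bij_betw \<pi> {..<3} {..<3} \<Longrightarrow> is_tripod p' (L' \<circ> \<pi>) (c' \<circ> \<pi>)"
    and c': "\<And>k. k < 3 \<Longrightarrow> c' k (L' k) = \<gamma>' k 0 \<and> c' k ` {0..L' k} = path_image (\<gamma>' k)"
    and inj': "inj_on (\<lambda>k. \<gamma>' k 0) {..<3}"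
    using critical_tripod_legs[OF \<gamma>'] by metis
  define \<pi> where "\<pi> = the_inv_into {..<3} (\<lambda>k. \<gamma>' k 0) \<circ> (\<lambda>k. \<gamma> k 0)"
  have "bij_betw (\<lambda>k. \<gamma> k 0) {..<3} ((\<lambda>k. \<gamma>' k 0) ` {..<3})" using inj eq by (simp add: bij_betw_def)
  moreover have "bij_betw (the_inv_into {..<3} (\<lambda>k. \<gamma>' k 0)) ((\<lambda>k. \<gamma>' k 0) ` {..<3}) {..<3}"
    using inj' by (intro bij_betw_the_inv_into) (simp add: bij_betw_def)
  ultimately have \<pi>: "bij_betw \<pi> {..<3} {..<3}" unfolding \<pi>_def by (rule bij_betw_trans)
  have lt: "\<pi> k < 3" if "k < 3" for k using \<pi> that by (auto simp: bij_betw_def)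
  have start: "\<gamma>' (\<pi> k) 0 = \<gamma> k 0" if "k < 3" for k
  proof -
    have "\<gamma> k 0 \<in> (\<lambda>k. \<gamma>' k 0) ` {..<3}" using that eq by blast
    from f_the_inv_into_f[OF inj' this] show ?thesis by (simp add: \<pi>_def)
  qed
  have tri: "is_tripod p L c" using T[OF bij_betw_id] by simp
  have ends: "c k (L k) = (c' \<circ> \<pi>) k ((L' \<circ> \<pi>) k)" if "k < 3" for k
    using c[OF that] c'[OF lt[OF that]] start[OF that] by simp
  have "path_image (\<gamma> k) = path_image (\<gamma>' (\<pi> k))" if k: "k < 3" for k
  proof -
    have "c k ` {0..L k} = c' (\<pi> k) ` {0..L' (\<pi> k)}"
      using tripod_unique[OF tri T'[OF \<pi>] ends k] by (auto intro!: image_cong)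
    then show ?thesis using c[OF k] c'[OF lt[OF k]] by simp
  qed
  then have "(\<lambda>k. path_image (\<gamma> k)) ` {..<3} = (\<lambda>k. path_image (\<gamma>' (\<pi> k))) ` {..<3}"
    by (intro image_cong) auto
  also have "\<dots> = (\<lambda>k. path_image (\<gamma>' k)) ` (\<pi> ` {..<3})" by (simp add: image_image)
  also have "\<pi> ` {..<3} = {..<3}" using \<pi> by (simp add: bij_betw_def)
  finally show ?thesis .
qed

end

section \<open>Counting triples of zeros\<close>

lemma three_subsets_bound:
  assumes "n \<le> d"
  shows "real (n choose 3) \<le> real d * (real d - 1) * (real d - 2) / 6"
proof -
  have "real (n choose 3) \<le> real (d choose 3)" using assms by (simp add: binomial_right_mono)
  \<comment> \<open>Over the reals nothing is truncated, and for \<open>d < 3\<close> one factor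
    vanishes, in agreement with the binomial coefficient.\<close>
  also have "real (d choose 3) = real d * (real d - 1) * (real d - 2) / 6"
    by (simp add: binomial_gbinomial gbinomial_prod_rev numeral_3_eq_3 prod.atLeast0_lessThan_Suc fact_numeral)
  finally show ?thesis .
qed

theorem corollary5p5:
  fixes P :: "complex poly" and d :: nat
  assumes "P \<noteq> 0" and "degree P = d"
  shows "finite (unoriented_critical_tripods P) \<and>
         real (card (unoriented_critical_tripods P)) \<le> real d * (real d - 1) * (real d - 2) / 6"
proof (cases "degree P = 0")
  \<comment> \<open>Without zeros there is no place where a leg could start.\<close>
  case True
  then have "poly P z \<noteq> 0" for z using assms(1) by (auto elim!: degree_eq_zeroE)
  then have "\<not> critical_tripod P \<gamma>" for \<gamma> unfolding critical_tripod_def by (auto intro!: exI[of _ 0])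
  then have "unoriented_critical_tripods P = {}" by (auto simp: unoriented_critical_tripods_def)
  then show ?thesis using True assms(2) by simp
next
  case False
  then interpret nonconstant_cubic P by unfold_locales simp
  define Z where "Z = {z. poly P z = 0}"
  have Z: "finite Z" "card Z \<le> d"
    using assms poly_roots_finite[OF assms(1)] card_poly_roots_bound[OF assms(1)] by (auto simp: Z_def)
  define S where "S = {A. A \<subseteq> Z \<and> card A = 3}"
  have S: "finite S" "card S = card Z choose 3" using Z(1) by (auto simp: S_def n_subsets)
  \<comment> \<open>A left inverse of the map from tripods to their sets of starting points: as
    those points determine the tripod, the choice does not matter, and every tripod is the value at
    its own triple.\<close>
  define tri where "tri A = (SOME T. \<exists>\<gamma>. critical_tripod P \<gamma> \<and> (\<lambda>k. \<gamma> k 0) ` {..<3} = A \<and> T = (\<lambda>k. path_image (\<gamma> k)) ` {..<3})" for A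
  have sub: "unoriented_critical_tripods P \<subseteq> tri ` S"
  proof
    fix T assume "T \<in> unoriented_critical_tripods P"
    then obtain \<gamma> where \<gamma>: "critical_tripod P \<gamma>" "T = (\<lambda>k. path_image (\<gamma> k)) ` {..<3}"
      by (auto simp: unoriented_critical_tripods_def)
    let ?A = "(\<lambda>k. \<gamma> k 0) ` {..<3}"
    have "?A \<subseteq> Z" using \<gamma>(1) by (auto simp: critical_tripod_def pathstart_def Z_def)
    moreover obtain "inj_on (\<lambda>k. \<gamma> k 0) {..<3}" using critical_tripod_legs[OF \<gamma>(1)] by metis
    then have "card ?A = 3" by (simp add: card_image)
    ultimately have "?A \<in> S" by (simp add: S_def)
    have "\<exists>\<gamma>'. critical_tripod P \<gamma>' \<and> (\<lambda>k. \<gamma>' k 0) ` {..<3} = ?A \<and> tri ?A = (\<lambda>k. path_image (\<gamma>' k)) ` {..<3}"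
      unfolding tri_def by (rule someI[of _ T]) (use \<gamma> in blast)
    then have "tri ?A = T" using critical_tripods_eqI \<gamma> by metis
    then show "T \<in> tri ` S" using \<open>?A \<in> S\<close> by blast
  qed
  have "finite (unoriented_critical_tripods P)" using sub S(1) finite_surj by blast
  moreover have "card (unoriented_critical_tripods P) \<le> card Z choose 3"
    using surj_card_le[OF S(1) sub] S(2) by simp
  then have "real (card (unoriented_critical_tripods P)) \<le> real (card Z choose 3)" by simp
  ultimately show ?thesis using three_subsets_bound[OF Z(2)] by linarith
qed

end
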